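(* Let $M$ be a smooth manifold with an affine (not necessarily torsion free) connection $\nabla$ on its tangent bundle, with curvature $R$ and torsion $T$, and let $p\in M$. The infinite order Taylor series in $0\in T_pM$ of the backward parallel transport $\Phi^{-1}:T_pM\to\mathrm{End}\,T_pM$ is characterized, as a formal power series $\Phi^{-1}\in\overline{\mathrm{Sym}}\,T_p^*M\otimes\mathrm{End}\,T_pM$ with initial value $\Phi^{-1}(0)=\mathrm{id}$, as the unique solution of the formal differential equation $$N(N+1)\,\Phi^{-1}=\mathscr R\,\Phi^{-1}+N(\mathscr T\,\Phi^{-1}),$$ where $N$ is the number operator on power series and $$\mathscr R(X)Y:=\sum_{k\ge0}\frac1{k!}(\nabla^k_{X,\ldots,X}R)_{X,Y}X,\qquad \mathscr T(X)Y:=\sum_{k\ge0}\frac1{k!}(\nabla^k_{X,\ldots,X}T)(X,Y)$$ with all tensors evaluated at $p$.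
   Context: Conventions: $R_{X,Y}Z=\nabla_X\nabla_YZ-\nabla_Y\nabla_XZ-\nabla_{[X,Y]}Z$, $T(X,Y)=\nabla_XY-\nabla_YX-[X,Y]$, and iterated covariant derivatives are defined by $\nabla^{k+1}_{Z,X_1,\ldots,X_k}=(\nabla_Z\nabla^k)_{X_1,\ldots,X_k}$. $\overline{\mathrm{Sym}}\,T_p^*M\otimes\mathrm{End}\,T_pM$ is the space of formal power series on $T_pM$ with values in $\mathrm{End}\,T_pM$. The number operator $N$ multiplies the component homogeneous of degree $n$ by $n$. Products such as $\mathscr R\,\Phi^{-1}$ are pointwise compositions: $(\mathscr R\,\Phi^{-1})(X)=\mathscr R(X)\circ\Phi^{-1}(X)$. $\exp_p$ is the exponential map of $\nabla$ (value at time $1$ of the geodesic with initial velocity $X$). $\mathrm{PT}^\nabla(X):T_pM\to T_{\exp_pX}M$ is parallel transport along the geodesic $t\mapsto\exp_p(tX)$, $0\le t\le1$. The backward parallel transport is $\Phi^{-1}(X):=\mathrm{PT}^\nabla(X)^{-1}\circ(\exp_p)_{*,X}$, an endomorphism of $T_pM$ under the identification $T_X(T_pM)\cong T_pM$; it is defined for $X$ in the domain of $\exp_p$, in particular near $0$. *)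

theory Defs
  imports "HOL-Analysis.Analysis"
begin

section \<open>Smooth maps between normed spaces\<close>

text \<open>Only used on open subsets of a finite-dimensional space, where requiring continuous
  directional derivatives of every order is the usual notion of a smooth map.\<close>

fun higher_differentiable_on ::
  "'a::real_normed_vector set \<Rightarrow> ('a \<Rightarrow> 'b::real_normed_vector) \<Rightarrow> nat \<Rightarrow> bool" where
  "higher_differentiable_on S f 0 \<longleftrightarrow> continuous_on S f"
| "higher_differentiable_on S f (Suc n) \<longleftrightarrow>
     (\<forall>x\<in>S. f differentiable (at x)) \<and>
     (\<forall>v. higher_differentiable_on S (\<lambda>x. frechet_derivative f (at x) v) n)"

definition smooth_on :: "'a::real_normed_vector set \<Rightarrow> ('a \<Rightarrow> 'b::real_normed_vector) \<Rightarrow> bool" where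
  "smooth_on S f \<longleftrightarrow> (\<forall>n. higher_differentiable_on S f n)"

text \<open>\<open>diag_derivative n f x v\<close> is \<open>D\<^sup>n f(x)(v, \<dots>, v)\<close>.\<close>

fun diag_derivative ::
  "nat \<Rightarrow> ('a::real_normed_vector \<Rightarrow> 'b::real_normed_vector) \<Rightarrow> 'a \<Rightarrow> 'a \<Rightarrow> 'b" where
  "diag_derivative 0 f x v = f x"
| "diag_derivative (Suc n) f x v = diag_derivative n (\<lambda>y. frechet_derivative f (at y) v) x v"


section \<open>Formal power series on a vector space\<close>

text \<open>A formal power series on \<open>'e\<close> with values in \<open>'b\<close> is the sequence of its homogeneous
  components, each of them given as a polynomial function. A function of \<open>n\<close> variables is
  encoded as a function on lists, of which only the values on lists of length \<open>n\<close> matter.\<close>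

definition multilinear :: "nat \<Rightarrow> ('e::real_vector list \<Rightarrow> 'b::real_vector) \<Rightarrow> bool" where
  "multilinear n B \<longleftrightarrow>
     (\<forall>xs. length xs = n \<longrightarrow> (\<forall>i<n. linear (\<lambda>v. B (xs[i := v]))))"

definition homogeneous_polynomial :: "nat \<Rightarrow> ('e::real_vector \<Rightarrow> 'b::real_vector) \<Rightarrow> bool" where
  "homogeneous_polynomial n P \<longleftrightarrow> (\<exists>B. multilinear n B \<and> (\<forall>x. P x = B (replicate n x)))"

type_synonym ('e, 'b) series = "nat \<Rightarrow> 'e \<Rightarrow> 'b"

definition formal_power_series :: "('e::real_vector, 'b::real_vector) series \<Rightarrow> bool" where
  "formal_power_series F \<longleftrightarrow> (\<forall>n. homogeneous_polynomial n (F n))"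

definition series_add :: "('e, 'b::real_vector) series \<Rightarrow> ('e, 'b) series \<Rightarrow> ('e, 'b) series" where
  "series_add F G = (\<lambda>n x. F n x + G n x)"

text \<open>The pointwise composition \<open>x \<mapsto> F(x) \<circ> G(x)\<close> of endomorphism-valued series, sorted by degree.\<close>

definition series_comp ::
  "('e, 'e::real_normed_vector \<Rightarrow>\<^sub>L 'e) series \<Rightarrow> ('e, 'e \<Rightarrow>\<^sub>L 'e) series \<Rightarrow> ('e, 'e \<Rightarrow>\<^sub>L 'e) series" where
  "series_comp F G = (\<lambda>n x. \<Sum>i\<le>n. F i x o\<^sub>L G (n - i) x)"

definition number_op :: "('e, 'b::real_vector) series \<Rightarrow> ('e, 'b) series" where
  "number_op F = (\<lambda>n x. real n *\<^sub>R F n x)"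

definition taylor_series :: "('e::real_normed_vector \<Rightarrow> 'b::real_normed_vector) \<Rightarrow> ('e, 'b) series" where
  "taylor_series f = (\<lambda>n x. (1 / fact n) *\<^sub>R diag_derivative n f 0 x)"


section \<open>Smooth manifolds\<close>

text \<open>A manifold is carried by a whole type \<open>'m\<close> and modelled on \<open>'e\<close>; its dimension is
  \<open>DIM('e)\<close>. A chart is a domain together with a map. The atlas need not be maximal.
  The field \<open>chart_at\<close> chooses a chart around each point. It serves to realise each tangent
  space \<open>T\<^sub>q M\<close> as the type \<open>'e\<close>: a vector of \<open>'e\<close>, regarded as an element of \<open>T\<^sub>q M\<close>, is
  the tangent vector with these components in the chart \<open>chart_at M q\<close>. Hence a vector field is a
  function \<open>'m \<Rightarrow> 'e\<close>, whose regularity has to be tested in the charts of the atlas.\<close>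

type_synonym ('m, 'e) chart = "'m set \<times> ('m \<Rightarrow> 'e)"

record ('m, 'e) manifold =
  atlas :: "('m, 'e) chart set"
  chart_at :: "'m \<Rightarrow> ('m, 'e) chart"

abbreviation chart_dom :: "('m, 'e) chart \<Rightarrow> 'm set" where
  "chart_dom \<equiv> fst"

abbreviation chart_map :: "('m, 'e) chart \<Rightarrow> 'm \<Rightarrow> 'e" where
  "chart_map \<equiv> snd"

definition chart_inv :: "('m, 'e) chart \<Rightarrow> 'e \<Rightarrow> 'm" where
  "chart_inv c = inv_into (chart_dom c) (chart_map c)"

locale smooth_manifold =
  fixes M :: "('m::{t2_space, second_countable_topology}, 'e::euclidean_space) manifold"
  assumes open_chart_dom: "c \<in> atlas M \<Longrightarrow> open (chart_dom c)"
    and open_chart_image: "c \<in> atlas M \<Longrightarrow> open (chart_map c ` chart_dom c)"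
    and chart_homeomorphism: "c \<in> atlas M \<Longrightarrow>
      homeomorphism (chart_dom c) (chart_map c ` chart_dom c) (chart_map c) (chart_inv c)"
    and smooth_transition: "\<lbrakk>c \<in> atlas M; d \<in> atlas M\<rbrakk> \<Longrightarrow>
      smooth_on (chart_map c ` (chart_dom c \<inter> chart_dom d)) (chart_map d \<circ> chart_inv c)"
    and chart_at_atlas: "chart_at M q \<in> atlas M"
    and chart_at_dom: "q \<in> chart_dom (chart_at M q)"

text \<open>The differential at \<open>q\<close> of the chart \<open>c\<close>, as a map \<open>T\<^sub>q M \<rightarrow> 'e\<close>: it sends a tangent
  vector to its components in \<open>c\<close>.\<close>

definition components ::
  "('m, 'e::euclidean_space) manifold \<Rightarrow> ('m, 'e) chart \<Rightarrow> 'm \<Rightarrow> 'e \<Rightarrow> 'e" where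
  "components M c q v =
     frechet_derivative (chart_map c \<circ> chart_inv (chart_at M q)) (at (chart_map (chart_at M q) q)) v"

definition local_rep ::
  "('m, 'e::euclidean_space) manifold \<Rightarrow> ('m, 'e) chart \<Rightarrow> ('m \<Rightarrow> 'e) \<Rightarrow> 'e \<Rightarrow> 'e" where
  "local_rep M c X x = components M c (chart_inv c x) (X (chart_inv c x))"

definition smooth_fun_on ::
  "('m, 'e::euclidean_space) manifold \<Rightarrow> 'm set \<Rightarrow> ('m \<Rightarrow> real) \<Rightarrow> bool" where
  "smooth_fun_on M U f \<longleftrightarrow>
     (\<forall>c\<in>atlas M. smooth_on (chart_map c ` (U \<inter> chart_dom c)) (f \<circ> chart_inv c))"

definition smooth_field_on ::
  "('m, 'e::euclidean_space) manifold \<Rightarrow> 'm set \<Rightarrow> ('m \<Rightarrow> 'e) \<Rightarrow> bool" where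
  "smooth_field_on M U X \<longleftrightarrow>
     (\<forall>c\<in>atlas M. smooth_on (chart_map c ` (U \<inter> chart_dom c)) (local_rep M c X))"

definition directional_derivative ::
  "('m, 'e::euclidean_space) manifold \<Rightarrow> ('m \<Rightarrow> 'e) \<Rightarrow> ('m \<Rightarrow> real) \<Rightarrow> 'm \<Rightarrow> real" where
  "directional_derivative M X f q =
     frechet_derivative (f \<circ> chart_inv (chart_at M q)) (at (chart_map (chart_at M q) q)) (X q)"

definition lie_bracket ::
  "('m, 'e::euclidean_space) manifold \<Rightarrow> ('m \<Rightarrow> 'e) \<Rightarrow> ('m \<Rightarrow> 'e) \<Rightarrow> 'm \<Rightarrow> 'e" where
  "lie_bracket M X Y q =
     (let c = chart_at M q; x = chart_map c q in
        frechet_derivative (local_rep M c Y) (at x) (X q)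
      - frechet_derivative (local_rep M c X) (at x) (Y q))"


section \<open>Affine connections\<close>

type_synonym ('m, 'e) connection = "('m \<Rightarrow> 'e) \<Rightarrow> ('m \<Rightarrow> 'e) \<Rightarrow> 'm \<Rightarrow> 'e"

text \<open>\<open>D X Y\<close> is \<open>\<nabla>\<^sub>X Y\<close>. The axioms are those of a Koszul connection on the vector
  fields over every open set \<open>U\<close>, together with compatibility with restriction. The values of
  \<open>D X Y\<close> where \<open>X\<close> or \<open>Y\<close> fail to be smooth are irrelevant.\<close>

locale affine_connection = smooth_manifold M
  for M :: "('m::{t2_space, second_countable_topology}, 'e::euclidean_space) manifold" +
  fixes D :: "('m, 'e) connection"
  assumes connection_smooth:
    "\<lbrakk>open U; smooth_field_on M U X; smooth_field_on M U Y\<rbrakk> \<Longrightarrow> smooth_field_on M U (D X Y)"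
    and connection_local:
    "\<lbrakk>open U; smooth_field_on M U X; smooth_field_on M U Y;
      \<And>q. q \<in> U \<Longrightarrow> X' q = X q; \<And>q. q \<in> U \<Longrightarrow> Y' q = Y q; q \<in> U\<rbrakk>
      \<Longrightarrow> D X' Y' q = D X Y q"
    and connection_add_left:
    "\<lbrakk>open U; smooth_field_on M U X; smooth_field_on M U X'; smooth_field_on M U Y; q \<in> U\<rbrakk>
      \<Longrightarrow> D (\<lambda>r. X r + X' r) Y q = D X Y q + D X' Y q"
    and connection_scale_left:
    "\<lbrakk>open U; smooth_fun_on M U f; smooth_field_on M U X; smooth_field_on M U Y; q \<in> U\<rbrakk>
      \<Longrightarrow> D (\<lambda>r. f r *\<^sub>R X r) Y q = f q *\<^sub>R D X Y q"
    and connection_add_right: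
    "\<lbrakk>open U; smooth_field_on M U X; smooth_field_on M U Y; smooth_field_on M U Y'; q \<in> U\<rbrakk>
      \<Longrightarrow> D X (\<lambda>r. Y r + Y' r) q = D X Y q + D X Y' q"
    and connection_leibniz:
    "\<lbrakk>open U; smooth_fun_on M U f; smooth_field_on M U X; smooth_field_on M U Y; q \<in> U\<rbrakk>
      \<Longrightarrow> D X (\<lambda>r. f r *\<^sub>R Y r) q = directional_derivative M X f q *\<^sub>R Y q + f q *\<^sub>R D X Y q"


section \<open>Curvature, torsion and their iterated covariant derivatives\<close>

text \<open>A tensor field with vector field values is an operator on lists of vector fields.\<close>

type_synonym ('m, 'e) tensor_field = "('m \<Rightarrow> 'e) list \<Rightarrow> 'm \<Rightarrow> 'e"

definition curvature ::
  "('m, 'e::euclidean_space) manifold \<Rightarrow> ('m, 'e) connection \<Rightarrow>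
   ('m \<Rightarrow> 'e) \<Rightarrow> ('m \<Rightarrow> 'e) \<Rightarrow> ('m \<Rightarrow> 'e) \<Rightarrow> 'm \<Rightarrow> 'e" where
  "curvature M D X Y Z = (\<lambda>q. D X (D Y Z) q - D Y (D X Z) q - D (lie_bracket M X Y) Z q)"

definition torsion ::
  "('m, 'e::euclidean_space) manifold \<Rightarrow> ('m, 'e) connection \<Rightarrow>
   ('m \<Rightarrow> 'e) \<Rightarrow> ('m \<Rightarrow> 'e) \<Rightarrow> 'm \<Rightarrow> 'e" where
  "torsion M D X Y = (\<lambda>q. D X Y q - D Y X q - lie_bracket M X Y q)"

text \<open>The arguments of the curvature tensor are listed as \<open>[X, Y, Z]\<close> for \<open>R\<^bsub>X,Y\<^esub> Z\<close>.\<close>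

definition curvature_tensor ::
  "('m, 'e::euclidean_space) manifold \<Rightarrow> ('m, 'e) connection \<Rightarrow> ('m, 'e) tensor_field" where
  "curvature_tensor M D Xs = curvature M D (Xs ! 0) (Xs ! 1) (Xs ! 2)"

definition torsion_tensor ::
  "('m, 'e::euclidean_space) manifold \<Rightarrow> ('m, 'e) connection \<Rightarrow> ('m, 'e) tensor_field" where
  "torsion_tensor M D Xs = torsion M D (Xs ! 0) (Xs ! 1)"

text \<open>The direction of differentiation is inserted in front of the list of arguments, so that
  the iterates \<open>(covariant_derivative D ^^ k) S\<close> follow the convention
  \<open>\<nabla>\<^sup>k\<^sup>+\<^sup>1\<^bsub>Z, X1, \<dots>, Xk\<^esub> S = (\<nabla>\<^sub>Z (\<nabla>\<^sup>k S))\<^bsub>X1, \<dots>, Xk\<^esub>\<close>.\<close>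

fun covariant_derivative ::
  "('m, 'e::real_vector) connection \<Rightarrow> ('m, 'e) tensor_field \<Rightarrow> ('m, 'e) tensor_field" where
  "covariant_derivative D S [] = (\<lambda>q. 0)"
| "covariant_derivative D S (Z # Xs) =
     (\<lambda>q. D Z (S Xs) q - (\<Sum>i<length Xs. S (Xs[i := D Z (Xs ! i)]) q))"

text \<open>The vector field with constant components in the chart chosen at \<open>p\<close> and with value
  \<open>v\<close> at \<open>p\<close>.\<close>

definition coordinate_field ::
  "('m, 'e::euclidean_space) manifold \<Rightarrow> 'm \<Rightarrow> 'e \<Rightarrow> 'm \<Rightarrow> 'e" where
  "coordinate_field M p v q =
     (if q \<in> chart_dom (chart_at M p)
      then frechet_derivative (chart_map (chart_at M q) \<circ> chart_inv (chart_at M p))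
             (at (chart_map (chart_at M p) q)) v
      else 0)"

text \<open>Evaluation of a tensor field on tangent vectors at \<open>p\<close>; by tensoriality every
  other smooth extension of the vectors gives the same value.\<close>

definition tensor_at ::
  "('m, 'e::euclidean_space) manifold \<Rightarrow> ('m, 'e) tensor_field \<Rightarrow> 'm \<Rightarrow> 'e list \<Rightarrow> 'e" where
  "tensor_at M S p vs = S (map (coordinate_field M p) vs) p"

text \<open>The \<open>k\<close>-th summand \<open>(1/k!) (\<nabla>\<^sup>k\<^bsub>X,\<dots>,X\<^esub> R)\<^bsub>X,Y\<^esub> X\<close> is homogeneous of
  degree \<open>k + 2\<close> in \<open>X\<close>, and \<open>(1/k!) (\<nabla>\<^sup>k\<^bsub>X,\<dots>,X\<^esub> T)(X,Y)\<close> is homogeneous of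
  degree \<open>k + 1\<close>.\<close>

definition curvature_series ::
  "('m, 'e::euclidean_space) manifold \<Rightarrow> ('m, 'e) connection \<Rightarrow> 'm \<Rightarrow> ('e, 'e \<Rightarrow>\<^sub>L 'e) series" where
  "curvature_series M D p = (\<lambda>n X. \<Sum>k | k + 2 = n.
     (1 / fact k) *\<^sub>R Blinfun (\<lambda>Y.
        tensor_at M ((covariant_derivative D ^^ k) (curvature_tensor M D)) p
          (replicate k X @ [X, Y, X])))"

definition torsion_series ::
  "('m, 'e::euclidean_space) manifold \<Rightarrow> ('m, 'e) connection \<Rightarrow> 'm \<Rightarrow> ('e, 'e \<Rightarrow>\<^sub>L 'e) series" where
  "torsion_series M D p = (\<lambda>n X. \<Sum>k | k + 1 = n.
     (1 / fact k) *\<^sub>R Blinfun (\<lambda>Y.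
        tensor_at M ((covariant_derivative D ^^ k) (torsion_tensor M D)) p
          (replicate k X @ [X, Y])))"


section \<open>Geodesics, exponential map and parallel transport\<close>

text \<open>Curves are parametrised by \<open>{0..1}\<close>, with one-sided derivatives at the end points;
  their values elsewhere are irrelevant.\<close>

definition has_velocity ::
  "('m, 'e::euclidean_space) manifold \<Rightarrow> (real \<Rightarrow> 'm) \<Rightarrow> 'e \<Rightarrow> real \<Rightarrow> bool" where
  "has_velocity M \<gamma> u t \<longleftrightarrow>
     ((\<lambda>s. chart_map (chart_at M (\<gamma> t)) (\<gamma> s)) has_vector_derivative u) (at t within {0..1})"

text \<open>\<open>\<Gamma>(u, v)\<close> at \<open>q\<close>, with respect to the chart chosen at \<open>q\<close>.\<close>

definition christoffel ::
  "('m, 'e::euclidean_space) manifold \<Rightarrow> ('m, 'e) connection \<Rightarrow> 'm \<Rightarrow> 'e \<Rightarrow> 'e \<Rightarrow> 'e" where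
  "christoffel M D q u v = D (coordinate_field M q u) (coordinate_field M q v) q"

text \<open>The vector field \<open>V\<close> along \<open>\<gamma>\<close> has the covariant derivative \<open>w\<close> at time \<open>t\<close>, that is
  \<open>w = V' + \<Gamma>(\<gamma>', V)\<close> in the chart chosen at \<open>\<gamma> t\<close>.\<close>

definition has_covariant_derivative ::
  "('m, 'e::euclidean_space) manifold \<Rightarrow> ('m, 'e) connection \<Rightarrow>
   (real \<Rightarrow> 'm) \<Rightarrow> (real \<Rightarrow> 'e) \<Rightarrow> 'e \<Rightarrow> real \<Rightarrow> bool" where
  "has_covariant_derivative M D \<gamma> V w t \<longleftrightarrow>
     (\<exists>u V'. has_velocity M \<gamma> u t \<and>
        ((\<lambda>s. components M (chart_at M (\<gamma> t)) (\<gamma> s) (V s)) has_vector_derivative V')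
           (at t within {0..1}) \<and>
        w = V' + christoffel M D (\<gamma> t) u (V t))"

definition parallel_along ::
  "('m::topological_space, 'e::euclidean_space) manifold \<Rightarrow> ('m, 'e) connection \<Rightarrow>
   (real \<Rightarrow> 'm) \<Rightarrow> (real \<Rightarrow> 'e) \<Rightarrow> bool" where
  "parallel_along M D \<gamma> V \<longleftrightarrow>
     continuous_on {0..1} \<gamma> \<and> (\<forall>t\<in>{0..1}. has_covariant_derivative M D \<gamma> V 0 t)"

definition geodesic_from ::
  "('m::topological_space, 'e::euclidean_space) manifold \<Rightarrow> ('m, 'e) connection \<Rightarrow>
   'm \<Rightarrow> 'e \<Rightarrow> (real \<Rightarrow> 'm) \<Rightarrow> bool" where
  "geodesic_from M D p X \<gamma> \<longleftrightarrow>
     \<gamma> 0 = p \<and>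
     (\<exists>V. V 0 = X \<and> (\<forall>t\<in>{0..1}. has_velocity M \<gamma> (V t) t) \<and> parallel_along M D \<gamma> V)"

definition exp_domain ::
  "('m::topological_space, 'e::euclidean_space) manifold \<Rightarrow> ('m, 'e) connection \<Rightarrow> 'm \<Rightarrow> 'e set" where
  "exp_domain M D p = {X. \<exists>\<gamma>. geodesic_from M D p X \<gamma>}"

definition exp_map ::
  "('m::topological_space, 'e::euclidean_space) manifold \<Rightarrow> ('m, 'e) connection \<Rightarrow> 'm \<Rightarrow> 'e \<Rightarrow> 'm" where
  "exp_map M D p X = (THE q. \<exists>\<gamma>. geodesic_from M D p X \<gamma> \<and> \<gamma> 1 = q)"

definition parallel_transport ::
  "('m::topological_space, 'e::euclidean_space) manifold \<Rightarrow> ('m, 'e) connection \<Rightarrow>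
   (real \<Rightarrow> 'm) \<Rightarrow> 'e \<Rightarrow> 'e" where
  "parallel_transport M D \<gamma> v = (THE w. \<exists>V. parallel_along M D \<gamma> V \<and> V 0 = v \<and> V 1 = w)"

definition radial_transport ::
  "('m::topological_space, 'e::euclidean_space) manifold \<Rightarrow> ('m, 'e) connection \<Rightarrow>
   'm \<Rightarrow> 'e \<Rightarrow> 'e \<Rightarrow> 'e" where
  "radial_transport M D p X = parallel_transport M D (\<lambda>t. exp_map M D p (t *\<^sub>R X))"

text \<open>The differential \<open>(exp\<^sub>p)\<^bsub>*,X\<^esub>\<close>, from \<open>T\<^sub>X(T\<^sub>p M) = T\<^sub>p M\<close> to the tangent space at \<open>exp\<^sub>p X\<close>.\<close>

definition exp_differential ::
  "('m::topological_space, 'e::euclidean_space) manifold \<Rightarrow> ('m, 'e) connection \<Rightarrow>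
   'm \<Rightarrow> 'e \<Rightarrow> 'e \<Rightarrow> 'e" where
  "exp_differential M D p X =
     frechet_derivative (chart_map (chart_at M (exp_map M D p X)) \<circ> exp_map M D p) (at X)"

definition backward_transport ::
  "('m::topological_space, 'e::euclidean_space) manifold \<Rightarrow> ('m, 'e) connection \<Rightarrow>
   'm \<Rightarrow> 'e \<Rightarrow> ('e \<Rightarrow>\<^sub>L 'e)" where
  "backward_transport M D p X =
     Blinfun (inv (radial_transport M D p X) \<circ> exp_differential M D p X)"


section \<open>The formal differential equation\<close>

definition transport_equation ::
  "('m, 'e::euclidean_space) manifold \<Rightarrow> ('m, 'e) connection \<Rightarrow> 'm \<Rightarrow>
   ('e, 'e \<Rightarrow>\<^sub>L 'e) series \<Rightarrow> bool" where
  "transport_equation M D p F \<longleftrightarrow>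
     number_op (series_add (number_op F) F) =
     series_add (series_comp (curvature_series M D p) F)
       (number_op (series_comp (torsion_series M D p) F))"

end

theory Submission
  imports Defs
begin

text \<open>
  In the chart at \<open>p\<close>, let \<open>E\<close> be the exponential map, \<open>P(X)\<close> the parallel transport along
  \<open>t \<mapsto> exp\<^sub>p(tX)\<close> and \<open>V(X) = P(X) X\<close>. With the radial derivative \<open>N f(X) = Df(X) X\<close>, the
  geodesic equation reads \<open>N E = V\<close>, \<open>N V = V - \<Gamma>(V, V)\<close>. Put \<open>J = \<partial>\<^bsub>Y\<^esub> E\<close>; the commutation
  \<open>N \<partial>\<^bsub>Y\<^esub> = \<partial>\<^bsub>Y\<^esub> N - \<partial>\<^bsub>Y\<^esub>\<close> gives \<open>(N + 1) J = \<partial>\<^bsub>Y\<^esub> V\<close>. Hence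
  \<open>(N + 1) P\<inverse> J = m + P\<inverse> T(V, J)\<close> with \<open>m = P\<inverse> (\<partial>\<^bsub>Y\<^esub> V + \<Gamma>(J, V))\<close>, and
  \<open>N m = P\<inverse> R(V, J) V\<close>: the Jacobi equation holds as an identity of smooth functions near \<open>0\<close>. On
  Taylor series \<open>N\<close> becomes the number operator. The coefficients of \<open>P\<inverse> R(V, P Y) V\<close> and
  \<open>P\<inverse> T(V, P Y)\<close> are read off along a ray, where differentiating a tensor transported back to
  \<open>p\<close> amounts to a covariant derivative in the direction \<open>X\<close>. Uniqueness of the formal solution
  is a recursion, since \<open>n(n + 1) \<noteq> 0\<close> for \<open>n > 0\<close> and the two coefficient series have no constant term.

  Smoothness of \<open>E\<close> and \<open>P\<close> comes from a Picard iteration that is a contraction for the sup norm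
  without shrinking the time interval, because small initial velocities scale the vector field down.
  The solution is then a smooth function of the parameters with values in a Banach space of curves,
  by bootstrapping the linearised fixed point equation.
\<close>

section \<open>Smooth maps\<close>

text \<open>The chart chosen at a point varies with the point without any continuity, so curves and
  fields are moved to the single chart at \<open>p\<close>. There the connection is a family of
  bilinear maps on an open set, and the manifold returns only to identify geodesics, exp and
  transport. A geodesic in the sense of the definitions might leave that chart; excluding this takes
  a connectedness argument that uses the Hausdorff property. Smoothness speaks of derivatives in
  fixed directions, whereas the chain rule produces directions that vary with the point. On a
  Euclidean domain a basis expansion repairs this. On the Banach space of curves it does not, so
  substitution into a curve is differentiated by hand. N(N + 1) is reached by two first order steps
  instead of a second covariant derivative: the first leaves the torsion term undifferentiated, the
  second puts it under N, which is the shape of the formal equation. Radial identities degenerate at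
  the origin, so the derivatives there are recorded separately.\<close>

lemma frechet_derivative_cong_open:
  assumes "open S" "x \<in> S" "\<And>y. y \<in> S \<Longrightarrow> f y = g y"
  shows "frechet_derivative f (at x) = frechet_derivative g (at x)"
proof -
  \<comment> \<open>All candidates for a derivative coincide, so the choice operator in
    \<open>frechet_derivative\<close> picks the same one, differentiable or not.\<close>
  have "(f has_derivative D) (at x) \<longleftrightarrow> (g has_derivative D) (at x)" for D
    using has_derivative_transform_within_open[of f D x UNIV S g]
      has_derivative_transform_within_open[of g D x UNIV S f] assms by (metis)
  then show ?thesis unfolding frechet_derivative_def by simp
qed

lemma frechet_derivative_eq:
  "(f has_derivative f') (at x) \<Longrightarrow> frechet_derivative f (at x) = f'"
  using frechet_derivative_at by metis

lemma frechet_derivative_has_derivative: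
  "f differentiable (at x) \<Longrightarrow> (f has_derivative frechet_derivative f (at x)) (at x)"
  using frechet_derivative_works by blast

lemma higher_differentiable_on_cong:
  assumes "open S" "\<And>x. x \<in> S \<Longrightarrow> f x = g x" "higher_differentiable_on S f n"
  shows "higher_differentiable_on S g n"
  using assms(2,3)
proof (induction n arbitrary: f g)
  case 0
  then show ?case using continuous_on_cong by force
next
  case (Suc n)
  have "g differentiable at x" if "x \<in> S" for x
  proof -
    have "f differentiable at x" using Suc.prems that by auto
    then show ?thesis
      using has_derivative_transform_within_open[of f _ x UNIV S g] that \<open>open S\<close> Suc.prems(1)
      unfolding differentiable_def by blast
  qed
  moreover have "higher_differentiable_on S (\<lambda>x. frechet_derivative g (at x) v) n" for v
    using Suc.IH[of "\<lambda>x. frechet_derivative f (at x) v" "\<lambda>x. frechet_derivative g (at x) v"]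
      Suc.prems frechet_derivative_cong_open[OF \<open>open S\<close> _ Suc.prems(1)] by auto
  ultimately show ?case by simp
qed

text \<open>Lets the closure properties below exhibit the derivative by a formula; replacing it by
  \<open>frechet_derivative\<close> is legitimate because both agree on the open set
  \<open>S\<close>.\<close>

lemma higher_differentiable_on_SucI:
  assumes "open S" "\<And>x. x \<in> S \<Longrightarrow> (f has_derivative f' x) (at x)"
    "\<And>v. higher_differentiable_on S (\<lambda>x. f' x v) n"
  shows "higher_differentiable_on S f (Suc n)"
proof -
  have "higher_differentiable_on S (\<lambda>x. frechet_derivative f (at x) v) n" for v
    by (rule higher_differentiable_on_cong[OF assms(1) _ assms(3)[of v]])
      (simp add: frechet_derivative_eq[OF assms(2)])
  then show ?thesis using assms(2) by (auto simp: differentiable_def)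
qed

lemma higher_differentiable_on_SucD:
  "higher_differentiable_on S f (Suc n) \<Longrightarrow> higher_differentiable_on S f n"
proof (induction n arbitrary: f)
  case 0
  then show ?case
    using continuous_at_imp_continuous_on[of S f] differentiable_imp_continuous_within[of f _ UNIV] by simp
next
  case (Suc n)
  then show ?case by simp
qed

lemma higher_differentiable_on_le:
  assumes "higher_differentiable_on S f n" "m \<le> n" shows "higher_differentiable_on S f m"
  using assms(2,1)
  by (induction rule: dec_induct) (auto simp del: higher_differentiable_on.simps dest: higher_differentiable_on_SucD)

lemma higher_differentiable_on_subset:
  assumes "higher_differentiable_on S f n" "T \<subseteq> S" shows "higher_differentiable_on T f n"
  using assms by (induction n arbitrary: f) (auto intro: continuous_on_subset)

lemma higher_differentiable_on_continuous:
  "higher_differentiable_on S f n \<Longrightarrow> continuous_on S f"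
  using higher_differentiable_on_le[of S f n 0] by simp

lemma higher_differentiable_on_const: "open S \<Longrightarrow> higher_differentiable_on S (\<lambda>x. c) n"
  by (induction n arbitrary: c) (auto simp: frechet_derivative_const)

lemma higher_differentiable_on_bounded_linear:
  assumes "open S" "bounded_linear L" "higher_differentiable_on S f n"
  shows "higher_differentiable_on S (\<lambda>x. L (f x)) n"
  using assms(3)
proof (induction n arbitrary: f)
  case 0
  then show ?case using bounded_linear.continuous_on[OF assms(2)] by simp
next
  case (Suc n)
  then show ?case
    by (intro higher_differentiable_on_SucI[OF assms(1),
          where f' = "\<lambda>x v. L (frechet_derivative f (at x) v)"]
        bounded_linear.has_derivative[OF assms(2)] Suc.IH) 
      (auto intro: frechet_derivative_has_derivative)
qed

lemma higher_differentiable_on_add: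
  assumes "open S" "higher_differentiable_on S f n" "higher_differentiable_on S g n"
  shows "higher_differentiable_on S (\<lambda>x. f x + g x) n"
  using assms(2,3)
proof (induction n arbitrary: f g)
  case 0
  then show ?case by (simp add: continuous_on_add)
next
  case (Suc n)
  then show ?case
    by (intro higher_differentiable_on_SucI[OF assms(1),
          where f' = "\<lambda>x v. frechet_derivative f (at x) v + frechet_derivative g (at x) v"]
        has_derivative_add Suc.IH) (auto intro: frechet_derivative_has_derivative)
qed

lemma higher_differentiable_on_sum:
  assumes "open S" "\<And>i. i \<in> I \<Longrightarrow> higher_differentiable_on S (f i) n"
  shows "higher_differentiable_on S (\<lambda>x. \<Sum>i\<in>I. f i x) n"
  using assms(2)
  by (induction I rule: infinite_finite_induct)
    (simp_all add: higher_differentiable_on_const higher_differentiable_on_add assms(1))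

lemma higher_differentiable_on_bilinear:
  assumes "open S" "bounded_bilinear B" "higher_differentiable_on S f n" "higher_differentiable_on S g n"
  shows "higher_differentiable_on S (\<lambda>x. B (f x) (g x)) n"
  using assms(3,4)
proof (induction n arbitrary: f g)
  case 0
  then show ?case using bounded_bilinear.continuous_on[OF assms(2)] by simp
next
  case (Suc n)
  have *: "higher_differentiable_on S f n" "higher_differentiable_on S g n"
    using Suc.prems higher_differentiable_on_SucD by auto
  show ?case
    by (intro higher_differentiable_on_SucI[OF assms(1),
          where f' = "\<lambda>x v. B (f x) (frechet_derivative g (at x) v) + B (frechet_derivative f (at x) v) (g x)"]
        bounded_bilinear.FDERIV[OF assms(2)] higher_differentiable_on_add[OF assms(1)] Suc.IH)
      (use * Suc.prems in \<open>auto intro: frechet_derivative_has_derivative\<close>)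
qed

text \<open>The device that turns a derivative in a direction depending on the point into a finite
  sum of derivatives in fixed directions, the only ones that \<open>higher_differentiable_on\<close>
  controls.\<close>

lemma linear_basis_expansion:
  fixes L :: "'a::euclidean_space \<Rightarrow> 'b::real_vector"
  assumes "linear L" shows "L v = (\<Sum>b\<in>Basis. (v \<bullet> b) *\<^sub>R L b)"
proof -
  have "L v = L (\<Sum>b\<in>Basis. (v \<bullet> b) *\<^sub>R b)" by (simp add: euclidean_representation)
  also have "\<dots> = (\<Sum>b\<in>Basis. (v \<bullet> b) *\<^sub>R L b)"
    by (simp add: linear_sum[OF assms] linear_scale[OF assms])
  finally show ?thesis .
qed

text \<open>The chain rule yields the derivative of \<open>f\<close> at \<open>g x\<close> in the
  moving direction g'(x) v. Expanded in a basis, it is a sum of products of coordinates of g'(x) v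
  with partial derivatives of \<open>f\<close> along \<open>g\<close>, to which the induction
  hypothesis applies. This is where the intermediate space has to be Euclidean.\<close>

lemma higher_differentiable_on_compose:
  fixes f :: "'a::euclidean_space \<Rightarrow> 'b::real_normed_vector" and g :: "'c::real_normed_vector \<Rightarrow> 'a"
  assumes "open S" "open T" "g ` S \<subseteq> T"
    and "higher_differentiable_on T f n" "higher_differentiable_on S g n"
  shows "higher_differentiable_on S (\<lambda>x. f (g x)) n"
  using assms(4,5)
proof (induction n arbitrary: f)
  case 0
  then show ?case using continuous_on_compose2[of T f S g] assms by simp
next
  case (Suc n)
  define f' where "f' x v = (\<Sum>b\<in>Basis. (frechet_derivative g (at x) v \<bullet> b) *\<^sub>R frechet_derivative f (at (g x)) b)" for x v
  have "((\<lambda>x. f (g x)) has_derivative f' x) (at x)" if "x \<in> S" for x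
  proof -
    have f: "(f has_derivative frechet_derivative f (at (g x))) (at (g x))"
      using Suc.prems that assms(3) by (auto intro!: frechet_derivative_has_derivative)
    have "((\<lambda>x. f (g x)) has_derivative (\<lambda>v. frechet_derivative f (at (g x)) (frechet_derivative g (at x) v))) (at x)"
      by (rule has_derivative_compose[of g _ x UNIV f, OF _ f])
        (use Suc.prems that in \<open>auto intro!: frechet_derivative_has_derivative\<close>)
    moreover have "frechet_derivative f (at (g x)) (frechet_derivative g (at x) v) = f' x v" for v
      unfolding f'_def by (rule linear_basis_expansion[OF has_derivative_linear[OF f]])
    ultimately show ?thesis by simp
  qed
  moreover have "higher_differentiable_on S (\<lambda>x. f' x v) n" for v
    unfolding f'_def
    by (intro higher_differentiable_on_sum higher_differentiable_on_bilinear[OF _ bounded_bilinear_scaleR]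
        higher_differentiable_on_bounded_linear[OF _ bounded_linear_inner_left] Suc.IH assms)
      (use Suc.prems higher_differentiable_on_SucD in auto)
  ultimately show ?case by (rule higher_differentiable_on_SucI[OF assms(1)])
qed

section \<open>Closure properties of smooth maps\<close>

lemma smooth_onD: "smooth_on S f \<Longrightarrow> higher_differentiable_on S f n"
  by (simp add: smooth_on_def)

lemma smooth_on_differentiable: "smooth_on S f \<Longrightarrow> x \<in> S \<Longrightarrow> f differentiable (at x)"
  using smooth_onD[of S f 1] by simp

lemma smooth_on_has_derivative:
  "smooth_on S f \<Longrightarrow> x \<in> S \<Longrightarrow> (f has_derivative frechet_derivative f (at x)) (at x)"
  by (intro frechet_derivative_has_derivative smooth_on_differentiable)

lemma smooth_on_linear_derivative:
  "smooth_on S f \<Longrightarrow> x \<in> S \<Longrightarrow> linear (frechet_derivative f (at x))"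
  by (rule has_derivative_linear[OF smooth_on_has_derivative])

lemma smooth_on_derivative: "smooth_on S f \<Longrightarrow> smooth_on S (\<lambda>x. frechet_derivative f (at x) v)"
  unfolding smooth_on_def by (metis higher_differentiable_on.simps(2))

lemma smooth_on_continuous: "smooth_on S f \<Longrightarrow> continuous_on S f"
  using smooth_onD[of S f 0] by simp

lemma smooth_on_cong: "open S \<Longrightarrow> (\<And>x. x \<in> S \<Longrightarrow> f x = g x) \<Longrightarrow> smooth_on S f \<Longrightarrow> smooth_on S g"
  unfolding smooth_on_def by (metis higher_differentiable_on_cong)

lemma smooth_on_subset: "smooth_on S f \<Longrightarrow> T \<subseteq> S \<Longrightarrow> smooth_on T f"
  unfolding smooth_on_def by (intro allI higher_differentiable_on_subset[of S f _ T]) auto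

lemma smooth_on_const: "open S \<Longrightarrow> smooth_on S (\<lambda>x. c)"
  unfolding smooth_on_def by (intro allI higher_differentiable_on_const) auto

lemma smooth_on_bounded_linear:
  "open S \<Longrightarrow> bounded_linear L \<Longrightarrow> smooth_on S f \<Longrightarrow> smooth_on S (\<lambda>x. L (f x))"
  unfolding smooth_on_def by (intro allI higher_differentiable_on_bounded_linear[where L=L and f=f]) auto

lemma smooth_on_add:
  "open S \<Longrightarrow> smooth_on S f \<Longrightarrow> smooth_on S g \<Longrightarrow> smooth_on S (\<lambda>x. f x + g x)"
  unfolding smooth_on_def by (intro allI higher_differentiable_on_add[where f=f and g=g]) auto

lemma smooth_on_minus: "open S \<Longrightarrow> smooth_on S f \<Longrightarrow> smooth_on S (\<lambda>x. - f x)"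
  by (rule smooth_on_bounded_linear[OF _ bounded_linear_minus[OF bounded_linear_ident]])

lemma smooth_on_diff:
  "open S \<Longrightarrow> smooth_on S f \<Longrightarrow> smooth_on S g \<Longrightarrow> smooth_on S (\<lambda>x. f x - g x)"
  using smooth_on_add[of S f "\<lambda>x. - g x"] smooth_on_minus[of S g] by simp

lemma smooth_on_sum:
  "open S \<Longrightarrow> (\<And>i. i \<in> I \<Longrightarrow> smooth_on S (f i)) \<Longrightarrow> smooth_on S (\<lambda>x. \<Sum>i\<in>I. f i x)"
  unfolding smooth_on_def by (intro allI higher_differentiable_on_sum[where f=f and I=I]) auto

lemma smooth_on_bilinear:
  "open S \<Longrightarrow> bounded_bilinear B \<Longrightarrow> smooth_on S f \<Longrightarrow> smooth_on S g \<Longrightarrow> smooth_on S (\<lambda>x. B (f x) (g x))"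
  unfolding smooth_on_def by (intro allI higher_differentiable_on_bilinear[where B=B and f=f and g=g]) auto

lemmas smooth_on_scaleR = smooth_on_bilinear[OF _ bounded_bilinear_scaleR]

lemma smooth_on_compose:
  fixes f :: "'a::euclidean_space \<Rightarrow> 'b::real_normed_vector"
  shows "open S \<Longrightarrow> open T \<Longrightarrow> g ` S \<subseteq> T \<Longrightarrow> smooth_on T f \<Longrightarrow> smooth_on S g \<Longrightarrow> smooth_on S (\<lambda>x. f (g x))"
  unfolding smooth_on_def by (intro allI higher_differentiable_on_compose[where T=T and f=f and g=g]) auto

lemma higher_differentiable_on_ident: "open S \<Longrightarrow> higher_differentiable_on S (\<lambda>x. x) n"
proof (cases n)
  case (Suc m)
  assume "open S"
  then show ?thesis unfolding Suc
    by (intro higher_differentiable_on_SucI[where f' = "\<lambda>x v. v"] higher_differentiable_on_const) auto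
qed (simp add: continuous_on_id)

lemma smooth_on_ident: "open S \<Longrightarrow> smooth_on S (\<lambda>x. x)"
  unfolding smooth_on_def by (intro allI higher_differentiable_on_ident) auto

lemma smooth_on_linear_image:
  "open S \<Longrightarrow> bounded_linear L \<Longrightarrow> smooth_on S L"
  by (intro smooth_on_bounded_linear[where L=L and f="\<lambda>x. x"] smooth_on_ident)

lemma smooth_on_Pair:
  assumes "open S" "smooth_on S f" "smooth_on S g" shows "smooth_on S (\<lambda>x. (f x, g x))"
proof -
  have "bounded_linear (\<lambda>a::'b. (a, 0::'c))" "bounded_linear (\<lambda>b::'c. (0::'b, b))"
    by (intro bounded_linear_Pair bounded_linear_ident bounded_linear_zero)+
  then have "smooth_on S (\<lambda>x. (f x, 0) + (0, g x))"
    using assms by (intro smooth_on_add smooth_on_bounded_linear[of S "\<lambda>a. (a, 0)"] 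
        smooth_on_bounded_linear[of S "\<lambda>b. (0, b)"])
  then show ?thesis by simp
qed

text \<open>Base point and direction both depend on \<open>x\<close>; a basis expansion of the
  direction reduces this to compositions with partial derivatives.\<close>

lemma smooth_on_derivative_apply:
  fixes f :: "'a::euclidean_space \<Rightarrow> 'b::real_normed_vector"
  assumes "open S" "open T" "smooth_on T f" "smooth_on S g" "g ` S \<subseteq> T" "smooth_on S h"
  shows "smooth_on S (\<lambda>x. frechet_derivative f (at (g x)) (h x))"
proof -
  have "smooth_on S (\<lambda>x. \<Sum>b\<in>Basis. (h x \<bullet> b) *\<^sub>R frechet_derivative f (at (g x)) b)"
    by (intro smooth_on_sum smooth_on_scaleR smooth_on_bounded_linear[OF _ bounded_linear_inner_left]
      smooth_on_compose[of S T g "\<lambda>y. frechet_derivative f (at y) _"] smooth_on_derivative assms)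
  then show ?thesis
    by (rule smooth_on_cong[OF assms(1), rotated])
      (use assms in \<open>auto intro!: linear_basis_expansion[symmetric] smooth_on_linear_derivative\<close>)
qed

lemma frechet_derivative_compose_apply:
  assumes "f differentiable (at (g x))" "g differentiable (at x)"
  shows "frechet_derivative (\<lambda>x. f (g x)) (at x) v = frechet_derivative f (at (g x)) (frechet_derivative g (at x) v)"
  using frechet_derivative_eq[OF has_derivative_compose[of g _ x UNIV f, OF frechet_derivative_has_derivative[OF assms(2)]
    frechet_derivative_has_derivative[OF assms(1)]]] by simp

lemma frechet_derivative_bilinear:
  assumes "bounded_bilinear B" "f differentiable (at x)" "g differentiable (at x)"
  shows "frechet_derivative (\<lambda>x. B (f x) (g x)) (at x) v =
    B (frechet_derivative f (at x) v) (g x) + B (f x) (frechet_derivative g (at x) v)"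
  by (subst frechet_derivative_eq[OF bounded_bilinear.FDERIV[OF assms(1)
    frechet_derivative_has_derivative[OF assms(2)] frechet_derivative_has_derivative[OF assms(3)]]]) simp

lemma frechet_derivative_bounded_linear:
  assumes "bounded_linear L" "f differentiable (at x)"
  shows "frechet_derivative (\<lambda>x. L (f x)) (at x) v = L (frechet_derivative f (at x) v)"
  by (subst frechet_derivative_eq[OF bounded_linear.has_derivative[OF assms(1)
    frechet_derivative_has_derivative[OF assms(2)]]]) simp

lemma smooth_on_vector_derivative:
  assumes "smooth_on S f" "x + t *\<^sub>R v \<in> S"
  shows "((\<lambda>t. f (x + t *\<^sub>R v)) has_vector_derivative frechet_derivative f (at (x + t *\<^sub>R v)) v) (at t within T)"
proof -
  have "((\<lambda>t. x + t *\<^sub>R v) has_vector_derivative v) (at t)"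
    unfolding has_vector_derivative_def
    using has_derivative_add[OF has_derivative_const has_derivative_scaleR_left[OF has_derivative_ident]] by simp
  moreover have "(f has_derivative frechet_derivative f (at (x + t *\<^sub>R v))) (at (x + t *\<^sub>R v))"
    by (rule smooth_on_has_derivative[OF assms])
  ultimately have "(f \<circ> (\<lambda>t. x + t *\<^sub>R v) has_vector_derivative frechet_derivative f (at (x + t *\<^sub>R v)) v) (at t)"
    by (rule vector_derivative_diff_chain_within[OF _ has_derivative_at_withinI])
  then show ?thesis unfolding o_def by (rule has_vector_derivative_at_within)
qed

section \<open>Mean value estimates and the symmetry of second derivatives\<close>

lemma vector_derivative_bound:
  fixes \<phi> :: "real \<Rightarrow> 'b::real_normed_vector"
  assumes "a \<le> b" "\<And>t. t \<in> {a..b} \<Longrightarrow> (\<phi> has_vector_derivative \<phi>' t) (at t within {a..b})"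
    "\<And>t. t \<in> {a..b} \<Longrightarrow> norm (\<phi>' t) \<le> B"
  shows "norm (\<phi> b - \<phi> a) \<le> B * (b - a)"
proof -
  have "norm (\<phi> b - \<phi> a) \<le> B * norm (b - a)"
  proof (rule differentiable_bound[of "{a..b}" \<phi> "\<lambda>t s. s *\<^sub>R \<phi>' t"])
    fix t assume t: "t \<in> {a..b}"
    show "onorm (\<lambda>s. s *\<^sub>R \<phi>' t) \<le> B"
    proof (rule onorm_le)
      fix s :: real
      show "norm (s *\<^sub>R \<phi>' t) \<le> B * norm s"
        using mult_left_mono[OF assms(3)[OF t] abs_ge_zero[of s]] by (simp add: mult.commute)
    qed
  qed (use assms in \<open>auto simp: has_vector_derivative_def\<close>)
  then show ?thesis using assms(1) by simp
qed

lemma linear_vector_derivative: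
  "((\<lambda>s. (s * c) *\<^sub>R v) has_vector_derivative c *\<^sub>R v) (at t within T)"
  using has_vector_derivative_scaleR[OF DERIV_cmult_Id[of c] has_vector_derivative_const[of v]]
  by (simp add: mult.commute)

text \<open>The second difference of \<open>f\<close> over the parallelogram with sides h u and h v,
  compared with its prediction h^2 D. The mean value inequality is applied twice: along
  \<open>u\<close> to the difference of two parallel edges (\<open>\<phi>\<close>), then along
  \<open>v\<close> to the first derivative (\<open>\<psi>\<close>).\<close>

lemma mixed_difference_estimate:
  fixes f :: "'a::real_normed_vector \<Rightarrow> 'b::real_normed_vector"
  assumes S: "open S" "smooth_on S f" and h: "0 < h"
    and sub: "\<And>\<sigma> \<tau>. \<sigma> \<in> {0..h} \<Longrightarrow> \<tau> \<in> {0..h} \<Longrightarrow> x + \<sigma> *\<^sub>R u + \<tau> *\<^sub>R v \<in> S"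
    and bound: "\<And>\<sigma> \<tau>. \<sigma> \<in> {0..h} \<Longrightarrow> \<tau> \<in> {0..h} \<Longrightarrow>
      norm (frechet_derivative (\<lambda>y. frechet_derivative f (at y) u) (at (x + \<sigma> *\<^sub>R u + \<tau> *\<^sub>R v)) v - D) \<le> \<eta>"
  shows "norm (f (x + h *\<^sub>R u + h *\<^sub>R v) - f (x + h *\<^sub>R u) - f (x + h *\<^sub>R v) + f x - (h * h) *\<^sub>R D) \<le> h * h * \<eta>"
proof -
  define \<phi> where "\<phi> \<sigma> = f (x + h *\<^sub>R v + \<sigma> *\<^sub>R u) - f (x + \<sigma> *\<^sub>R u) - (\<sigma> * h) *\<^sub>R D" for \<sigma>
  define \<phi>' where "\<phi>' \<sigma> = frechet_derivative f (at (x + h *\<^sub>R v + \<sigma> *\<^sub>R u)) u - frechet_derivative f (at (x + \<sigma> *\<^sub>R u)) u - h *\<^sub>R D" for \<sigma>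
  have d: "(\<phi> has_vector_derivative \<phi>' \<sigma>) (at \<sigma> within {0..h})" if "\<sigma> \<in> {0..h}" for \<sigma>
    unfolding \<phi>_def \<phi>'_def
    by (intro has_vector_derivative_diff smooth_on_vector_derivative[OF S(2)])
      (use sub[OF that, of 0] sub[OF that, of h] h linear_vector_derivative[of h D] in \<open>auto simp: algebra_simps\<close>)
  have b: "norm (\<phi>' \<sigma>) \<le> h * \<eta>" if \<sigma>: "\<sigma> \<in> {0..h}" for \<sigma>
  proof -
    define \<psi> where "\<psi> \<tau> = frechet_derivative f (at (x + \<sigma> *\<^sub>R u + \<tau> *\<^sub>R v)) u - \<tau> *\<^sub>R D" for \<tau>
    define \<psi>' where "\<psi>' \<tau> = frechet_derivative (\<lambda>y. frechet_derivative f (at y) u) (at (x + \<sigma> *\<^sub>R u + \<tau> *\<^sub>R v)) v - D" for \<tau>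
    have "(\<psi> has_vector_derivative \<psi>' \<tau>) (at \<tau> within {0..h})" if "\<tau> \<in> {0..h}" for \<tau>
      unfolding \<psi>_def \<psi>'_def
      by (intro has_vector_derivative_diff smooth_on_vector_derivative[OF smooth_on_derivative[OF S(2)]])
        (use sub[OF \<sigma> that] linear_vector_derivative[of 1 D] in auto)
    then have "norm (\<psi> h - \<psi> 0) \<le> \<eta> * (h - 0)"
      by (rule vector_derivative_bound[rotated]) (use h bound[OF \<sigma>] in \<open>auto simp: \<psi>'_def\<close>)
    then show ?thesis using h by (simp add: \<psi>_def \<phi>'_def algebra_simps)
  qed
  have "norm (\<phi> h - \<phi> 0) \<le> h * \<eta> * (h - 0)"
    by (rule vector_derivative_bound[OF _ d b]) (use h in auto)
  then show ?thesis using h by (simp add: \<phi>_def algebra_simps)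
qed

text \<open>Schwarz's theorem in any normed space: the second difference is symmetric in
  \<open>u\<close> and \<open>v\<close>, so both mixed derivatives, being continuous, are close to
  the same difference quotient.\<close>

lemma smooth_on_mixed_derivatives:
  fixes f :: "'a::real_normed_vector \<Rightarrow> 'b::real_normed_vector"
  assumes S: "open S" "smooth_on S f" and x: "x \<in> S"
  shows "frechet_derivative (\<lambda>y. frechet_derivative f (at y) u) (at x) v =
    frechet_derivative (\<lambda>y. frechet_derivative f (at y) v) (at x) u" (is "?D = ?E")
proof (rule ccontr)
  assume neq: "?D \<noteq> ?E"
  \<comment> \<open>A quarter suffices: the two estimates add up to 2 \<open>\<eta>\<close>, half of
    the supposed gap.\<close>
  define \<eta> where "\<eta> = norm (?D - ?E) / 4"
  have \<eta>: "\<eta> > 0" using neq by (simp add: \<eta>_def)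
  define G where "G u v y = frechet_derivative (\<lambda>y. frechet_derivative f (at y) u) (at y) v" for u v y
  have cont: "continuous (at x) (G u v)" for u v
    using smooth_on_continuous[OF smooth_on_derivative[OF smooth_on_derivative[OF S(2)]]] x S(1)
    unfolding G_def by (simp add: continuous_on_eq_continuous_at)
  obtain d1 where d1: "d1 > 0" "\<And>y. dist y x < d1 \<Longrightarrow> dist (G u v y) (G u v x) < \<eta>"
    using cont[of u v] \<eta> unfolding continuous_at_eps_delta by metis
  obtain d2 where d2: "d2 > 0" "\<And>y. dist y x < d2 \<Longrightarrow> dist (G v u y) (G v u x) < \<eta>"
    using cont[of v u] \<eta> unfolding continuous_at_eps_delta by metis
  obtain d3 where d3: "d3 > 0" "\<And>y. dist y x < d3 \<Longrightarrow> y \<in> S"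
    using S(1) x unfolding open_dist by metis
  define d where "d = min d1 (min d2 d3)"
  have d: "d > 0" and dd: "\<And>y. dist y x < d \<Longrightarrow> y \<in> S \<and> dist (G u v y) (G u v x) < \<eta> \<and> dist (G v u y) (G v u x) < \<eta>"
    using d1 d2 d3 by (auto simp: d_def)
  define N where "N = norm u + norm v + 1"
  have N: "N > 0" unfolding N_def using norm_ge_zero[of u] norm_ge_zero[of v] by linarith
  \<comment> \<open>This side length keeps the whole parallelogram at distance at most d / 2 from
    \<open>x\<close>.\<close>
  define h where "h = d / (2 * N)"
  have h: "h > 0" using d N by (simp add: h_def)
  have near: "dist (x + \<sigma> *\<^sub>R u + \<tau> *\<^sub>R v) x < d" if "\<sigma> \<in> {0..h}" "\<tau> \<in> {0..h}" for \<sigma> \<tau>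
  proof -
    have "norm (\<sigma> *\<^sub>R u + \<tau> *\<^sub>R v) \<le> \<sigma> * norm u + \<tau> * norm v"
      using that by (intro order_trans[OF norm_triangle_ineq]) simp
    also have "\<dots> \<le> h * norm u + h * norm v" using that by (intro add_mono mult_right_mono) auto
    also have "\<dots> \<le> h * N" using h by (simp add: N_def algebra_simps)
    also have "\<dots> = d / 2" using N by (simp add: h_def)
    also have "\<dots> < d" using d by simp
    finally show ?thesis by (simp add: dist_norm add.assoc)
  qed
  have near': "dist (x + \<sigma> *\<^sub>R v + \<tau> *\<^sub>R u) x < d" if "\<sigma> \<in> {0..h}" "\<tau> \<in> {0..h}" for \<sigma> \<tau>
    using near[OF that(2,1)] by (simp add: ac_simps)
  define \<Delta> where "\<Delta> = f (x + h *\<^sub>R u + h *\<^sub>R v) - f (x + h *\<^sub>R u) - f (x + h *\<^sub>R v) + f x"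
  have 1: "norm (\<Delta> - (h * h) *\<^sub>R ?D) \<le> h * h * \<eta>"
    unfolding \<Delta>_def
    by (rule mixed_difference_estimate[OF S h]) (use dd[OF near] in \<open>auto simp: G_def dist_norm intro: less_imp_le\<close>)
  have "norm (f (x + h *\<^sub>R v + h *\<^sub>R u) - f (x + h *\<^sub>R v) - f (x + h *\<^sub>R u) + f x - (h * h) *\<^sub>R ?E) \<le> h * h * \<eta>"
    by (rule mixed_difference_estimate[OF S h]) (use dd[OF near'] in \<open>auto simp: G_def dist_norm intro: less_imp_le\<close>)
  then have 2: "norm (\<Delta> - (h * h) *\<^sub>R ?E) \<le> h * h * \<eta>"
    unfolding \<Delta>_def by (simp add: algebra_simps)
  have "norm ((h * h) *\<^sub>R (?D - ?E)) \<le> h * h * \<eta> + h * h * \<eta>"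
    using norm_triangle_ineq4[of "\<Delta> - (h * h) *\<^sub>R ?E" "\<Delta> - (h * h) *\<^sub>R ?D"] 1 2
    by (simp add: algebra_simps)
  then have "(h * h) * norm (?D - ?E) \<le> (h * h) * (2 * \<eta>)" by (simp add: ac_simps)
  then have "norm (?D - ?E) \<le> 2 * \<eta>" using h by (simp add: mult_le_cancel_left_pos)
  then show False using \<eta> unfolding \<eta>_def by linarith
qed

section \<open>Inverses of operators\<close>

lemma norm_blinfun_compose3:
  "norm (f o\<^sub>L g o\<^sub>L h) \<le> norm f * norm g * norm h"
  by (intro order_trans[OF norm_blinfun_compose] mult_right_mono norm_blinfun_compose) simp

text \<open>The resolvent identity, from a left inverse of one operator and a right inverse of the
  other.\<close>

lemma blinfun_inverse_difference:
  fixes P P' Q Q' :: "'a::real_normed_vector \<Rightarrow>\<^sub>L 'a"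
  assumes "\<And>v. Q' (P' v) = v" "\<And>v. P (Q v) = v"
  shows "Q' - Q = - (Q' o\<^sub>L (P' - P) o\<^sub>L Q)"
  by (rule blinfun_eqI) (simp add: blinfun.bilinear_simps assms)

text \<open>The uniform bound \<open>C\<close> controls both factors \<open>Q\<close> in the
  resolvent identity, which leaves the distance between the values of \<open>P\<close> as the only
  small quantity.\<close>

lemma continuous_on_blinfun_inverse:
  fixes P Q :: "'c::real_normed_vector \<Rightarrow> 'a::real_normed_vector \<Rightarrow>\<^sub>L 'a"
  assumes "\<And>x v. x \<in> S \<Longrightarrow> Q x (P x v) = v" "\<And>x v. x \<in> S \<Longrightarrow> P x (Q x v) = v"
    "\<And>x. x \<in> S \<Longrightarrow> norm (Q x) \<le> C" and P: "continuous_on S P"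
  shows "continuous_on S Q"
  unfolding continuous_on_def
proof
  fix x assume x: "x \<in> S"
  have C: "0 \<le> C" using assms(3)[OF x] norm_ge_zero order_trans by blast
  have "((\<lambda>y. C * norm (P y - P x) * C) \<longlongrightarrow> C * norm (P x - P x) * C) (at x within S)"
    using P x unfolding continuous_on_def by (intro tendsto_intros) auto
  then have lim: "((\<lambda>y. C * norm (P y - P x) * C) \<longlongrightarrow> 0) (at x within S)" by simp
  have "\<forall>\<^sub>F y in at x within S. norm (Q y - Q x) \<le> C * norm (P y - P x) * C"
    unfolding eventually_at_filter
  proof (intro always_eventually allI impI)
    fix y assume y: "y \<in> S"
    have "norm (Q y - Q x) \<le> norm (Q y) * norm (P y - P x) * norm (Q x)"
      unfolding blinfun_inverse_difference[of "Q y" "P y" "P x" "Q x", OF assms(1)[OF y] assms(2)[OF x]]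
      using norm_blinfun_compose3 by simp
    also have "\<dots> \<le> C * norm (P y - P x) * C"
      using assms(3)[OF x] assms(3)[OF y] C by (intro mult_mono) auto
    finally show "norm (Q y - Q x) \<le> C * norm (P y - P x) * C" .
  qed
  then have "((\<lambda>y. Q y - Q x) \<longlongrightarrow> 0) (at x within S)" by (rule Lim_null_comparison[OF _ lim])
  then show "(Q \<longlongrightarrow> Q x) (at x within S)" by (rule LIM_zero_cancel)
qed

lemma has_derivative_blinfun_inverse:
  fixes P Q :: "'c::real_normed_vector \<Rightarrow> 'a::real_normed_vector \<Rightarrow>\<^sub>L 'a"
  assumes S: "open S" and x: "x \<in> S"
    and inv: "\<And>x v. x \<in> S \<Longrightarrow> Q x (P x v) = v" "\<And>x v. x \<in> S \<Longrightarrow> P x (Q x v) = v"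
    and C: "\<And>x. x \<in> S \<Longrightarrow> norm (Q x) \<le> C"
    and P: "(P has_derivative P') (at x)" and contP: "continuous_on S P"
  shows "(Q has_derivative (\<lambda>v. - (Q x o\<^sub>L P' v o\<^sub>L Q x))) (at x)"
proof -
  have C0: "0 \<le> C" using C[OF x] norm_ge_zero order_trans by blast
  have bl: "bounded_linear P'" using P by (rule has_derivative_bounded_linear)
  obtain K where K: "\<And>h. norm (P' h) \<le> norm h * K" "K > 0"
    using bounded_linear.pos_bounded[OF bl] by blast
  define H where "H y = C * (norm (P y - P x - P' (y - x)) / norm (y - x)) * C + norm (Q y - Q x) * K * C" for y
  have "(Q \<longlongrightarrow> Q x) (at x)"
    using continuous_on_blinfun_inverse[OF inv C contP] S x at_within_open[OF x S]
    unfolding continuous_on_def by metis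
  then have "(H \<longlongrightarrow> C * 0 * C + norm (Q x - Q x) * K * C) (at x)"
    unfolding H_def using P unfolding has_derivative_iff_norm by (intro tendsto_intros) auto
  then have lim: "(H \<longlongrightarrow> 0) (at x)" by simp
  have "(Q has_derivative (\<lambda>v. - (Q x o\<^sub>L P' v o\<^sub>L Q x))) (at x within S)"
  proof (rule has_derivativeI_sandwich[where e=1 and H=H])
    show "bounded_linear (\<lambda>v. - (Q x o\<^sub>L P' v o\<^sub>L Q x))"
      by (intro bounded_linear_minus bounded_linear_compose[OF bounded_bilinear.bounded_linear_left[OF bounded_bilinear_blinfun_compose]]
        bounded_linear_compose[OF bounded_bilinear.bounded_linear_right[OF bounded_bilinear_blinfun_compose] bl])
    show "(H \<longlongrightarrow> 0) (at x within S)" using lim at_within_open[OF x S] by simp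
    fix y assume y: "y \<in> S" "y \<noteq> x" 
    let ?h = "y - x"
    \<comment> \<open>The resolvent identity with P y - P x split into linear part and remainder.
      The first term is small because \<open>P\<close> is differentiable, the second because
      \<open>Q\<close> is continuous.\<close>
    have "Q y - Q x - - (Q x o\<^sub>L P' ?h o\<^sub>L Q x) =
       - (Q y o\<^sub>L (P y - P x - P' ?h) o\<^sub>L Q x) - ((Q y - Q x) o\<^sub>L P' ?h o\<^sub>L Q x)"
      by (rule blinfun_eqI) (simp add: blinfun.bilinear_simps inv x y)
    then have "norm (Q y - Q x - - (Q x o\<^sub>L P' ?h o\<^sub>L Q x)) \<le>
      norm (Q y o\<^sub>L (P y - P x - P' ?h) o\<^sub>L Q x) + norm ((Q y - Q x) o\<^sub>L P' ?h o\<^sub>L Q x)"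
      using norm_triangle_ineq4[of "- (Q y o\<^sub>L (P y - P x - P' ?h) o\<^sub>L Q x)" "(Q y - Q x) o\<^sub>L P' ?h o\<^sub>L Q x"] by simp
    also have "\<dots> \<le> norm (Q y) * norm (P y - P x - P' ?h) * norm (Q x) + norm (Q y - Q x) * norm (P' ?h) * norm (Q x)"
      by (intro add_mono norm_blinfun_compose3)
    also have "\<dots> \<le> C * norm (P y - P x - P' ?h) * C + norm (Q y - Q x) * (norm ?h * K) * C"
      using C[OF x] C[OF y(1)] C0 K by (intro add_mono mult_mono) auto
    also have "\<dots> = H y * norm ?h"
      using y(2) by (simp add: H_def field_simps)
    finally show "norm (Q y - Q x - - (Q x o\<^sub>L P' ?h o\<^sub>L Q x)) / norm ?h \<le> H y"
      using y(2) by (simp add: divide_le_eq)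
  qed simp
  then show ?thesis using at_within_open[OF x S] by simp
qed

text \<open>Bootstrapping: the derivative -Q P' Q contains \<open>Q\<close> itself, so
  \<open>n\<close> orders of regularity of \<open>Q\<close> and P' give order n + 1 for
  \<open>Q\<close>.\<close>

lemma higher_differentiable_on_blinfun_inverse:
  fixes P Q :: "'c::real_normed_vector \<Rightarrow> 'a::real_normed_vector \<Rightarrow>\<^sub>L 'a"
  assumes S: "open S"
    and inv: "\<And>x v. x \<in> S \<Longrightarrow> Q x (P x v) = v" "\<And>x v. x \<in> S \<Longrightarrow> P x (Q x v) = v"
    and C: "\<And>x. x \<in> S \<Longrightarrow> norm (Q x) \<le> C"
    and P: "higher_differentiable_on S P n"
  shows "higher_differentiable_on S Q n"
  using P
proof (induction n)
  case 0
  then show ?case using continuous_on_blinfun_inverse[OF inv C] by simp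
next
  case (Suc n)
  have Q: "higher_differentiable_on S Q n" using Suc higher_differentiable_on_SucD by blast
  show ?case
  proof (rule higher_differentiable_on_SucI[OF S])
    fix x assume x: "x \<in> S"
    show "(Q has_derivative (\<lambda>v. - (Q x o\<^sub>L frechet_derivative P (at x) v o\<^sub>L Q x))) (at x)"
      using Suc.prems x higher_differentiable_on_continuous[OF Suc.prems]
      by (intro has_derivative_blinfun_inverse[OF S x inv C] frechet_derivative_has_derivative) auto
  next
    fix v
    have "higher_differentiable_on S (\<lambda>x. frechet_derivative P (at x) v) n" using Suc.prems by simp
    then show "higher_differentiable_on S (\<lambda>x. - (Q x o\<^sub>L frechet_derivative P (at x) v o\<^sub>L Q x)) n"
      using Q S
      by (intro higher_differentiable_on_bounded_linear[OF S bounded_linear_minus[OF bounded_linear_ident]]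
        higher_differentiable_on_bilinear[OF S bounded_bilinear_blinfun_compose])
  qed
qed

text \<open>Neumann series without the series: \<open>k = y + A k\<close> is a fixed point equation for a contraction.\<close>

lemma blinfun_inverse_near_id:
  fixes A :: "'a::{real_normed_vector,complete_space} \<Rightarrow>\<^sub>L 'a"
  assumes A: "norm A \<le> 1/2"
  obtains Q :: "'a \<Rightarrow>\<^sub>L 'a" where "\<And>v. Q (v - A v) = v" "\<And>v. Q v - A (Q v) = v" "norm Q \<le> 2"
proof -
  have half: "norm (A k) \<le> norm k / 2" for k
    using norm_blinfun[of A k] mult_right_mono[OF A norm_ge_zero[of k]] by simp
  have "\<exists>!k. y + A k = k" for y
    using half[of "_ - _"] by (intro banach_fix_type[of "1/2"]) (auto simp: dist_norm blinfun.bilinear_simps)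
  then obtain q where q: "y + A (q y) = q y" for y by metis
  have uniq: "k = q y" if "y + A k = k" for y k
    using \<open>\<exists>!k. y + A k = k\<close> that q by blast
  have bound: "norm (q y) \<le> norm y * 2" for y
    using half[of "q y"] norm_triangle_ineq[of y "A (q y)"] q[of y] by simp
  have "bounded_linear q"
  proof (rule bounded_linear_intro[where K=2])
    fix x y :: 'a and r :: real
    show "q (x + y) = q x + q y"
      using arg_cong2[OF q[of x] q[of y], of "(+)"]
      by (intro uniq[symmetric]) (simp add: blinfun.bilinear_simps algebra_simps)
    show "q (r *\<^sub>R x) = r *\<^sub>R q x"
      using q[of x] by (intro uniq[symmetric]) (simp add: blinfun.bilinear_simps flip: scaleR_add_right)
  qed (rule bound)
  then have ap: "blinfun_apply (Blinfun q) = q" by (rule bounded_linear_Blinfun_apply)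
  show thesis
  proof
    show "Blinfun q (v - A v) = v" for v
      using uniq[of "v - A v" v] by (simp add: ap)
    show "Blinfun q v - A (Blinfun q v) = v" for v
      using q[of v] by (simp add: ap algebra_simps)
    show "norm (Blinfun q) \<le> 2"
      using bound by (intro norm_blinfun_bound) (auto simp: ap mult.commute)
  qed
qed

lemma bounded_linear_inner_scaleR:
  "bounded_linear (\<lambda>v. (v \<bullet> b) *\<^sub>R (w::'b::real_normed_vector))" for b :: "'e::euclidean_space"
  by (rule bounded_linear_compose[OF bounded_linear_scaleR_left bounded_linear_inner_left])

lemma bounded_linear_rank_one:
  "bounded_linear (\<lambda>w::'b::real_normed_vector. Blinfun (\<lambda>v::'e::euclidean_space. (v \<bullet> b) *\<^sub>R w))"
proof (rule bounded_linear_intro[where K="norm b"])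
  note ap = bounded_linear_Blinfun_apply[OF bounded_linear_inner_scaleR]
  fix x y :: 'b and r :: real
  show "Blinfun (\<lambda>v. (v \<bullet> b) *\<^sub>R (x + y)) = Blinfun (\<lambda>v. (v \<bullet> b) *\<^sub>R x) + Blinfun (\<lambda>v. (v \<bullet> b) *\<^sub>R y)"
    by (rule blinfun_eqI) (simp only: ap blinfun.bilinear_simps, simp add: algebra_simps)
  show "Blinfun (\<lambda>v. (v \<bullet> b) *\<^sub>R (r *\<^sub>R x)) = r *\<^sub>R Blinfun (\<lambda>v. (v \<bullet> b) *\<^sub>R x)"
    by (rule blinfun_eqI) (simp only: ap blinfun.bilinear_simps, simp add: algebra_simps)
  show "norm (Blinfun (\<lambda>v::'e. (v \<bullet> b) *\<^sub>R x)) \<le> norm x * norm b"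
  proof (rule norm_blinfun_bound)
    fix v :: 'e
    have "\<bar>v \<bullet> b\<bar> * norm x \<le> (norm v * norm b) * norm x"
      by (intro mult_right_mono Cauchy_Schwarz_ineq2) simp
    then show "norm (blinfun_apply (Blinfun (\<lambda>v. (v \<bullet> b) *\<^sub>R x)) v) \<le> norm x * norm b * norm v"
      by (simp add: ap ac_simps)
  qed simp
qed

lemma Blinfun_apply_linear:
  fixes f :: "'e::euclidean_space \<Rightarrow> 'b::real_normed_vector"
  assumes "linear f" shows "blinfun_apply (Blinfun f) = f"
  using assms by (intro bounded_linear_Blinfun_apply) (simp add: linear_conv_bounded_linear)

text \<open>An operator on a Euclidean space is the sum of the rank one operators built from its
  columns, and each of these is a bounded linear function of the column.\<close>

lemma smooth_on_Blinfun:
  fixes F :: "'a::real_normed_vector \<Rightarrow> 'e::euclidean_space \<Rightarrow> 'b::real_normed_vector"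
  assumes S: "open S" and lin: "\<And>x. x \<in> S \<Longrightarrow> linear (F x)"
    and smooth: "\<And>b. b \<in> Basis \<Longrightarrow> smooth_on S (\<lambda>x. F x b)"
  shows "smooth_on S (\<lambda>x. Blinfun (F x))"
proof -
  have "smooth_on S (\<lambda>x. \<Sum>b\<in>Basis. Blinfun (\<lambda>v. (v \<bullet> b) *\<^sub>R F x b))"
    by (intro smooth_on_sum S smooth_on_bounded_linear[OF S bounded_linear_rank_one] smooth)
  then show ?thesis
  proof (rule smooth_on_cong[OF S, rotated])
    fix x assume x: "x \<in> S"
    show "(\<Sum>b\<in>Basis. Blinfun (\<lambda>v. (v \<bullet> b) *\<^sub>R F x b)) = Blinfun (F x)"
    proof (rule blinfun_eqI)
      fix v
      show "(\<Sum>b\<in>Basis. Blinfun (\<lambda>v. (v \<bullet> b) *\<^sub>R F x b)) v = Blinfun (F x) v"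
        unfolding blinfun.sum_left bounded_linear_Blinfun_apply[OF bounded_linear_inner_scaleR]
          Blinfun_apply_linear[OF lin[OF x]] by (rule linear_basis_expansion[OF lin[OF x], symmetric])
    qed
  qed
qed

section \<open>Smooth dependence of solutions of differential equations\<close>

text \<open>The superposition (Nemytskii) operator. The composite need not be bounded or continuous,
  in which case \<open>Bcontfun\<close> gives no information; hence the hypotheses of the evaluation
  lemmas.\<close>

definition superpose :: "('a \<Rightarrow> 'b::real_normed_vector) \<Rightarrow> (real \<Rightarrow>\<^sub>C 'a::real_normed_vector) \<Rightarrow> (real \<Rightarrow>\<^sub>C 'b)" where
  "superpose h f = Bcontfun (\<lambda>t. h (apply_bcontfun f t))"

lemma superpose_apply:
  assumes "continuous_on X h" "bounded (h ` X)" "\<And>t. apply_bcontfun f t \<in> X"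
  shows "apply_bcontfun (superpose h f) t = h (apply_bcontfun f t)"
proof -
  have "(\<lambda>t. h (apply_bcontfun f t)) \<in> bcontfun"
    using assms by (auto simp: bcontfun_def intro!: continuous_on_compose2[OF assms(1)] intro: bounded_subset)
  then show ?thesis unfolding superpose_def by (simp add: Bcontfun_inverse)
qed

text \<open>Being bounded and bilinear, multiplication of a curve by one coordinate of another is
  the building block for the derivative of a superposition operator.\<close>

definition scale_component :: "'a::real_inner \<Rightarrow> (real \<Rightarrow>\<^sub>C 'b::real_normed_vector) \<Rightarrow> (real \<Rightarrow>\<^sub>C 'a) \<Rightarrow> (real \<Rightarrow>\<^sub>C 'b)" where
  "scale_component b F k = Bcontfun (\<lambda>t. (apply_bcontfun k t \<bullet> b) *\<^sub>R apply_bcontfun F t)"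

lemma scale_component_bound:
  "norm ((apply_bcontfun k t \<bullet> b) *\<^sub>R apply_bcontfun F t) \<le> norm F * norm k * norm b"
proof -
  have "norm ((apply_bcontfun k t \<bullet> b) *\<^sub>R apply_bcontfun F t) = \<bar>apply_bcontfun k t \<bullet> b\<bar> * norm (apply_bcontfun F t)"
    by simp
  also have "\<dots> \<le> (norm (apply_bcontfun k t) * norm b) * norm (apply_bcontfun F t)"
    by (intro mult_right_mono Cauchy_Schwarz_ineq2) simp
  also have "\<dots> \<le> (norm k * norm b) * norm F"
    by (intro mult_mono norm_bounded) auto
  finally show ?thesis by (simp add: ac_simps)
qed

lemma scale_component_apply [simp]:
  "apply_bcontfun (scale_component b F k) t = (apply_bcontfun k t \<bullet> b) *\<^sub>R apply_bcontfun F t"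
proof -
  have "(\<lambda>t. (apply_bcontfun k t \<bullet> b) *\<^sub>R apply_bcontfun F t) \<in> bcontfun"
    by (intro bcontfun_normI[OF _ scale_component_bound] continuous_intros continuous_on_apply_bcontfun)
  then show ?thesis unfolding scale_component_def by (simp add: Bcontfun_inverse)
qed

lemma bounded_bilinear_scale_component: "bounded_bilinear (scale_component b)"
proof
  show "\<exists>K. \<forall>F k. norm (scale_component b F k) \<le> norm F * norm k * K"
    by (intro exI[of _ "norm b"] allI norm_bound) (simp only: scale_component_apply scale_component_bound)
qed (auto intro!: bcontfun_eqI simp: algebra_simps inner_add_left)

text \<open>Elements of the curve space live on the whole real line, so the integral is frozen
  outside {0..1} to keep it bounded. The unit length of the interval makes the norm of the operator
  at most 1.\<close>

definition primitive :: "(real \<Rightarrow>\<^sub>C 'a::banach) \<Rightarrow> (real \<Rightarrow>\<^sub>C 'a)" where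
  "primitive f = Bcontfun (\<lambda>t. integral {0..max 0 (min 1 t)} (apply_bcontfun f))"

lemma primitive_bound:
  fixes f :: "real \<Rightarrow>\<^sub>C 'a::banach"
  shows "norm (integral {0..max 0 (min 1 t)} (apply_bcontfun f)) \<le> norm f"
proof -
  have "norm (integral {0..max 0 (min 1 t)} (apply_bcontfun f)) \<le> norm f * (max 0 (min 1 t) - 0)"
    by (intro integral_bound) (auto intro: norm_bounded)
  also have "\<dots> \<le> norm f * 1" by (intro mult_left_mono) auto
  finally show ?thesis by simp
qed

lemma primitive_apply:
  fixes f :: "real \<Rightarrow>\<^sub>C 'a::banach"
  shows "apply_bcontfun (primitive f) t = integral {0..max 0 (min 1 t)} (apply_bcontfun f)"
proof -
  have "continuous_on {0..1} (\<lambda>u. integral {0..u} (apply_bcontfun f))"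
    by (intro indefinite_integral_continuous_1 integrable_continuous_real) simp
  then have "continuous_on UNIV (\<lambda>t. integral {0..max 0 (min 1 t)} (apply_bcontfun f))"
    by (rule continuous_on_compose2) (auto intro!: continuous_intros)
  then have "(\<lambda>t. integral {0..max 0 (min 1 t)} (apply_bcontfun f)) \<in> bcontfun"
    by (rule bcontfun_normI[OF _ primitive_bound])
  then show ?thesis unfolding primitive_def by (simp add: Bcontfun_inverse)
qed

lemma bounded_linear_primitive: "bounded_linear (primitive :: (real \<Rightarrow>\<^sub>C 'a::banach) \<Rightarrow> _)"
proof (rule bounded_linear_intro[where K=1])
  fix f g :: "real \<Rightarrow>\<^sub>C 'a" and r :: real
  have int: "apply_bcontfun f integrable_on {a..b}" for f :: "real \<Rightarrow>\<^sub>C 'a" and a b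
    by (intro integrable_continuous_real) simp
  show "primitive (f + g) = primitive f + primitive g"
    by (rule bcontfun_eqI) (simp add: primitive_apply integral_add[OF int int])
  show "primitive (r *\<^sub>R f) = r *\<^sub>R primitive f"
    by (rule bcontfun_eqI) (simp add: primitive_apply)
  show "norm (primitive f) \<le> norm f * 1"
    by (rule norm_bound) (simp only: primitive_apply primitive_bound mult_1_right)
qed

lemma norm_primitive: "norm (primitive f) \<le> norm f"
  by (rule norm_bound) (simp only: primitive_apply primitive_bound)

lemma primitive_has_vector_derivative:
  fixes f :: "real \<Rightarrow>\<^sub>C 'a::banach"
  assumes "t \<in> {0..1}"
  shows "(apply_bcontfun (primitive f) has_vector_derivative apply_bcontfun f t) (at t within {0..1})"
proof -
  have "((\<lambda>u. integral {0..u} (apply_bcontfun f)) has_vector_derivative apply_bcontfun f t) (at t within {0..1})"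
    using assms by (intro integral_has_vector_derivative) auto
  then show ?thesis
    by (rule has_vector_derivative_transform[OF assms, rotated]) (simp add: primitive_apply)
qed

lemma bounded_linear_const_bcontfun:
  "bounded_linear (const_bcontfun :: 'a::real_normed_vector \<Rightarrow> ('b::topological_space \<Rightarrow>\<^sub>C 'a))"
  by (rule bounded_linear_intro[where K=1]) (auto intro!: bcontfun_eqI norm_bound)

lemma bounded_linear_apply_bcontfun:
  "bounded_linear (\<lambda>f :: 'b::topological_space \<Rightarrow>\<^sub>C 'a::real_normed_vector. apply_bcontfun f t)"
  by (rule bounded_linear_intro[where K=1]) (auto intro: norm_bounded)

section \<open>Derivatives of superposition operators\<close>

lemma uniform_linearization:
  fixes h :: "'a::euclidean_space \<Rightarrow> 'b::real_normed_vector"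
  assumes X: "open X" "smooth_on X h" and K: "compact K" "convex K" "K \<subseteq> X" and e: "e > 0"
  obtains d where "d > 0"
    "\<And>x y. x \<in> K \<Longrightarrow> y \<in> K \<Longrightarrow> norm (y - x) < d \<Longrightarrow>
      norm (h y - h x - frechet_derivative h (at x) (y - x)) \<le> e * norm (y - x)"
proof -
  \<comment> \<open>The derivatives will differ by at most \<open>\<eta>\<close> on each basis
    vector; summing over the basis costs the factor DIM.\<close>
  define \<eta> where "\<eta> = e / real (DIM('a))"
  have \<eta>: "\<eta> > 0" using e by (simp add: \<eta>_def)
  have "\<exists>d>0. \<forall>x\<in>K. \<forall>y\<in>K. dist y x < d \<longrightarrow>
      dist (frechet_derivative h (at y) b) (frechet_derivative h (at x) b) < \<eta>" for b
  proof -
    have "uniformly_continuous_on K (\<lambda>x. frechet_derivative h (at x) b)"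
      by (intro compact_uniformly_continuous K
          continuous_on_subset[OF smooth_on_continuous[OF smooth_on_derivative[OF X(2)]] K(3)])
    then show ?thesis using \<eta> unfolding uniformly_continuous_on_def by blast
  qed
  then obtain d where d: "\<And>b. d b > 0"
    "\<And>b x y. x \<in> K \<Longrightarrow> y \<in> K \<Longrightarrow> dist y x < d b \<Longrightarrow>
      dist (frechet_derivative h (at y) b) (frechet_derivative h (at x) b) < \<eta>"
    by metis
  define \<delta> where "\<delta> = Min (d ` (Basis :: 'a set))"
  have \<delta>: "\<delta> > 0" "\<And>b. b \<in> Basis \<Longrightarrow> \<delta> \<le> d b"
    using d(1) by (auto simp: \<delta>_def)
  show thesis
  proof
    show "\<delta> > 0" by (rule \<delta>)
    fix x y assume xy: "x \<in> K" "y \<in> K" "norm (y - x) < \<delta>"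
    \<comment> \<open>Convexity of \<open>K\<close> keeps this segment, on which the derivative is
      compared with its value at \<open>x\<close>, inside the set where the partial derivatives are
      uniformly continuous.\<close>
    define S where "S = closed_segment x y"
    have S: "S \<subseteq> K" "x \<in> S" "y \<in> S" using K(2) xy by (auto simp: S_def closed_segment_subset)
    have "norm (h y - h x - frechet_derivative h (at x) (y - x)) \<le> norm (y - x) * e"
    proof (rule differentiable_bound_linearization[where S=S])
      fix t :: real assume "t \<in> {0..1}"
      then show "x + t *\<^sub>R (y - x) \<in> S" unfolding S_def closed_segment_def
        by (auto intro!: exI[of _ t] simp: algebra_simps)
    next
      fix z assume z: "z \<in> S"
      then have zX: "z \<in> X" and xX: "x \<in> X" using S K(3) xy by auto
      show "(h has_derivative frechet_derivative h (at z)) (at z within S)"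
        by (rule has_derivative_at_withinI[OF smooth_on_has_derivative[OF X(2) zX]])
      have "norm (z - x) \<le> norm (y - x)"
        using z segment_bound(1)[of z x y] unfolding S_def by (simp add: norm_minus_commute)
      then have zx: "dist z x < \<delta>" using xy by (simp add: dist_norm)
      define L where "L k = frechet_derivative h (at z) k - frechet_derivative h (at x) k" for k
      have "linear L" unfolding L_def
        by (intro linear_compose_sub smooth_on_linear_derivative[OF X(2)] zX xX)
      have Lb: "norm (L b) \<le> \<eta>" if "b \<in> Basis" for b
        using d(2)[OF xy(1), of z b] z S(1) zx \<delta>(2)[OF that] by (auto simp: L_def dist_norm intro: less_imp_le)
      have "norm (L k) \<le> e * norm k" for k
      proof -
        have "norm (L k) = norm (\<Sum>b\<in>Basis. (k \<bullet> b) *\<^sub>R L b)"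
          using linear_basis_expansion[OF \<open>linear L\<close>, of k] by simp
        also have "\<dots> \<le> (\<Sum>b\<in>(Basis::'a set). norm k * \<eta>)"
          using Lb by (intro order_trans[OF norm_sum] sum_mono) (auto intro!: mult_mono Basis_le_norm)
        also have "\<dots> = e * norm k" by (simp add: \<eta>_def)
        finally show ?thesis .
      qed
      then show "onorm (frechet_derivative h (at z) - frechet_derivative h (at x)) \<le> e"
        unfolding L_def by (intro onorm_le) simp
    qed (use S in auto)
    then show "norm (h y - h x - frechet_derivative h (at x) (y - x)) \<le> e * norm (y - x)"
      by (simp add: mult.commute)
  qed
qed

text \<open>This set need not be open in the space of curves, which is why superposition operators
  are differentiated within it.\<close>

definition bcontfun_into :: "'a set \<Rightarrow> (real \<Rightarrow>\<^sub>C 'a::real_normed_vector) set" where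
  "bcontfun_into K = {f. \<forall>t. apply_bcontfun f t \<in> K}"

lemma superpose_apply_compact:
  assumes "compact K" "continuous_on K h" "f \<in> bcontfun_into K"
  shows "apply_bcontfun (superpose h f) t = h (apply_bcontfun f t)"
  using assms by (intro superpose_apply[of K]) (auto simp: bcontfun_into_def compact_imp_bounded compact_continuous_image)

lemma continuous_on_superpose:
  assumes K: "compact K" "continuous_on K h"
  shows "continuous_on (bcontfun_into K) (superpose h)"
  unfolding continuous_on_iff
proof (intro ballI allI impI)
  fix f and e :: real assume f: "f \<in> bcontfun_into K" and e: "e > 0"
  obtain d where d: "d > 0" "\<And>x y. x \<in> K \<Longrightarrow> y \<in> K \<Longrightarrow> dist y x < d \<Longrightarrow> dist (h y) (h x) < e / 2"
    using compact_uniformly_continuous[OF K(2,1)] e unfolding uniformly_continuous_on_def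
    by (metis half_gt_zero)
  have "dist (superpose h g) (superpose h f) < e" if g: "g \<in> bcontfun_into K" and "dist g f < d" for g
  proof -
    have "dist (h (apply_bcontfun g t)) (h (apply_bcontfun f t)) < e / 2" for t
      using f g that(2) dist_bounded[of g t f] unfolding bcontfun_into_def by (intro d(2)) auto
    then have "dist (superpose h g) (superpose h f) \<le> e / 2"
      by (intro dist_bound) (simp add: superpose_apply_compact[OF K f] superpose_apply_compact[OF K g] less_imp_le)
    then show ?thesis using e by simp
  qed
  then show "\<exists>d>0. \<forall>g\<in>bcontfun_into K. dist g f < d \<longrightarrow> dist (superpose h g) (superpose h f) < e"
    using d(1) by blast
qed

text \<open>Pointwise multiplication by the derivative of \<open>h\<close> along \<open>f\<close>.
  Written through partial derivatives, it depends on \<open>f\<close> only through finitely many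
  superpositions and inherits their regularity.\<close>

definition superpose_derivative ::
  "('a::euclidean_space \<Rightarrow> 'b::real_normed_vector) \<Rightarrow> (real \<Rightarrow>\<^sub>C 'a) \<Rightarrow> (real \<Rightarrow>\<^sub>C 'a) \<Rightarrow>\<^sub>L (real \<Rightarrow>\<^sub>C 'b)" where
  "superpose_derivative h f = (\<Sum>b\<in>Basis. bounded_bilinear.prod_right (scale_component b)
     (superpose (\<lambda>x. frechet_derivative h (at x) b) f))"

lemma superpose_derivative_eq:
  "blinfun_apply (superpose_derivative h f) k =
    (\<Sum>b\<in>Basis. scale_component b (superpose (\<lambda>x. frechet_derivative h (at x) b) f) k)"
  by (simp add: superpose_derivative_def blinfun.sum_left
      bounded_bilinear.prod_right.rep_eq[OF bounded_bilinear_scale_component])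

lemma apply_bcontfun_sum: "apply_bcontfun (\<Sum>i\<in>I. F i) t = (\<Sum>i\<in>I. apply_bcontfun (F i) t)"
  by (rule linear_sum[OF bounded_linear.linear[OF bounded_linear_apply_bcontfun]])

context
  fixes X K :: "'a::euclidean_space set" and h :: "'a \<Rightarrow> 'b::real_normed_vector"
  assumes X: "open X" "smooth_on X h" and K: "compact K" "convex K" "K \<subseteq> X"
begin

lemma continuous_on_compact_smooth: "continuous_on K h"
  by (rule continuous_on_subset[OF smooth_on_continuous[OF X(2)] K(3)])

lemma continuous_on_compact_smooth_derivative: "continuous_on K (\<lambda>x. frechet_derivative h (at x) b)"
  by (rule continuous_on_subset[OF smooth_on_continuous[OF smooth_on_derivative[OF X(2)]] K(3)])

lemma superpose_derivative_apply:
  assumes f: "f \<in> bcontfun_into K"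
  shows "apply_bcontfun (superpose_derivative h f k) t =
    frechet_derivative h (at (apply_bcontfun f t)) (apply_bcontfun k t)"
proof -
  have "apply_bcontfun f t \<in> X" using f K(3) by (auto simp: bcontfun_into_def)
  then show ?thesis
    by (simp add: superpose_derivative_eq apply_bcontfun_sum
      superpose_apply_compact[OF K(1) continuous_on_compact_smooth_derivative f]
      flip: linear_basis_expansion[OF smooth_on_linear_derivative[OF X(2)]])
qed

text \<open>The linearisation error of \<open>h\<close> is uniform over \<open>K\<close>, so it
  passes to the supremum over all times.\<close>

lemma superpose_has_derivative:
  assumes f: "f \<in> bcontfun_into K"
  shows "(superpose h has_derivative superpose_derivative h f) (at f within bcontfun_into K)"
  unfolding has_derivative_within_alt
proof (intro conjI allI impI)
  show "bounded_linear (blinfun_apply (superpose_derivative h f))" by (rule blinfun.bounded_linear_right)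
  fix e :: real assume "e > 0"
  then obtain d where d: "d > 0" "\<And>x y. x \<in> K \<Longrightarrow> y \<in> K \<Longrightarrow> norm (y - x) < d \<Longrightarrow>
      norm (h y - h x - frechet_derivative h (at x) (y - x)) \<le> e * norm (y - x)"
    using uniform_linearization[OF X K] by metis
  have "norm (superpose h g - superpose h f - superpose_derivative h f (g - f)) \<le> e * norm (g - f)"
    if g: "g \<in> bcontfun_into K" and gf: "norm (g - f) < d" for g
  proof (rule norm_bound)
    fix t
    have "norm (apply_bcontfun (g - f) t) \<le> norm (g - f)" by (rule norm_bounded)
    then have nt: "norm (apply_bcontfun g t - apply_bcontfun f t) \<le> norm (g - f)" by simp
    have "norm (h (apply_bcontfun g t) - h (apply_bcontfun f t) -
      frechet_derivative h (at (apply_bcontfun f t)) (apply_bcontfun g t - apply_bcontfun f t))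
      \<le> e * norm (apply_bcontfun g t - apply_bcontfun f t)"
      using f g gf nt unfolding bcontfun_into_def by (intro d(2)) auto
    also have "\<dots> \<le> e * norm (g - f)" using nt \<open>e > 0\<close> by simp
    finally show "norm (apply_bcontfun (superpose h g - superpose h f - superpose_derivative h f (g - f)) t)
      \<le> e * norm (g - f)"
      by (simp add: superpose_derivative_apply[OF f] superpose_apply_compact[OF K(1) continuous_on_compact_smooth f]
          superpose_apply_compact[OF K(1) continuous_on_compact_smooth g])
  qed
  then show "\<exists>d>0. \<forall>g\<in>bcontfun_into K. norm (g - f) < d \<longrightarrow>
    norm (superpose h g - superpose h f - superpose_derivative h f (g - f)) \<le> e * norm (g - f)"
    using d(1) by blast
qed

end

text \<open>Induction on the order with \<open>h\<close> general: the derivative of the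
  superposition by \<open>h\<close> is made of superpositions by the partial derivatives of
  \<open>h\<close>. Since \<open>u\<close> maps the open set \<open>S\<close> into
  \<open>bcontfun_into K\<close>, a derivative within that set is enough for the chain rule.\<close>

lemma higher_differentiable_on_superpose:
  fixes h :: "'a::euclidean_space \<Rightarrow> 'b::real_normed_vector" and u :: "'c::real_normed_vector \<Rightarrow> (real \<Rightarrow>\<^sub>C 'a)"
  assumes X: "open X" "smooth_on X h" and K: "compact K" "convex K" "K \<subseteq> X"
    and S: "open S" and uK: "u ` S \<subseteq> bcontfun_into K" and u: "higher_differentiable_on S u n"
  shows "higher_differentiable_on S (\<lambda>\<xi>. superpose h (u \<xi>)) n"
  using X(2) u
proof (induction n arbitrary: h)
  case 0
  have "continuous_on (bcontfun_into K) (superpose h)"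
    by (intro continuous_on_superpose K continuous_on_compact_smooth[OF X(1) 0(1) K])
  then have "continuous_on S (\<lambda>\<xi>. superpose h (u \<xi>))"
    by (rule continuous_on_compose2) (use 0 uK in auto)
  then show ?case by simp
next
  case (Suc n)
  have un: "higher_differentiable_on S u n" by (rule higher_differentiable_on_SucD[OF Suc.prems(2)])
  show ?case
  proof (rule higher_differentiable_on_SucI[OF S])
    fix \<xi> assume \<xi>: "\<xi> \<in> S"
    have u': "(u has_derivative frechet_derivative u (at \<xi>)) (at \<xi> within S)"
      using Suc.prems(2) \<xi> by (simp add: has_derivative_at_withinI[OF frechet_derivative_has_derivative])
    have "((\<lambda>\<xi>. superpose h (u \<xi>)) has_derivative
      (\<lambda>v. superpose_derivative h (u \<xi>) (frechet_derivative u (at \<xi>) v))) (at \<xi> within S)"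
      by (rule has_derivative_in_compose[OF u' has_derivative_subset[OF superpose_has_derivative[OF X(1) Suc.prems(1) K] uK]])
        (use \<xi> uK in auto)
    then show "((\<lambda>\<xi>. superpose h (u \<xi>)) has_derivative
      (\<lambda>v. superpose_derivative h (u \<xi>) (frechet_derivative u (at \<xi>) v))) (at \<xi>)"
      using at_within_open[OF \<xi> S] by simp
  next
    fix v
    have "higher_differentiable_on S (\<lambda>\<xi>. superpose (\<lambda>x. frechet_derivative h (at x) b) (u \<xi>)) n" for b
      by (rule Suc.IH[OF smooth_on_derivative[OF Suc.prems(1)] un])
    moreover have "higher_differentiable_on S (\<lambda>\<xi>. frechet_derivative u (at \<xi>) v) n" using Suc.prems(2) by simp
    ultimately show "higher_differentiable_on S (\<lambda>\<xi>. superpose_derivative h (u \<xi>) (frechet_derivative u (at \<xi>) v)) n"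
      unfolding superpose_derivative_eq
      by (intro higher_differentiable_on_sum S higher_differentiable_on_bilinear[OF S bounded_bilinear_scale_component])
  qed
qed

lemma higher_differentiable_on_superpose_derivative:
  assumes X: "open X" "smooth_on X h" and K: "compact K" "convex K" "K \<subseteq> X"
    and S: "open S" and uK: "u ` S \<subseteq> bcontfun_into K" and u: "higher_differentiable_on S u n"
  shows "higher_differentiable_on S (\<lambda>\<xi>. superpose_derivative h (u \<xi>)) n"
  unfolding superpose_derivative_def
  by (intro higher_differentiable_on_sum S
      higher_differentiable_on_bounded_linear[OF S bounded_bilinear.bounded_linear_prod_right[OF bounded_bilinear_scale_component]]
      higher_differentiable_on_superpose[OF X(1) smooth_on_derivative[OF X(2)] K S uK u])

section \<open>Smooth dependence of fixed points on parameters\<close>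

lemma contraction_from_derivative:
  fixes g :: "'a::euclidean_space \<Rightarrow> 'a"
  assumes g: "smooth_on X g" and K: "convex K" "K \<subseteq> X"
    and contraction: "\<And>x v. x \<in> K \<Longrightarrow> norm (frechet_derivative g (at x) v) \<le> norm v / 2"
    and xy: "x \<in> K" "y \<in> K"
  shows "norm (g y - g x) \<le> norm (y - x) / 2"
proof -
  have "norm (g y - g x) \<le> 1/2 * norm (y - x)"
  proof (rule differentiable_bound[OF K(1)])
    fix z assume z: "z \<in> K"
    show "(g has_derivative frechet_derivative g (at z)) (at z within K)"
      using z K(2) by (auto intro!: has_derivative_at_withinI[OF smooth_on_has_derivative[OF g]])
    show "onorm (frechet_derivative g (at z)) \<le> 1/2"
      using contraction[OF z] by (intro onorm_le) simp
  qed (use xy in auto)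
  then show ?thesis by simp
qed

text \<open>Differentiating the fixed point equation gives u' = J + A u', where \<open>A\<close> is
  the primitive of the linearised superposition and has norm at most 1/2. Hence u' = Q J with
  \<open>Q\<close> inverse to id - A. As \<open>A\<close> is as regular as \<open>u\<close>, so is
  \<open>Q\<close>, and the formula gains one order each time.\<close>

lemma picard_solution_smooth:
  fixes g :: "'a::euclidean_space \<Rightarrow> 'a" and u :: "'c::real_normed_vector \<Rightarrow> (real \<Rightarrow>\<^sub>C 'a)"
  assumes X: "open X" "smooth_on X g" and K: "compact K" "convex K" "K \<subseteq> X"
    and contraction: "\<And>x v. x \<in> K \<Longrightarrow> norm (frechet_derivative g (at x) v) \<le> norm v / 2"
    and S: "open S" and l: "bounded_linear l"
    and uK: "u ` S \<subseteq> bcontfun_into K"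
    and fix_eq: "\<And>\<xi>. \<xi> \<in> S \<Longrightarrow> u \<xi> = const_bcontfun (a + l \<xi>) + primitive (superpose g (u \<xi>))"
  shows "smooth_on S u"
proof -
  have inK: "u \<xi> \<in> bcontfun_into K" if "\<xi> \<in> S" for \<xi> using that uK by blast
  define J :: "'c \<Rightarrow> (real \<Rightarrow>\<^sub>C 'a)" where "J v = const_bcontfun (l v)" for v
  have blJ: "bounded_linear J" unfolding J_def by (rule bounded_linear_compose[OF bounded_linear_const_bcontfun l])
  have J_diff: "const_bcontfun (a + l \<xi>') - const_bcontfun (a + l \<xi>) = J (\<xi>' - \<xi>)" for \<xi> \<xi>'
    unfolding J_def by (rule bcontfun_eqI) (simp add: linear_diff[OF bounded_linear.linear[OF l]])
  obtain C where C: "\<And>v. norm (J v) \<le> norm v * C" "C > 0"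
    using bounded_linear.pos_bounded[OF blJ] by blast
  have contg: "continuous_on K g" by (rule continuous_on_compact_smooth[OF X K])
  have lip: "norm (g y - g x) \<le> norm (y - x) / 2" if "x \<in> K" "y \<in> K" for x y
    by (rule contraction_from_derivative[OF X(2) K(2,3) contraction that])
  define P where "P = Blinfun (primitive :: (real \<Rightarrow>\<^sub>C 'a) \<Rightarrow> _)"
  have P: "blinfun_apply P = primitive"
    unfolding P_def by (rule bounded_linear_Blinfun_apply[OF bounded_linear_primitive])
  define A where "A \<xi> = P o\<^sub>L superpose_derivative g (u \<xi>)" for \<xi>
  have normA: "norm (A \<xi>) \<le> 1/2" if \<xi>: "\<xi> \<in> S" for \<xi>
  proof (rule norm_blinfun_bound)
    fix k :: "real \<Rightarrow>\<^sub>C 'a"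
    have "norm (A \<xi> k) \<le> norm (superpose_derivative g (u \<xi>) k)"
      by (simp add: A_def P norm_primitive)
    also have "\<dots> \<le> 1/2 * norm k"
    proof (rule norm_bound)
      fix t
      have "norm (apply_bcontfun (superpose_derivative g (u \<xi>) k) t) \<le> norm (apply_bcontfun k t) / 2"
        unfolding superpose_derivative_apply[OF X K inK[OF \<xi>]]
        using inK[OF \<xi>] by (intro contraction) (simp add: bcontfun_into_def)
      then show "norm (apply_bcontfun (superpose_derivative g (u \<xi>) k) t) \<le> 1/2 * norm k"
        using norm_bounded[of k t] by simp
    qed
    finally show "norm (A \<xi> k) \<le> 1/2 * norm k" .
  qed simp
  have "\<exists>Q. (\<forall>v. blinfun_apply Q (v - A \<xi> v) = v) \<and> (\<forall>v. Q v - A \<xi> (Q v) = v) \<and> norm Q \<le> 2" if "\<xi> \<in> S" for \<xi>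
    using blinfun_inverse_near_id[OF normA[OF that]] by metis
  then obtain Q where Q: "\<And>\<xi> v. \<xi> \<in> S \<Longrightarrow> blinfun_apply (Q \<xi>) (v - A \<xi> v) = v"
    "\<And>\<xi> v. \<xi> \<in> S \<Longrightarrow> Q \<xi> v - A \<xi> (Q \<xi> v) = v" "\<And>\<xi>. \<xi> \<in> S \<Longrightarrow> norm (Q \<xi>) \<le> 2"
    by metis
  \<comment> \<open>The contraction absorbs half of the difference, which leaves the Lipschitz
    constant 2 C. It is needed before the derivative, to measure the linearisation error in the
    space of curves by the parameter increment.\<close>
  have u_lip: "norm (u \<xi>' - u \<xi>) \<le> 2 * C * norm (\<xi>' - \<xi>)" if \<xi>: "\<xi> \<in> S" "\<xi>' \<in> S" for \<xi> \<xi>'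
  proof -
    have "u \<xi>' - u \<xi> = J (\<xi>' - \<xi>) + primitive (superpose g (u \<xi>') - superpose g (u \<xi>))"
      by (subst (1 2) fix_eq, fact+)
        (simp add: linear_diff[OF bounded_linear.linear[OF bounded_linear_primitive]] flip: J_diff)
    then have "norm (u \<xi>' - u \<xi>) \<le> norm (J (\<xi>' - \<xi>)) + norm (superpose g (u \<xi>') - superpose g (u \<xi>))"
      by (metis norm_triangle_le norm_primitive add_left_mono)
    moreover have "norm (superpose g (u \<xi>') - superpose g (u \<xi>)) \<le> norm (u \<xi>' - u \<xi>) / 2"
    proof (rule norm_bound)
      fix t
      have "norm (g (apply_bcontfun (u \<xi>') t) - g (apply_bcontfun (u \<xi>) t)) \<le>
        norm (apply_bcontfun (u \<xi>' - u \<xi>) t) / 2"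
        using lip[of "apply_bcontfun (u \<xi>) t" "apply_bcontfun (u \<xi>') t"] inK[OF \<xi>(1)] inK[OF \<xi>(2)]
        by (simp add: bcontfun_into_def)
      also have "\<dots> \<le> norm (u \<xi>' - u \<xi>) / 2" by (intro divide_right_mono norm_bounded) simp
      finally show "norm (apply_bcontfun (superpose g (u \<xi>') - superpose g (u \<xi>)) t) \<le> norm (u \<xi>' - u \<xi>) / 2"
        by (simp add: superpose_apply_compact[OF K(1) contg inK] \<xi>)
    qed
    moreover have "norm (J (\<xi>' - \<xi>)) \<le> C * norm (\<xi>' - \<xi>)" using C(1)[of "\<xi>' - \<xi>"] by (simp add: mult.commute)
    ultimately have "norm (u \<xi>' - u \<xi>) \<le> 2 * (C * norm (\<xi>' - \<xi>))" by linarith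
    then show ?thesis by simp
  qed
  have u_deriv: "(u has_derivative (\<lambda>v. Q \<xi> (J v))) (at \<xi> within S)" if \<xi>: "\<xi> \<in> S" for \<xi>
    unfolding has_derivative_within_alt
  proof (intro conjI allI impI)
    show "bounded_linear (\<lambda>v. Q \<xi> (J v))" by (rule bounded_linear_compose[OF blinfun.bounded_linear_right blJ])
    fix e :: real assume e: "e > 0"
    \<comment> \<open>The bound 2 on \<open>Q\<close> and the Lipschitz constant 2 C multiply to 4
      C.\<close>
    define e' where "e' = e / (4 * C)"
    have e': "e' > 0" using e C by (simp add: e'_def)
    obtain d where d: "d > 0" "\<And>f. f \<in> bcontfun_into K \<Longrightarrow> norm (f - u \<xi>) < d \<Longrightarrow>
        norm (superpose g f - superpose g (u \<xi>) - superpose_derivative g (u \<xi>) (f - u \<xi>)) \<le> e' * norm (f - u \<xi>)"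
      using superpose_has_derivative[OF X K inK[OF \<xi>]] e' unfolding has_derivative_within_alt by metis
    have "norm (u \<xi>' - u \<xi> - Q \<xi> (J (\<xi>' - \<xi>))) \<le> e * norm (\<xi>' - \<xi>)"
      if \<xi>': "\<xi>' \<in> S" and near: "norm (\<xi>' - \<xi>) < d / (2 * C)" for \<xi>'
    proof -
      \<comment> \<open>The remainder of the superposition. Applying \<open>Q\<close> to the
        difference of the two fixed point equations leaves an error equal to \<open>Q\<close> of the
        primitive of \<open>r\<close>.\<close>
      define r where "r = superpose g (u \<xi>') - superpose g (u \<xi>) - superpose_derivative g (u \<xi>) (u \<xi>' - u \<xi>)"
      have "2 * C * norm (\<xi>' - \<xi>) < d" using near C(2) by (simp add: field_simps)
      then have "norm (u \<xi>' - u \<xi>) < d" using u_lip[OF \<xi> \<xi>'] by linarith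
      then have r: "norm r \<le> e' * norm (u \<xi>' - u \<xi>)" unfolding r_def by (intro d inK \<xi>')
      have "u \<xi>' - u \<xi> = J (\<xi>' - \<xi>) + primitive (superpose g (u \<xi>') - superpose g (u \<xi>))"
        by (subst (1 2) fix_eq, fact+)
          (simp add: linear_diff[OF bounded_linear.linear[OF bounded_linear_primitive]] flip: J_diff)
      also have "superpose g (u \<xi>') - superpose g (u \<xi>) = superpose_derivative g (u \<xi>) (u \<xi>' - u \<xi>) + r"
        by (simp add: r_def)
      also have "primitive (superpose_derivative g (u \<xi>) (u \<xi>' - u \<xi>) + r) = A \<xi> (u \<xi>' - u \<xi>) + primitive r"
        by (simp add: A_def P linear_add[OF bounded_linear.linear[OF bounded_linear_primitive]])
      finally have "(u \<xi>' - u \<xi>) - A \<xi> (u \<xi>' - u \<xi>) = J (\<xi>' - \<xi>) + primitive r" by (simp add: algebra_simps)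
      then have "u \<xi>' - u \<xi> = Q \<xi> (J (\<xi>' - \<xi>) + primitive r)" using Q(1)[OF \<xi>, of "u \<xi>' - u \<xi>"] by simp
      then have "norm (u \<xi>' - u \<xi> - Q \<xi> (J (\<xi>' - \<xi>))) = norm (Q \<xi> (primitive r))"
        by (simp add: blinfun.add_right)
      also have "\<dots> \<le> 2 * norm r"
        by (rule order_trans[OF norm_blinfun]) (intro mult_mono Q(3)[OF \<xi>] norm_primitive; simp)
      also have "\<dots> \<le> 2 * (e' * (2 * C * norm (\<xi>' - \<xi>)))"
        using r u_lip[OF \<xi> \<xi>'] e' by (intro mult_left_mono order_trans[OF r]) auto
      also have "\<dots> = e * norm (\<xi>' - \<xi>)" using C(2) by (simp add: e'_def)
      finally show ?thesis .
    qed
    then show "\<exists>d>0. \<forall>\<xi>'\<in>S. norm (\<xi>' - \<xi>) < d \<longrightarrow> norm (u \<xi>' - u \<xi> - Q \<xi> (J (\<xi>' - \<xi>))) \<le> e * norm (\<xi>' - \<xi>)"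
      using d(1) C(2) by (intro exI[of _ "d / (2 * C)"]) auto
  qed
  have "higher_differentiable_on S u n" for n
  proof (induction n)
    case 0
    have "continuous_on S u"
      unfolding continuous_on_eq_continuous_within by (intro ballI has_derivative_continuous[OF u_deriv])
    then show ?case by simp
  next
    case (Suc n)
    show ?case
    proof (rule higher_differentiable_on_SucI[OF S])
      fix \<xi> assume \<xi>: "\<xi> \<in> S"
      show "(u has_derivative (\<lambda>v. Q \<xi> (J v))) (at \<xi>)" using u_deriv[OF \<xi>] at_within_open[OF \<xi> S] by simp
    next
      fix v
      have "higher_differentiable_on S A n"
        unfolding A_def by (intro higher_differentiable_on_bounded_linear[OF S
            bounded_bilinear.bounded_linear_right[OF bounded_bilinear_blinfun_compose]]
            higher_differentiable_on_superpose_derivative[OF X K S uK Suc])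
      then have "higher_differentiable_on S (\<lambda>\<xi>. id_blinfun + - A \<xi>) n"
        by (intro higher_differentiable_on_add S higher_differentiable_on_const
          higher_differentiable_on_bounded_linear[OF S bounded_linear_minus[OF bounded_linear_ident]])
      then have "higher_differentiable_on S Q n"
        by (intro higher_differentiable_on_blinfun_inverse[where P = "\<lambda>\<xi>. id_blinfun + - A \<xi>", OF S _ _ Q(3)])
          (simp_all add: blinfun.diff_left Q(1,2))
      then show "higher_differentiable_on S (\<lambda>\<xi>. Q \<xi> (J v)) n"
        by (rule higher_differentiable_on_bounded_linear[OF S blinfun.bounded_linear_left])
    qed
  qed
  then show ?thesis by (simp add: smooth_on_def)
qed

text \<open>The radius is spent in two halves: the start lies within r / 2 of the centre, and in
  unit time the field moves it by at most r / 2, so the curve stays in the ball during all of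
  {0..1}.\<close>

theorem ode_solution_smooth:
  fixes g :: "'a::euclidean_space \<Rightarrow> 'a" and l :: "'c::real_normed_vector \<Rightarrow> 'a"
  assumes X: "open X" "smooth_on X g" "cball z r \<subseteq> X"
    and bound: "\<And>x. x \<in> cball z r \<Longrightarrow> norm (g x) \<le> r / 2"
    and contraction: "\<And>x v. x \<in> cball z r \<Longrightarrow> norm (frechet_derivative g (at x) v) \<le> norm v / 2"
    and r: "0 < r" and S: "open S" and l: "bounded_linear l"
    and start: "\<And>\<xi>. \<xi> \<in> S \<Longrightarrow> dist z (a + l \<xi>) \<le> r / 2"
  obtains u where "\<And>\<xi>. \<xi> \<in> S \<Longrightarrow> u \<xi> 0 = a + l \<xi>"
    "\<And>\<xi> t. \<xi> \<in> S \<Longrightarrow> u \<xi> t \<in> cball z r"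
    "\<And>\<xi> t. \<xi> \<in> S \<Longrightarrow> t \<in> {0..1} \<Longrightarrow> (u \<xi> has_vector_derivative g (u \<xi> t)) (at t within {0..1})"
    "\<And>t. smooth_on S (\<lambda>\<xi>. u \<xi> t)"
proof -
  define K where "K = cball z r"
  have K: "compact K" "convex K" "K \<subseteq> X" "closed K" "K \<noteq> {}" using X(3) r by (auto simp: K_def)
  have lip: "norm (g y - g x) \<le> norm (y - x) / 2" if "x \<in> K" "y \<in> K" for x y
    by (rule contraction_from_derivative[OF X(2) K(2,3) contraction[folded K_def] that])
  \<comment> \<open>The nearest point projection extends the field to the whole space without
    increasing its Lipschitz constant, so Banach's theorem applies to the full space of curves. The
    projection is removed once the solution is seen to stay in \<open>K\<close>.\<close>
  define G where "G x = g (closest_point K x)" for x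
  have inK: "closest_point K x \<in> K" for x by (rule closest_point_in_set[OF K(4,5)])
  have G_bound: "norm (G x) \<le> r / 2" for x
    using bound[folded K_def, OF inK] by (simp add: G_def)
  have G_lip: "norm (G x - G y) \<le> norm (x - y) / 2" for x y
    using lip[OF inK[of y] inK[of x]] closest_point_lipschitz[OF K(2,4,5), of x y]
    by (simp add: G_def dist_norm)
  have "continuous_on UNIV (\<lambda>x. g (closest_point K x))"
    by (rule continuous_on_compose2[OF continuous_on_compact_smooth[OF X(1,2) K(1,2,3)] continuous_on_closest_point[OF K(2,4,5)]])
      (use inK in auto)
  then have G_cont: "continuous_on UNIV G" by (simp add: G_def[abs_def])
  have G_apply: "apply_bcontfun (superpose G f) t = G (apply_bcontfun f t)" for f t
    by (rule superpose_apply[OF G_cont]) (use G_bound in \<open>auto intro!: boundedI[of _ "r / 2"]\<close>)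
  define T where "T y f = const_bcontfun y + primitive (superpose G f)" for y f
  have "\<exists>!f. T y f = f" for y
  proof (rule banach_fix_type[of "1/2"], simp, simp, intro allI)
    fix f h
    have "dist (T y f) (T y h) = norm (primitive (superpose G f - superpose G h))"
      by (simp add: T_def dist_norm linear_diff[OF bounded_linear.linear[OF bounded_linear_primitive]])
    also have "\<dots> \<le> norm (superpose G f - superpose G h)" by (rule norm_primitive)
    also have "\<dots> \<le> 1/2 * dist f h"
    proof (rule norm_bound)
      fix t
      have "norm (apply_bcontfun (superpose G f - superpose G h) t) \<le> norm (apply_bcontfun (f - h) t) / 2"
        using G_lip[of "apply_bcontfun f t" "apply_bcontfun h t"] by (simp add: G_apply)
      then show "norm (apply_bcontfun (superpose G f - superpose G h) t) \<le> 1/2 * dist f h"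
        using norm_bounded[of "f - h" t] by (simp add: dist_norm)
    qed
    finally show "dist (T y f) (T y h) \<le> 1/2 * dist f h" .
  qed
  then obtain F where F: "\<And>y. T y (F y) = F y" by metis
  define u where "u \<xi> = F (a + l \<xi>)" for \<xi>
  have u_eq: "u \<xi> = const_bcontfun (a + l \<xi>) + primitive (superpose G (u \<xi>))" for \<xi>
    using F[of "a + l \<xi>"] by (simp add: u_def T_def)
  have u_K: "u \<xi> \<in> bcontfun_into K" if \<xi>: "\<xi> \<in> S" for \<xi>
    unfolding bcontfun_into_def mem_Collect_eq
  proof
    fix t
    have "norm (primitive (superpose G (u \<xi>))) \<le> r / 2"
      by (intro order_trans[OF norm_primitive] norm_bound) (simp only: G_apply G_bound)
    then have "norm (apply_bcontfun (primitive (superpose G (u \<xi>))) t) \<le> r / 2"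
      by (rule order_trans[OF norm_bounded])
    moreover have "apply_bcontfun (u \<xi>) t = (a + l \<xi>) + apply_bcontfun (primitive (superpose G (u \<xi>))) t"
      using arg_cong[OF u_eq[of \<xi>], of "\<lambda>f. apply_bcontfun f t"] by simp
    ultimately have "dist (a + l \<xi>) (apply_bcontfun (u \<xi>) t) \<le> r / 2" by (simp add: dist_norm)
    then show "apply_bcontfun (u \<xi>) t \<in> K"
      using dist_triangle[of z "apply_bcontfun (u \<xi>) t" "a + l \<xi>"] start[OF \<xi>] by (simp add: K_def)
  qed
  have u_fix: "u \<xi> = const_bcontfun (a + l \<xi>) + primitive (superpose g (u \<xi>))" if "\<xi> \<in> S" for \<xi>
  proof -
    have "G (apply_bcontfun (u \<xi>) t) = g (apply_bcontfun (u \<xi>) t)" for t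
      using u_K[OF that] by (simp add: G_def bcontfun_into_def closest_point_self)
    then have "superpose G (u \<xi>) = superpose g (u \<xi>)" by (simp add: superpose_def)
    then show ?thesis using u_eq[of \<xi>] by simp
  qed
  have smooth: "smooth_on S u"
    by (rule picard_solution_smooth[OF X(1,2) K(1-3) contraction[folded K_def] S l _ u_fix]) (use u_K in auto)
  show thesis
  proof
    fix \<xi> t assume \<xi>: "\<xi> \<in> S"
    show "apply_bcontfun (u \<xi>) 0 = a + l \<xi>"
      using arg_cong[OF u_eq[of \<xi>], of "\<lambda>f. apply_bcontfun f 0"] by (simp add: primitive_apply)
    show "apply_bcontfun (u \<xi>) t \<in> cball z r"
      using u_K[OF \<xi>] by (simp add: bcontfun_into_def K_def)
    assume t: "t \<in> {0..1::real}"
    have ap: "apply_bcontfun (u \<xi>) = (\<lambda>t. (a + l \<xi>) + apply_bcontfun (primitive (superpose g (u \<xi>))) t)"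
      by (subst u_fix[OF \<xi>]) auto
    have "((\<lambda>t. (a + l \<xi>) + apply_bcontfun (primitive (superpose g (u \<xi>))) t) has_vector_derivative
        0 + apply_bcontfun (superpose g (u \<xi>)) t) (at t within {0..1})"
      by (intro has_vector_derivative_add has_vector_derivative_const primitive_has_vector_derivative t)
    then show "(apply_bcontfun (u \<xi>) has_vector_derivative g (apply_bcontfun (u \<xi>) t)) (at t within {0..1})"
      unfolding ap[symmetric]
      by (simp add: superpose_apply_compact[OF K(1) continuous_on_compact_smooth[OF X(1,2) K(1-3)] u_K[OF \<xi>]])
  next
    show "smooth_on S (\<lambda>\<xi>. apply_bcontfun (u \<xi>) t)" for t
      by (rule smooth_on_bounded_linear[OF S bounded_linear_apply_bcontfun smooth])
  qed
qed

section \<open>Multilinear maps and tensors in a chart\<close>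

lemma multilinearD:
  "multilinear n B \<Longrightarrow> length xs = n \<Longrightarrow> i < n \<Longrightarrow> linear (\<lambda>v. B (xs[i := v]))"
  by (simp add: multilinear_def)

lemma multilinear_head:
  assumes "multilinear (Suc n) B" "length vs = n" shows "linear (\<lambda>v. B (v # vs))"
  using multilinearD[OF assms(1), of "0 # vs" 0] assms(2) by simp

lemma multilinear_tail:
  assumes "multilinear (Suc n) B" shows "multilinear n (\<lambda>vs. B (b # vs))"
  unfolding multilinear_def
proof (intro allI impI)
  fix xs :: "'a list" and i assume "length xs = n" "i < n"
  then show "linear (\<lambda>v. B (b # xs[i := v]))"
    using multilinearD[OF assms, of "b # xs" "Suc i"] by simp
qed

text \<open>Additivity and homogeneity in a fixed slot are identities between functions near
  \<open>x\<close>, and may therefore be differentiated.\<close>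

lemma multilinear_frechet_derivative:
  assumes S: "open S" "x \<in> S" and B: "\<And>y. y \<in> S \<Longrightarrow> multilinear n (B y)"
    and diff: "\<And>vs. length vs = n \<Longrightarrow> (\<lambda>y. B y vs) differentiable (at x)"
  shows "multilinear n (\<lambda>vs. frechet_derivative (\<lambda>y. B y vs) (at x) h)"
  unfolding multilinear_def
proof (intro allI impI)
  fix xs :: "'b list" and i assume xs: "length xs = n" "i < n"
  have lin: "linear (\<lambda>v. B y (xs[i := v]))" if "y \<in> S" for y
    using multilinearD[OF B[OF that] xs] .
  have d: "((\<lambda>y. B y (xs[i := v])) has_derivative frechet_derivative (\<lambda>y. B y (xs[i := v])) (at x)) (at x)" for v
    by (rule frechet_derivative_has_derivative[OF diff]) (simp add: xs)
  show "linear (\<lambda>v. frechet_derivative (\<lambda>y. B y (xs[i := v])) (at x) h)"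
  proof
    fix v w and c :: real
    have "frechet_derivative (\<lambda>y. B y (xs[i := v + w])) (at x) =
      frechet_derivative (\<lambda>y. B y (xs[i := v]) + B y (xs[i := w])) (at x)"
      by (rule frechet_derivative_cong_open[OF S]) (rule linear_add[OF lin])
    also have "\<dots> = (\<lambda>h. frechet_derivative (\<lambda>y. B y (xs[i := v])) (at x) h + frechet_derivative (\<lambda>y. B y (xs[i := w])) (at x) h)"
      by (rule frechet_derivative_eq[OF has_derivative_add[OF d d]])
    finally show "frechet_derivative (\<lambda>y. B y (xs[i := v + w])) (at x) h =
      frechet_derivative (\<lambda>y. B y (xs[i := v])) (at x) h + frechet_derivative (\<lambda>y. B y (xs[i := w])) (at x) h"
      by simp
    have "frechet_derivative (\<lambda>y. B y (xs[i := c *\<^sub>R v])) (at x) =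
      frechet_derivative (\<lambda>y. c *\<^sub>R B y (xs[i := v])) (at x)"
      by (rule frechet_derivative_cong_open[OF S]) (rule linear_scale[OF lin])
    also have "\<dots> = (\<lambda>h. c *\<^sub>R frechet_derivative (\<lambda>y. B y (xs[i := v])) (at x) h)"
      by (rule frechet_derivative_eq[OF has_derivative_scaleR_right[OF d]])
    finally show "frechet_derivative (\<lambda>y. B y (xs[i := c *\<^sub>R v])) (at x) h =
      c *\<^sub>R frechet_derivative (\<lambda>y. B y (xs[i := v])) (at x) h"
      by simp
  qed
qed

text \<open>Induction on the list: expanding the first argument in the basis makes it constant, and
  the remaining family has one slot less.\<close>

lemma smooth_on_multilinear:
  fixes B :: "'a::real_normed_vector \<Rightarrow> 'e::euclidean_space list \<Rightarrow> 'b::real_normed_vector"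
  assumes S: "open S" and "\<And>x. x \<in> S \<Longrightarrow> multilinear (length Xs) (B x)"
    "\<And>vs. length vs = length Xs \<Longrightarrow> smooth_on S (\<lambda>x. B x vs)"
    "\<And>X. X \<in> set Xs \<Longrightarrow> smooth_on S X"
  shows "smooth_on S (\<lambda>x. B x (map (\<lambda>X. X x) Xs))"
  using assms(2-)
proof (induction Xs arbitrary: B)
  case Nil
  then show ?case by simp
next
  case (Cons X Xs)
  have "smooth_on S (\<lambda>x. \<Sum>b\<in>Basis. (X x \<bullet> b) *\<^sub>R B x (b # map (\<lambda>X. X x) Xs))"
  proof (intro smooth_on_sum S smooth_on_scaleR smooth_on_bounded_linear[OF _ bounded_linear_inner_left])
    fix b :: 'e
    show "smooth_on S (\<lambda>x. B x (b # map (\<lambda>X. X x) Xs))"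
    proof (rule Cons.IH[of "\<lambda>x vs. B x (b # vs)"])
      show "multilinear (length Xs) (\<lambda>vs. B x (b # vs))" if "x \<in> S" for x
        using multilinear_tail[of "length Xs" "B x" b] Cons.prems(1)[OF that] by simp
    qed (use Cons.prems in auto)
  qed (use Cons.prems in auto)
  then show ?case
  proof (rule smooth_on_cong[OF S, rotated])
    fix x assume "x \<in> S"
    then have "linear (\<lambda>v. B x (v # map (\<lambda>X. X x) Xs))"
      using Cons.prems(1) by (intro multilinear_head[of "length Xs"]) auto
    from linear_basis_expansion[OF this, of "X x"]
    show "(\<Sum>b\<in>Basis. (X x \<bullet> b) *\<^sub>R B x (b # map (\<lambda>X. X x) Xs)) = B x (map (\<lambda>X. X x) (X # Xs))"
      by simp
  qed
qed

text \<open>The product rule for a base point and arguments that move together. The head is expanded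
  in the basis, the tail is covered by the induction hypothesis, and the basis sums are contracted
  again at \<open>x\<close>.\<close>

lemma has_derivative_multilinear:
  fixes B :: "'a::real_normed_vector \<Rightarrow> 'e::euclidean_space list \<Rightarrow> 'b::real_normed_vector"
  assumes S: "open S" "x \<in> S" and "\<And>y. y \<in> S \<Longrightarrow> multilinear (length Xs) (B y)"
    "\<And>vs. length vs = length Xs \<Longrightarrow> (\<lambda>y. B y vs) differentiable (at x)"
    "\<And>X. X \<in> set Xs \<Longrightarrow> X differentiable (at x)"
  shows "((\<lambda>y. B y (map (\<lambda>X. X y) Xs)) has_derivative
    (\<lambda>h. frechet_derivative (\<lambda>y. B y (map (\<lambda>X. X x) Xs)) (at x) h +
      (\<Sum>i<length Xs. B x ((map (\<lambda>X. X x) Xs)[i := frechet_derivative (Xs ! i) (at x) h])))) (at x)"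
  using assms(3-)
proof (induction Xs arbitrary: B)
  case Nil
  then show ?case by (simp add: frechet_derivative_has_derivative)
next
  case (Cons X Xs)
  let ?v = "map (\<lambda>X. X x) Xs" and ?n = "length Xs"
  have mult: "multilinear (Suc ?n) (B y)" if "y \<in> S" for y using Cons.prems(1)[OF that] by simp
  have IH: "((\<lambda>y. B y (b # map (\<lambda>X. X y) Xs)) has_derivative
    (\<lambda>h. frechet_derivative (\<lambda>y. B y (b # ?v)) (at x) h +
      (\<Sum>i<?n. B x (b # ?v[i := frechet_derivative (Xs ! i) (at x) h])))) (at x)" for b
    by (rule Cons.IH[of "\<lambda>x vs. B x (b # vs)"]) (use Cons.prems in \<open>auto intro: multilinear_tail\<close>)
  have X: "(X has_derivative frechet_derivative X (at x)) (at x)"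
    using Cons.prems(3) by (intro frechet_derivative_has_derivative) simp
  have "((\<lambda>y. \<Sum>b\<in>Basis. (X y \<bullet> b) *\<^sub>R B y (b # map (\<lambda>X. X y) Xs)) has_derivative
    (\<lambda>h. \<Sum>b\<in>Basis. (X x \<bullet> b) *\<^sub>R (frechet_derivative (\<lambda>y. B y (b # ?v)) (at x) h +
      (\<Sum>i<?n. B x (b # ?v[i := frechet_derivative (Xs ! i) (at x) h]))) +
      (frechet_derivative X (at x) h \<bullet> b) *\<^sub>R B x (b # ?v))) (at x)"
    by (intro has_derivative_sum has_derivative_scaleR[OF _ IH] has_derivative_inner_left[OF X])
  moreover have "(\<Sum>b\<in>Basis. (X x \<bullet> b) *\<^sub>R (frechet_derivative (\<lambda>y. B y (b # ?v)) (at x) h +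
      (\<Sum>i<?n. B x (b # ?v[i := frechet_derivative (Xs ! i) (at x) h]))) +
      (frechet_derivative X (at x) h \<bullet> b) *\<^sub>R B x (b # ?v)) =
    frechet_derivative (\<lambda>y. B y (X x # ?v)) (at x) h +
      (\<Sum>i<Suc ?n. B x ((X x # ?v)[i := frechet_derivative ((X # Xs) ! i) (at x) h]))" for h
  proof -
    have lin: "linear (\<lambda>v. B x (v # vs))" if "length vs = ?n" for vs
      using multilinear_head[OF mult[OF S(2)] that] .
    have "multilinear (Suc ?n) (\<lambda>vs. frechet_derivative (\<lambda>y. B y vs) (at x) h)"
      by (rule multilinear_frechet_derivative[OF S mult]) (use Cons.prems(2) in auto)
    then have lin': "linear (\<lambda>v. frechet_derivative (\<lambda>y. B y (v # ?v)) (at x) h)"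
      by (rule multilinear_head) simp
    have e1: "(\<Sum>b\<in>Basis. (X x \<bullet> b) *\<^sub>R frechet_derivative (\<lambda>y. B y (b # ?v)) (at x) h) =
      frechet_derivative (\<lambda>y. B y (X x # ?v)) (at x) h"
      by (rule linear_basis_expansion[OF lin', symmetric])
    have e2: "(\<Sum>b\<in>Basis. (w \<bullet> b) *\<^sub>R B x (b # vs)) = B x (w # vs)" if "length vs = ?n" for w vs
      by (rule linear_basis_expansion[OF lin[OF that], symmetric])
    have e3: "(\<Sum>b\<in>Basis. (X x \<bullet> b) *\<^sub>R (\<Sum>i<?n. B x (b # ?v[i := frechet_derivative (Xs ! i) (at x) h]))) =
      (\<Sum>i<?n. B x (X x # ?v[i := frechet_derivative (Xs ! i) (at x) h]))"
      unfolding scaleR_sum_right by (subst sum.swap) (intro sum.cong refl e2, simp)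
    show ?thesis
      unfolding sum.lessThan_Suc_shift
      by (simp add: scaleR_add_right sum.distrib e1 e2 e3)
  qed
  ultimately have "((\<lambda>y. \<Sum>b\<in>Basis. (X y \<bullet> b) *\<^sub>R B y (b # map (\<lambda>X. X y) Xs)) has_derivative
    (\<lambda>h. frechet_derivative (\<lambda>y. B y (X x # ?v)) (at x) h +
      (\<Sum>i<Suc ?n. B x ((X x # ?v)[i := frechet_derivative ((X # Xs) ! i) (at x) h])))) (at x)"
    by simp
  then have "((\<lambda>y. B y (map (\<lambda>X. X y) (X # Xs))) has_derivative
    (\<lambda>h. frechet_derivative (\<lambda>y. B y (X x # ?v)) (at x) h +
      (\<Sum>i<Suc ?n. B x ((X x # ?v)[i := frechet_derivative ((X # Xs) ! i) (at x) h])))) (at x)"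
  proof (rule has_derivative_transform_within_open[OF _ S])
    fix y assume "y \<in> S"
    then have "linear (\<lambda>v. B y (v # map (\<lambda>X. X y) Xs))"
      using multilinear_head[OF mult] by simp
    from linear_basis_expansion[OF this, of "X y"]
    show "(\<Sum>b\<in>Basis. (X y \<bullet> b) *\<^sub>R B y (b # map (\<lambda>X. X y) Xs)) = B y (map (\<lambda>X. X y) (X # Xs))"
      by simp
  qed
  then show ?case by simp
qed

lemma linear_compose': "linear f \<Longrightarrow> linear g \<Longrightarrow> linear (\<lambda>x. g (f x))"
  using linear_compose[of f g] by (simp add: o_def)

section \<open>Tensors and connections on an open subset of a Euclidean space\<close>

definition local_tensor :: "'e::euclidean_space set \<Rightarrow> nat \<Rightarrow> ('e \<Rightarrow> 'e list \<Rightarrow> 'e) \<Rightarrow> bool" where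
  "local_tensor \<Omega> n S \<longleftrightarrow> (\<forall>x\<in>\<Omega>. multilinear n (S x)) \<and> (\<forall>vs. length vs = n \<longrightarrow> smooth_on \<Omega> (\<lambda>x. S x vs))"

lemma local_tensorD:
  "local_tensor \<Omega> n S \<Longrightarrow> x \<in> \<Omega> \<Longrightarrow> multilinear n (S x)"
  "local_tensor \<Omega> n S \<Longrightarrow> length vs = n \<Longrightarrow> smooth_on \<Omega> (\<lambda>x. S x vs)"
  by (auto simp: local_tensor_def)

lemma smooth_on_local_tensor:
  assumes "open U" "open \<Omega>" "g ` U \<subseteq> \<Omega>" "smooth_on U g" "local_tensor \<Omega> n S" "length Xs = n"
    "\<And>X. X \<in> set Xs \<Longrightarrow> smooth_on U X"
  shows "smooth_on U (\<lambda>x. S (g x) (map (\<lambda>X. X x) Xs))"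
proof (rule smooth_on_multilinear[OF assms(1), of Xs "\<lambda>x. S (g x)"])
  show "multilinear (length Xs) (S (g x))" if "x \<in> U" for x
    using assms(3,5,6) that by (auto intro: local_tensorD)
  show "smooth_on U (\<lambda>x. S (g x) vs)" if "length vs = length Xs" for vs
    by (rule smooth_on_compose[OF assms(1,2,3) local_tensorD(2)[OF assms(5)] assms(4)]) (simp add: that assms(6))
qed (rule assms(7))

text \<open>\<open>G x u v\<close> is the covariant derivative at \<open>x\<close> of the constant
  field \<open>v\<close> in direction \<open>u\<close>. No symmetry in \<open>u\<close> and
  \<open>v\<close> is imposed: the antisymmetrisation is the torsion.\<close>

locale local_connection =
  fixes \<Omega> :: "'e::euclidean_space set" and G :: "'e \<Rightarrow> 'e \<Rightarrow> 'e \<Rightarrow> 'e"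
  assumes open_domain: "open \<Omega>"
    and linear_left: "x \<in> \<Omega> \<Longrightarrow> linear (\<lambda>u. G x u v)"
    and linear_right: "x \<in> \<Omega> \<Longrightarrow> linear (\<lambda>v. G x u v)"
    and smooth_coefficients: "smooth_on \<Omega> (\<lambda>x. G x u v)"
begin

text \<open>Christoffel symbols do not transform as a tensor, but within one chart the rules for
  multilinear families may treat them as one.\<close>

lemma local_tensor_coefficients: "local_tensor \<Omega> 2 (\<lambda>x vs. G x (vs ! 0) (vs ! 1))"
  unfolding local_tensor_def multilinear_def
  by (auto simp: smooth_coefficients less_2_cases_iff linear_left linear_right)

lemma smooth_on_coefficients:
  assumes "open U" "g ` U \<subseteq> \<Omega>" "smooth_on U g" "smooth_on U u" "smooth_on U v"
  shows "smooth_on U (\<lambda>x. G (g x) (u x) (v x))"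
  using smooth_on_local_tensor[OF assms(1) open_domain assms(2,3) local_tensor_coefficients, of "[u, v]"] assms(4,5)
  by auto

lemma coefficients_has_derivative:
  assumes U: "open U" "x \<in> U" and g: "g ` U \<subseteq> \<Omega>" "g differentiable (at x)"
    and uv: "u differentiable (at x)" "v differentiable (at x)"
  shows "((\<lambda>y. G (g y) (u y) (v y)) has_derivative
    (\<lambda>h. frechet_derivative (\<lambda>y. G y (u x) (v x)) (at (g x)) (frechet_derivative g (at x) h) +
      G (g x) (frechet_derivative u (at x) h) (v x) + G (g x) (u x) (frechet_derivative v (at x) h))) (at x)"
proof -
  have gx: "g x \<in> \<Omega>" using U g by auto
  have chain: "((\<lambda>y. G (g y) a b) has_derivative
    (\<lambda>h. frechet_derivative (\<lambda>y. G y a b) (at (g x)) (frechet_derivative g (at x) h))) (at x)" for a b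
    by (rule has_derivative_compose[OF frechet_derivative_has_derivative[OF g(2)]
        smooth_on_has_derivative[OF smooth_coefficients gx]])
  have "((\<lambda>y. G (g y) (map (\<lambda>X. X y) [u, v] ! 0) (map (\<lambda>X. X y) [u, v] ! 1)) has_derivative
    (\<lambda>h. frechet_derivative (\<lambda>y. G (g y) (map (\<lambda>X. X x) [u, v] ! 0) (map (\<lambda>X. X x) [u, v] ! 1)) (at x) h +
      (\<Sum>i<length [u, v]. G (g x) ((map (\<lambda>X. X x) [u, v])[i := frechet_derivative ([u, v] ! i) (at x) h] ! 0)
        ((map (\<lambda>X. X x) [u, v])[i := frechet_derivative ([u, v] ! i) (at x) h] ! 1)))) (at x)"
  proof (rule has_derivative_multilinear[OF U, where B = "\<lambda>y vs. G (g y) (vs ! 0) (vs ! 1)"])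
    show "multilinear (length [u, v]) (\<lambda>vs. G (g y) (vs ! 0) (vs ! 1))" if "y \<in> U" for y
      using local_tensorD(1)[OF local_tensor_coefficients, of "g y"] that g(1) by (auto simp: numeral_2_eq_2)
    show "(\<lambda>y. G (g y) (vs ! 0) (vs ! 1)) differentiable at x" for vs
      using chain differentiable_def by blast
  qed (use uv in auto)
  then show ?thesis
    by (simp add: frechet_derivative_eq[OF chain] add.assoc)
qed

definition local_cov :: "('e \<Rightarrow> 'e list \<Rightarrow> 'e) \<Rightarrow> 'e \<Rightarrow> 'e list \<Rightarrow> 'e" where
  "local_cov S x vs = frechet_derivative (\<lambda>y. S y (tl vs)) (at x) (hd vs) + G x (hd vs) (S x (tl vs))
     - (\<Sum>i<length (tl vs). S x ((tl vs)[i := G x (hd vs) (tl vs ! i)]))"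

lemma local_cov_Cons [simp]:
  "local_cov S x (z # vs) = frechet_derivative (\<lambda>y. S y vs) (at x) z + G x z (S x vs)
     - (\<Sum>i<length vs. S x (vs[i := G x z (vs ! i)]))"
  by (simp add: local_cov_def)

lemma smooth_on_local_update:
  assumes S: "local_tensor \<Omega> n S" and vs: "length vs = n" "i < n"
  shows "smooth_on \<Omega> (\<lambda>x. S x (vs[i := G x z (vs ! i)]))"
proof -
  define Xs where "Xs = (map (\<lambda>v x. v) vs)[i := \<lambda>x. G x z (vs ! i)]"
  have "smooth_on \<Omega> (\<lambda>x. S x (map (\<lambda>X. X x) Xs))"
  proof (rule smooth_on_local_tensor[OF open_domain open_domain _ smooth_on_ident[OF open_domain] S])
    fix X assume "X \<in> set Xs"
    then have "X \<in> insert (\<lambda>x. G x z (vs ! i)) ((\<lambda>v x. v) ` set vs)"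
      using set_update_subset_insert[of "map (\<lambda>v x. v) vs" i "\<lambda>x. G x z (vs ! i)"] unfolding Xs_def by auto
    then show "smooth_on \<Omega> X" by (auto simp: smooth_coefficients smooth_on_const[OF open_domain])
  qed (auto simp: Xs_def vs)
  moreover have "map (\<lambda>X. X x) Xs = vs[i := G x z (vs ! i)]" for x
    unfolding Xs_def map_update by (simp add: o_def)
  ultimately show ?thesis by simp
qed

lemma local_tensor_cov:
  assumes S: "local_tensor \<Omega> n S"
  shows "local_tensor \<Omega> (Suc n) (local_cov S)"
  unfolding local_tensor_def
proof (intro conjI ballI allI impI)
  fix x assume x: "x \<in> \<Omega>"
  have diff: "(\<lambda>y. S y vs) differentiable (at x)" if "length vs = n" for vs
    using smooth_on_differentiable[OF local_tensorD(2)[OF S that] x] .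
  have mfd: "multilinear n (\<lambda>vs. frechet_derivative (\<lambda>y. S y vs) (at x) h)" for h
    by (rule multilinear_frechet_derivative[OF open_domain x local_tensorD(1)[OF S] diff])
  note mS = local_tensorD(1)[OF S x]
  show "multilinear (Suc n) (local_cov S x)"
    unfolding multilinear_def
  proof (intro allI impI)
    fix xs :: "'e list" and i assume xs: "length xs = Suc n" and i: "i < Suc n"
    then obtain z vs where zvs: "xs = z # vs" "length vs = n" by (cases xs) auto
    \<comment> \<open>Slot 0 is the direction of differentiation, which also sits inside the
      correction terms; any later slot is an argument of \<open>S\<close>.\<close>
    show "linear (\<lambda>v. local_cov S x (xs[i := v]))"
    proof (cases i)
      case 0
      have "linear (\<lambda>v. S x (vs[j := G x v (vs ! j)]))" if "j < n" for j
        using linear_compose'[OF linear_left[OF x] multilinearD[OF mS zvs(2) that]] .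
      then show ?thesis unfolding 0 zvs
        by (simp add: zvs(2))
          (intro linear_compose_sub linear_compose_add linear_compose_sum ballI linear_left[OF x]
            linear_frechet_derivative diff[OF zvs(2)]; simp)
    next
      case (Suc j)
      then have j: "j < n" using i by simp
      \<comment> \<open>In the \<open>k\<close>-th correction term the varied slot is either the one
        acted on by \<open>G\<close> or a different one, and in the latter case the two updates
        commute.\<close>
      have "linear (\<lambda>v. S x (vs[j := v, k := G x z (vs[j := v] ! k)]))" if k: "k < n" for k
      proof (cases "k = j")
        case True
        then show ?thesis
          using linear_compose'[OF linear_right[OF x] multilinearD[OF mS zvs(2) j]] j zvs(2) by simp
      next
        case False
        then show ?thesis
          using multilinearD[OF mS _ j, of "vs[k := G x z (vs ! k)]"] zvs(2) by (simp add: list_update_swap)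
      qed
      then show ?thesis unfolding Suc zvs
        by (simp add: zvs(2))
          (intro linear_compose_sub linear_compose_add linear_compose_sum ballI multilinearD[OF mfd zvs(2) j]
            linear_compose'[OF multilinearD[OF mS zvs(2) j] linear_right[OF x]]; simp)
    qed
  qed
next
  fix xs :: "'e list" assume "length xs = Suc n"
  then obtain z vs where zvs: "xs = z # vs" "length vs = n" by (cases xs) auto
  show "smooth_on \<Omega> (\<lambda>x. local_cov S x xs)"
    unfolding zvs(1) local_cov_Cons
    by (intro smooth_on_diff smooth_on_add open_domain smooth_on_derivative local_tensorD(2)[OF S zvs(2)]
      smooth_on_coefficients[OF open_domain _ smooth_on_ident smooth_on_const] smooth_on_sum
      smooth_on_local_update[OF S zvs(2)]) (auto simp: zvs(2))
qed

end

section \<open>Taylor series\<close>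

lemma diag_derivative_cong:
  assumes "open U" "x \<in> U" "\<And>y. y \<in> U \<Longrightarrow> f y = g y"
  shows "diag_derivative n f x v = diag_derivative n g x v"
  using assms(3)
proof (induction n arbitrary: f g)
  case 0
  then show ?case using assms(2) by simp
next
  case (Suc n)
  have "frechet_derivative f (at y) v = frechet_derivative g (at y) v" if "y \<in> U" for y
    using frechet_derivative_cong_open[OF assms(1) that Suc.prems] by simp
  then show ?case unfolding diag_derivative.simps by (rule Suc.IH)
qed

text \<open>The recursion of \<open>diag_derivative\<close> takes the additional derivative
  innermost, whereas differentiation along a ray adds it outermost.\<close>

lemma diag_derivative_Suc_outer:
  "frechet_derivative (\<lambda>y. diag_derivative n f y v) (at x) v = diag_derivative (Suc n) f x v"
proof (induction n arbitrary: f)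
  case (Suc n)
  show ?case using Suc.IH[of "\<lambda>y. frechet_derivative f (at y) v"] by simp
qed simp

lemma smooth_on_diag_derivative: "smooth_on U f \<Longrightarrow> smooth_on U (\<lambda>y. diag_derivative n f y v)"
proof (induction n arbitrary: f)
  case (Suc n)
  show ?case using Suc.IH[OF smooth_on_derivative[OF Suc.prems]] by simp
qed simp

lemma smooth_on_frechet_derivative_add:
  assumes "smooth_on U f" "smooth_on U g" "x \<in> U"
  shows "frechet_derivative (\<lambda>y. f y + g y) (at x) v = frechet_derivative f (at x) v + frechet_derivative g (at x) v"
  by (subst frechet_derivative_eq[OF has_derivative_add[OF smooth_on_has_derivative[OF assms(1,3)]
    smooth_on_has_derivative[OF assms(2,3)]]]) simp

lemma diag_derivative_add:
  assumes "open U" "smooth_on U f" "smooth_on U g" "x \<in> U"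
  shows "diag_derivative n (\<lambda>y. f y + g y) x v = diag_derivative n f x v + diag_derivative n g x v"
  using assms(2,3)
proof (induction n arbitrary: f g)
  case (Suc n)
  have "diag_derivative (Suc n) (\<lambda>y. f y + g y) x v =
    diag_derivative n (\<lambda>y. frechet_derivative f (at y) v + frechet_derivative g (at y) v) x v"
    unfolding diag_derivative.simps
    by (rule diag_derivative_cong[OF assms(1,4)]) (rule smooth_on_frechet_derivative_add[OF Suc.prems])
  then show ?case by (simp add: Suc.IH[OF smooth_on_derivative[OF Suc.prems(1)] smooth_on_derivative[OF Suc.prems(2)]])
qed simp

lemma diag_derivative_bounded_linear:
  assumes "open U" "bounded_linear L" "smooth_on U f" "x \<in> U"
  shows "diag_derivative n (\<lambda>y. L (f y)) x v = L (diag_derivative n f x v)"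
  using assms(3)
proof (induction n arbitrary: f)
  case (Suc n)
  have "diag_derivative (Suc n) (\<lambda>y. L (f y)) x v = diag_derivative n (\<lambda>y. L (frechet_derivative f (at y) v)) x v"
    unfolding diag_derivative.simps
    by (rule diag_derivative_cong[OF assms(1,4)])
      (rule frechet_derivative_bounded_linear[OF assms(2) smooth_on_differentiable[OF Suc.prems]])
  then show ?case by (simp add: Suc.IH[OF smooth_on_derivative[OF Suc.prems]])
qed simp

lemma taylor_series_add:
  assumes "open U" "smooth_on U f" "smooth_on U g" "0 \<in> U"
  shows "taylor_series (\<lambda>y. f y + g y) = series_add (taylor_series f) (taylor_series g)"
  by (intro ext) (simp add: taylor_series_def series_add_def diag_derivative_add[OF assms] scaleR_add_right)

lemma taylor_series_cong:
  assumes "open U" "0 \<in> U" "\<And>y. y \<in> U \<Longrightarrow> f y = g y"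
  shows "taylor_series f = taylor_series g"
  by (intro ext) (simp add: taylor_series_def diag_derivative_cong[OF assms])

text \<open>The direction of differentiation is also the argument of the polynomial, so only the
  factorials change: 1 / n! = (n + 1) / (n + 1)!.\<close>

lemma taylor_series_derivative:
  "taylor_series (\<lambda>y. frechet_derivative f (at y) v) n v = real (Suc n) *\<^sub>R taylor_series f (Suc n) v"
  by (simp add: taylor_series_def)

lemma taylor_series_Suc:
  "real (Suc n) *\<^sub>R taylor_series f (Suc n) v = taylor_series (\<lambda>y. frechet_derivative f (at y) v) n v"
  by (rule taylor_series_derivative[symmetric])

text \<open>The Cauchy product. By induction through n + 1 times the coefficient of degree n + 1,
  which is a coefficient of degree \<open>n\<close> of the derivative: the weights i and n + 1 - i
  from the two halves of the product rule add up to n + 1.\<close>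

lemma taylor_series_bilinear:
  assumes U: "open U" "0 \<in> U" and B: "bounded_bilinear B" and "smooth_on U f" "smooth_on U g"
  shows "taylor_series (\<lambda>y. B (f y) (g y)) n v = (\<Sum>i\<le>n. B (taylor_series f i v) (taylor_series g (n - i) v))"
  using assms(4,5)
proof (induction n arbitrary: f g)
  case 0
  then show ?case by (simp add: taylor_series_def)
next
  case (Suc n)
  let ?f' = "\<lambda>y. frechet_derivative f (at y) v" and ?g' = "\<lambda>y. frechet_derivative g (at y) v"
  note f' = smooth_on_derivative[OF Suc.prems(1), of v] and g' = smooth_on_derivative[OF Suc.prems(2), of v]
  define b where "b i j = B (taylor_series f i v) (taylor_series g j v)" for i j
  note sc = bounded_bilinear.scaleR_left[OF B] bounded_bilinear.scaleR_right[OF B]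
  have "real (Suc n) *\<^sub>R taylor_series (\<lambda>y. B (f y) (g y)) (Suc n) v =
    taylor_series (\<lambda>y. B (?f' y) (g y) + B (f y) (?g' y)) n v"
    unfolding taylor_series_Suc
    by (rule fun_cong[OF fun_cong[OF taylor_series_cong[OF U]]])
      (rule frechet_derivative_bilinear[OF B smooth_on_differentiable[OF Suc.prems(1)] smooth_on_differentiable[OF Suc.prems(2)]])
  also have "\<dots> = taylor_series (\<lambda>y. B (?f' y) (g y)) n v + taylor_series (\<lambda>y. B (f y) (?g' y)) n v"
    by (subst taylor_series_add[OF U(1) _ _ U(2)])
      (auto simp: series_add_def intro!: smooth_on_bilinear[OF U(1) B] Suc.prems f' g')
  also have "\<dots> = (\<Sum>i\<le>n. real (Suc i) *\<^sub>R b (Suc i) (n - i)) + (\<Sum>i\<le>n. real (Suc n - i) *\<^sub>R b i (Suc n - i))"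
    unfolding Suc.IH[OF f' Suc.prems(2)] Suc.IH[OF Suc.prems(1) g'] taylor_series_derivative sc b_def
    by (intro arg_cong2[where f="(+)"] sum.cong) (simp_all add: Suc_diff_le)
  \<comment> \<open>Index shift; the term i = 0 may be included since its weight is 0. In the other
    sum the same holds for i = n + 1.\<close>
  also have "(\<Sum>i\<le>n. real (Suc i) *\<^sub>R b (Suc i) (n - i)) = (\<Sum>i\<le>Suc n. real i *\<^sub>R b i (Suc n - i))"
    by (simp only: sum.atMost_Suc_shift diff_Suc_Suc) simp
  also have "(\<Sum>i\<le>n. real (Suc n - i) *\<^sub>R b i (Suc n - i)) = (\<Sum>i\<le>Suc n. real (Suc n - i) *\<^sub>R b i (Suc n - i))"
    by simp
  also have "(\<Sum>i\<le>Suc n. real i *\<^sub>R b i (Suc n - i)) + (\<Sum>i\<le>Suc n. real (Suc n - i) *\<^sub>R b i (Suc n - i)) =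
    (\<Sum>i\<le>Suc n. real (Suc n) *\<^sub>R b i (Suc n - i))"
    unfolding sum.distrib[symmetric] by (intro sum.cong refl) (simp add: of_nat_diff flip: scaleR_add_left)
  also have "\<dots> = real (Suc n) *\<^sub>R (\<Sum>i\<le>Suc n. b i (Suc n - i))" by (simp only: scaleR_sum_right)
  finally show ?case unfolding b_def by (simp only: scaleR_cancel_left) simp
qed

lemma smooth_on_radial_derivative:
  fixes f :: "'a::euclidean_space \<Rightarrow> 'b::real_normed_vector"
  assumes "open U" "smooth_on U f" shows "smooth_on U (\<lambda>y. frechet_derivative f (at y) y)"
  by (rule smooth_on_derivative_apply[OF assms(1,1,2)]) (auto intro: smooth_on_ident assms)

text \<open>With the direction \<open>y\<close> expanded in the basis, the product rule
  differentiates either its coordinates, which gives the last term, or the partial derivatives,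
  where the order of differentiation has to be exchanged.\<close>

lemma frechet_derivative_radial:
  fixes f :: "'a::euclidean_space \<Rightarrow> 'b::real_normed_vector"
  assumes U: "open U" "smooth_on U f" and x: "x \<in> U"
  shows "frechet_derivative (\<lambda>y. frechet_derivative f (at y) y) (at x) v =
    frechet_derivative (\<lambda>y. frechet_derivative f (at y) v) (at x) x + frechet_derivative f (at x) v"
proof -
  let ?d = "\<lambda>b y. frechet_derivative f (at y) b"
  have d: "(?d b has_derivative frechet_derivative (?d b) (at x)) (at x)" for b
    by (rule smooth_on_has_derivative[OF smooth_on_derivative[OF U(2)] x])
  have lin: "linear (frechet_derivative f (at y))" if "y \<in> U" for y
    by (rule smooth_on_linear_derivative[OF U(2) that])
  have "frechet_derivative (\<lambda>y. frechet_derivative f (at y) y) (at x) =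
    frechet_derivative (\<lambda>y. \<Sum>b\<in>Basis. (y \<bullet> b) *\<^sub>R ?d b y) (at x)"
    by (rule frechet_derivative_cong_open[OF U(1) x linear_basis_expansion[OF lin]])
  also have "\<dots> = (\<lambda>h. \<Sum>b\<in>Basis. (x \<bullet> b) *\<^sub>R frechet_derivative (?d b) (at x) h + (h \<bullet> b) *\<^sub>R ?d b x)"
    by (intro frechet_derivative_eq has_derivative_sum has_derivative_scaleR[OF _ d]
        has_derivative_inner_left has_derivative_ident)
  finally have "frechet_derivative (\<lambda>y. frechet_derivative f (at y) y) (at x) v =
    (\<Sum>b\<in>Basis. (x \<bullet> b) *\<^sub>R frechet_derivative (?d b) (at x) v) + (\<Sum>b\<in>Basis. (v \<bullet> b) *\<^sub>R ?d b x)"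
    by (simp add: sum.distrib)
  also have "(\<Sum>b\<in>Basis. (v \<bullet> b) *\<^sub>R ?d b x) = ?d v x"
    by (rule linear_basis_expansion[OF lin[OF x], symmetric])
  also have "(\<Sum>b\<in>Basis. (x \<bullet> b) *\<^sub>R frechet_derivative (?d b) (at x) v) =
    (\<Sum>b\<in>Basis. (x \<bullet> b) *\<^sub>R frechet_derivative (?d v) (at x) b)"
    by (simp add: smooth_on_mixed_derivatives[OF U x])
  also have "\<dots> = frechet_derivative (?d v) (at x) x"
    by (rule linear_basis_expansion[OF has_derivative_linear[OF d], symmetric])
  finally show ?thesis .
qed

text \<open>Euler's identity on homogeneous components. The commutation rule turns n + 1 times the
  coefficient of degree n + 1 into the coefficient of degree \<open>n\<close> of N f' + f', where f'
  is the derivative in direction \<open>v\<close>; by induction this is n + 1 times the one of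
  f'.\<close>

lemma taylor_series_radial_derivative:
  fixes f :: "'a::euclidean_space \<Rightarrow> 'b::real_normed_vector"
  assumes U: "open U" "0 \<in> U" and "smooth_on U f"
  shows "taylor_series (\<lambda>y. frechet_derivative f (at y) y) = number_op (taylor_series f)"
proof (intro ext)
  fix n v
  show "taylor_series (\<lambda>y. frechet_derivative f (at y) y) n v = number_op (taylor_series f) n v"
    using assms(3)
  proof (induction n arbitrary: f)
    case 0
    have "linear (frechet_derivative f (at 0))" by (rule smooth_on_linear_derivative[OF 0 U(2)])
    then show ?case by (simp add: taylor_series_def number_op_def linear_0)
  next
    case (Suc n)
    let ?f' = "\<lambda>y. frechet_derivative f (at y) v"
    note f' = smooth_on_derivative[OF Suc.prems, of v]
    have "real (Suc n) *\<^sub>R taylor_series (\<lambda>y. frechet_derivative f (at y) y) (Suc n) v =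
      taylor_series (\<lambda>y. frechet_derivative ?f' (at y) y + ?f' y) n v"
      unfolding taylor_series_Suc
      by (rule fun_cong[OF fun_cong[OF taylor_series_cong[OF U]]]) (rule frechet_derivative_radial[OF U(1) Suc.prems])
    also have "\<dots> = taylor_series (\<lambda>y. frechet_derivative ?f' (at y) y) n v + taylor_series ?f' n v"
      by (subst taylor_series_add[OF U(1) _ _ U(2)])
        (auto simp: series_add_def intro!: smooth_on_radial_derivative U f')
    also have "\<dots> = real (Suc n) *\<^sub>R taylor_series ?f' n v"
      unfolding Suc.IH[OF f'] number_op_def by (simp add: algebra_simps)
    also have "\<dots> = real (Suc n) *\<^sub>R (real (Suc n) *\<^sub>R taylor_series f (Suc n) v)"
      by (simp only: taylor_series_derivative)
    finally show ?case unfolding number_op_def by (simp only: scaleR_cancel_left) simp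
  qed
qed

text \<open>The directions of \<open>diag_derivative\<close> made independent: this is the
  multilinear map that certifies a Taylor component as a homogeneous polynomial.\<close>

fun iterated_derivative ::
  "'a::real_normed_vector list \<Rightarrow> ('a \<Rightarrow> 'b::real_normed_vector) \<Rightarrow> 'a \<Rightarrow> 'b" where
  "iterated_derivative [] f x = f x"
| "iterated_derivative (v # vs) f x = iterated_derivative vs (\<lambda>y. frechet_derivative f (at y) v) x"

lemma iterated_derivative_replicate: "iterated_derivative (replicate n v) f x = diag_derivative n f x v"
  by (induction n arbitrary: f) auto

lemma iterated_derivative_cong:
  assumes "open U" "x \<in> U" "\<And>y. y \<in> U \<Longrightarrow> f y = g y"
  shows "iterated_derivative vs f x = iterated_derivative vs g x"
  using assms(3)
proof (induction vs arbitrary: f g)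
  case Nil
  then show ?case using assms(2) by simp
next
  case (Cons v vs)
  have "frechet_derivative f (at y) v = frechet_derivative g (at y) v" if "y \<in> U" for y
    using frechet_derivative_cong_open[OF assms(1) that Cons.prems] by simp
  then show ?case unfolding iterated_derivative.simps by (rule Cons.IH)
qed

lemma iterated_derivative_add:
  assumes "open U" "x \<in> U" "smooth_on U f" "smooth_on U g"
  shows "iterated_derivative vs (\<lambda>y. f y + g y) x = iterated_derivative vs f x + iterated_derivative vs g x"
  using assms(3,4)
proof (induction vs arbitrary: f g)
  case (Cons v vs)
  have "iterated_derivative (v # vs) (\<lambda>y. f y + g y) x =
    iterated_derivative vs (\<lambda>y. frechet_derivative f (at y) v + frechet_derivative g (at y) v) x"
    unfolding iterated_derivative.simps
    by (rule iterated_derivative_cong[OF assms(1,2)]) (rule smooth_on_frechet_derivative_add[OF Cons.prems])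
  then show ?case by (simp add: Cons.IH[OF smooth_on_derivative[OF Cons.prems(1)] smooth_on_derivative[OF Cons.prems(2)]])
qed simp

lemma iterated_derivative_scale:
  assumes "open U" "x \<in> U" "smooth_on U f"
  shows "iterated_derivative vs (\<lambda>y. c *\<^sub>R f y) x = c *\<^sub>R iterated_derivative vs f x"
  using assms(3)
proof (induction vs arbitrary: f)
  case (Cons v vs)
  have "iterated_derivative (v # vs) (\<lambda>y. c *\<^sub>R f y) x =
    iterated_derivative vs (\<lambda>y. c *\<^sub>R frechet_derivative f (at y) v) x"
    unfolding iterated_derivative.simps
    by (rule iterated_derivative_cong[OF assms(1,2)])
      (rule frechet_derivative_bounded_linear[OF bounded_linear_scaleR_right smooth_on_differentiable[OF Cons.prems]])
  then show ?case by (simp add: Cons.IH[OF smooth_on_derivative[OF Cons.prems]])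
qed simp

lemma multilinear_iterated_derivative:
  assumes U: "open U" "x \<in> U" and "smooth_on U f"
  shows "multilinear n (\<lambda>vs. iterated_derivative vs f x)"
  unfolding multilinear_def
proof (intro allI impI)
  fix xs :: "'a list" and i assume "length xs = n" "i < n"
  then have "i < length xs" by simp
  then show "linear (\<lambda>v. iterated_derivative (xs[i := v]) f x)"
    using assms(3)
  proof (induction xs arbitrary: f i)
    case (Cons w ws)
    show ?case
    proof (cases i)
      case 0
      have lin: "linear (frechet_derivative f (at y))" if "y \<in> U" for y
        by (rule smooth_on_linear_derivative[OF Cons.prems(2) that])
      note sm = smooth_on_derivative[OF Cons.prems(2)]
      show ?thesis unfolding 0
      proof (rule linearI; simp)
        fix a b and c :: real
        have "iterated_derivative ws (\<lambda>y. frechet_derivative f (at y) (a + b)) x =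
          iterated_derivative ws (\<lambda>y. frechet_derivative f (at y) a + frechet_derivative f (at y) b) x"
          by (rule iterated_derivative_cong[OF U linear_add[OF lin]])
        then show "iterated_derivative ws (\<lambda>y. frechet_derivative f (at y) (a + b)) x =
          iterated_derivative ws (\<lambda>y. frechet_derivative f (at y) a) x +
          iterated_derivative ws (\<lambda>y. frechet_derivative f (at y) b) x"
          by (simp only: iterated_derivative_add[OF U sm sm])
        have "iterated_derivative ws (\<lambda>y. frechet_derivative f (at y) (c *\<^sub>R a)) x =
          iterated_derivative ws (\<lambda>y. c *\<^sub>R frechet_derivative f (at y) a) x"
          by (rule iterated_derivative_cong[OF U linear_scale[OF lin]])
        then show "iterated_derivative ws (\<lambda>y. frechet_derivative f (at y) (c *\<^sub>R a)) x =
          c *\<^sub>R iterated_derivative ws (\<lambda>y. frechet_derivative f (at y) a) x"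
          by (simp only: iterated_derivative_scale[OF U sm])
      qed
    next
      case (Suc j)
      then show ?thesis
        using Cons.IH[OF _ smooth_on_derivative[OF Cons.prems(2)], of j w] Cons.prems(1) by simp
    qed
  qed simp
qed

lemma formal_power_series_taylor_series:
  assumes U: "open U" "0 \<in> U" and f: "smooth_on U f"
  shows "formal_power_series (taylor_series f)"
  unfolding formal_power_series_def homogeneous_polynomial_def
proof
  fix n
  let ?B = "\<lambda>vs. (1 / fact n) *\<^sub>R iterated_derivative vs f 0"
  have "multilinear n ?B"
    using multilinear_iterated_derivative[OF U f, of n] unfolding multilinear_def
    by (auto intro: linear_compose_scale_right)
  moreover have "taylor_series f n x = ?B (replicate n x)" for x
    by (simp add: taylor_series_def iterated_derivative_replicate)
  ultimately show "\<exists>B. multilinear n B \<and> (\<forall>x. taylor_series f n x = B (replicate n x))" by blast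
qed

text \<open>Reduces Taylor coefficients to calculus in one variable: \<open>h\<close> lists the
  successive derivatives of \<open>f\<close> on the ray through \<open>X\<close>. The identity is
  carried along for all \<open>t\<close> in \<open>I\<close>, since the next order differentiates it
  in \<open>t\<close>.\<close>

lemma diag_derivative_along_ray:
  fixes f :: "'a::real_normed_vector \<Rightarrow> 'b::real_normed_vector"
  assumes U: "open U" and f: "smooth_on U f" and I: "open I" "0 \<in> I"
    and ray: "\<And>t. t \<in> I \<Longrightarrow> t *\<^sub>R X \<in> U"
    and h0: "\<And>t. t \<in> I \<Longrightarrow> f (t *\<^sub>R X) = h 0 t"
    and h: "\<And>k t. t \<in> I \<Longrightarrow> (h k has_vector_derivative h (Suc k) t) (at t)"
  shows "diag_derivative n f 0 X = h n 0"
proof -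
  have "diag_derivative n f (t *\<^sub>R X) X = h n t" if "t \<in> I" for t
    using that
  proof (induction n arbitrary: t)
    case 0
    then show ?case by (simp add: h0)
  next
    case (Suc n)
    have "0 + t *\<^sub>R X \<in> U" using ray[OF Suc.prems] by simp
    from smooth_on_vector_derivative[OF smooth_on_diag_derivative[OF f, of n X] this, of UNIV]
    have "((\<lambda>t. diag_derivative n f (t *\<^sub>R X) X) has_vector_derivative diag_derivative (Suc n) f (t *\<^sub>R X) X) (at t)"
      by (simp only: add_0 diag_derivative_Suc_outer)
    then have "(h n has_vector_derivative diag_derivative (Suc n) f (t *\<^sub>R X) X) (at t)"
      by (rule has_vector_derivative_transform_within_open[OF _ I(1) Suc.prems]) (rule Suc.IH)
    then show ?case using h[OF Suc.prems, of n] vector_derivative_unique_at by blast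
  qed
  from this[OF I(2)] show ?thesis by simp
qed

section \<open>The Jacobi equation along radial geodesics\<close>

lemma formal_equation_unique:
  fixes F F' R T :: "('e::real_normed_vector, 'e \<Rightarrow>\<^sub>L 'e) series"
  assumes R: "R 0 = (\<lambda>_. 0)" "R 1 = (\<lambda>_. 0)" and T: "T 0 = (\<lambda>_. 0)"
    and F: "number_op (series_add (number_op F) F) = series_add (series_comp R F) (number_op (series_comp T F))"
    and F': "number_op (series_add (number_op F') F') = series_add (series_comp R F') (number_op (series_comp T F'))"
    and "F 0 = F' 0"
  shows "F = F'"
proof
  fix n
  show "F n = F' n"
  proof (induction n rule: less_induct)
    case (less n)
    show ?case
    proof (cases n)
      case 0
      then show ?thesis using assms(6) by simp
    next
      case (Suc m)
      show ?thesis
      proof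
        fix x
        \<comment> \<open>\<open>A\<close> stands for either coefficient series: the term i = 0
          vanishes with \<open>A 0\<close>, and all others see only degrees below
          \<open>n\<close>.\<close>
        have "A i x o\<^sub>L F (n - i) x = A i x o\<^sub>L F' (n - i) x" if "A 0 = (\<lambda>_. 0)" "i \<le> n"
          for A :: "('e, 'e \<Rightarrow>\<^sub>L 'e) series" and i
          using that less[of "n - i"] Suc by (cases i) auto
        then have "series_comp R F n x = series_comp R F' n x" "series_comp T F n x = series_comp T F' n x"
          unfolding series_comp_def using R(1) T by (auto intro!: sum.cong)
        then have "number_op (series_add (number_op F) F) n x = number_op (series_add (number_op F') F') n x"
          unfolding F F' by (simp add: series_add_def number_op_def)
        then have "(real n * (real n + 1)) *\<^sub>R F n x = (real n * (real n + 1)) *\<^sub>R F' n x"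
          by (simp add: series_add_def number_op_def algebra_simps)
        then show "F n x = F' n x" using Suc by (simp add: add_eq_0_iff)
      qed
    qed
  qed
qed

text \<open>If \<open>h k\<close> is the \<open>k\<close>-th derivative of \<open>h 0\<close>, then \<open>times_parameter h k\<close> is that of \<open>t \<mapsto> t h(t)\<close>.\<close>

definition times_parameter :: "(nat \<Rightarrow> real \<Rightarrow> 'b::real_normed_vector) \<Rightarrow> nat \<Rightarrow> real \<Rightarrow> 'b" where
  "times_parameter h k t = t *\<^sub>R h k t + real k *\<^sub>R h (k - 1) t"

lemma times_parameter_has_vector_derivative:
  assumes "\<And>k. (h k has_vector_derivative h (Suc k) t) (at t)"
  shows "(times_parameter h k has_vector_derivative times_parameter h (Suc k) t) (at t)"
proof -
  have "((\<lambda>t. t *\<^sub>R h k t + real k *\<^sub>R h (k - 1) t) has_vector_derivative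
    (t *\<^sub>R h (Suc k) t + 1 *\<^sub>R h k t) + (real k *\<^sub>R h (Suc (k - 1)) t)) (at t)"
    by (intro has_vector_derivative_add has_vector_derivative_scaleR[OF DERIV_ident assms]
      bounded_linear.has_vector_derivative[OF bounded_linear_scaleR_right assms])
  \<comment> \<open>At k = 0 the truncated difference k - 1 repeats the index 0, but its weight is
    0.\<close>
  moreover have "(t *\<^sub>R h (Suc k) t + 1 *\<^sub>R h k t) + real k *\<^sub>R h (Suc (k - 1)) t = times_parameter h (Suc k) t"
    by (cases k) (simp_all add: times_parameter_def algebra_simps scaleR_2)
  moreover have "(\<lambda>t. t *\<^sub>R h k t + real k *\<^sub>R h (k - 1) t) = times_parameter h k"
    by (simp add: fun_eq_iff times_parameter_def)
  ultimately show ?thesis by (simp only:)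
qed

context local_connection
begin

text \<open>The curvature on fields that are constant in the chart, whose Lie brackets
  vanish.\<close>

definition local_curvature :: "'e \<Rightarrow> 'e list \<Rightarrow> 'e" where
  "local_curvature x vs =
     frechet_derivative (\<lambda>y. G y (vs ! 1) (vs ! 2)) (at x) (vs ! 0) - frechet_derivative (\<lambda>y. G y (vs ! 0) (vs ! 2)) (at x) (vs ! 1)
     + G x (vs ! 0) (G x (vs ! 1) (vs ! 2)) - G x (vs ! 1) (G x (vs ! 0) (vs ! 2))"

definition local_torsion :: "'e \<Rightarrow> 'e list \<Rightarrow> 'e" where
  "local_torsion x vs = G x (vs ! 0) (vs ! 1) - G x (vs ! 1) (vs ! 0)"

lemma linear_coefficients_derivative:
  assumes x: "x \<in> \<Omega>"
  shows "linear (\<lambda>v. frechet_derivative (\<lambda>y. G y v w) (at x) u)"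
    "linear (\<lambda>w. frechet_derivative (\<lambda>y. G y v w) (at x) u)"
    "linear (frechet_derivative (\<lambda>y. G y v w) (at x))"
proof -
  have "multilinear 2 (\<lambda>vs. frechet_derivative (\<lambda>y. G y (vs ! 0) (vs ! 1)) (at x) u)"
    by (rule multilinear_frechet_derivative[OF open_domain x local_tensorD(1)[OF local_tensor_coefficients]])
      (auto intro: smooth_on_differentiable[OF smooth_coefficients x])
  from multilinearD[OF this, of "[v, w]" 0] multilinearD[OF this, of "[v, w]" 1]
  show "linear (\<lambda>v. frechet_derivative (\<lambda>y. G y v w) (at x) u)"
    "linear (\<lambda>w. frechet_derivative (\<lambda>y. G y v w) (at x) u)" by simp_all
  show "linear (frechet_derivative (\<lambda>y. G y v w) (at x))"
    by (rule smooth_on_linear_derivative[OF smooth_coefficients x])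
qed

lemma local_tensor_torsion: "local_tensor \<Omega> 2 local_torsion"
  unfolding local_tensor_def multilinear_def local_torsion_def
  by (auto simp: less_2_cases_iff linear_left linear_right
    intro!: linear_compose_sub smooth_on_diff smooth_coefficients open_domain)

lemma local_tensor_curvature: "local_tensor \<Omega> 3 local_curvature"
  unfolding local_tensor_def
proof (intro conjI ballI allI impI)
  fix vs :: "'e list"
  show "smooth_on \<Omega> (\<lambda>x. local_curvature x vs)"
    unfolding local_curvature_def
    by (intro smooth_on_diff smooth_on_add smooth_on_derivative smooth_coefficients open_domain
      smooth_on_coefficients[OF open_domain _ smooth_on_ident smooth_on_const]) auto
next
  fix x assume x: "x \<in> \<Omega>"
  note l = linear_coefficients_derivative[OF x] linear_left[OF x] linear_right[OF x]
    linear_compose'[OF linear_left[OF x] linear_right[OF x]] linear_compose'[OF linear_right[OF x] linear_right[OF x]]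
  show "multilinear 3 (local_curvature x)"
    unfolding multilinear_def
  proof (intro allI impI)
    fix xs :: "'e list" and i :: nat assume xs: "length xs = 3" and i: "i < 3"
    then obtain a b c where abc: "xs = [a, b, c]" by (auto simp: numeral_3_eq_3 length_Suc_conv)
    have "i = 0 \<or> i = 1 \<or> i = 2" using i by auto
    then show "linear (\<lambda>v. local_curvature x (xs[i := v]))"
      by (elim disjE) (auto simp: abc local_curvature_def intro!: linear_compose_sub linear_compose_add l)
  qed
qed

lemma local_tensor_iterated_cov: "local_tensor \<Omega> n S \<Longrightarrow> local_tensor \<Omega> (k + n) ((local_cov ^^ k) S)"
  by (induction k) (auto intro: local_tensor_cov)

end

text \<open>\<open>E\<close> is the exponential map and \<open>P X\<close> the radial parallel transport, both read in a chart
  with Christoffel symbols \<open>G\<close>; \<open>Q X\<close> is the inverse of \<open>P X\<close>.\<close>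

locale radial_frame = local_connection \<Omega> G
  for \<Omega> :: "'e::euclidean_space set" and G :: "'e \<Rightarrow> 'e \<Rightarrow> 'e \<Rightarrow> 'e" +
  fixes U :: "'e set" and E :: "'e \<Rightarrow> 'e" and P Q :: "'e \<Rightarrow> 'e \<Rightarrow>\<^sub>L 'e"
  assumes U: "open U" "0 \<in> U"
    and E: "smooth_on U E" "E ` U \<subseteq> \<Omega>"
    and P: "smooth_on U P" and Q: "smooth_on U Q"
    and QP: "X \<in> U \<Longrightarrow> Q X (P X v) = v" and PQ: "X \<in> U \<Longrightarrow> P X (Q X v) = v"
    and P_0: "P 0 v = v"
    and DE_0: "frechet_derivative E (at 0) v = v"
    and DE: "X \<in> U \<Longrightarrow> frechet_derivative E (at X) X = P X X"
    and DP_0: "frechet_derivative P (at 0) X v = - G (E 0) X v"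
    and DP: "X \<in> U \<Longrightarrow> frechet_derivative P (at X) X v = - G (E X) (P X X) (P X v)"
begin

section \<open>Radial identities and their derivatives along rays\<close>

lemma EU: "X \<in> U \<Longrightarrow> E X \<in> \<Omega>" using E(2) by auto

lemma Q_0: "Q 0 v = v"
  using QP[OF U(2), of v] by (simp add: P_0)

text \<open>For t different from 0 the radial identity at t X is divided by t. At the origin that
  identity reads 0 = 0, and \<open>DE_0\<close> takes its place.\<close>

lemma DE_ray:
  assumes "t *\<^sub>R X \<in> U" shows "frechet_derivative E (at (t *\<^sub>R X)) X = P (t *\<^sub>R X) X"
proof (cases "t = 0")
  case False
  have "t *\<^sub>R frechet_derivative E (at (t *\<^sub>R X)) X = t *\<^sub>R P (t *\<^sub>R X) X"
    using DE[OF assms] linear_scale[OF smooth_on_linear_derivative[OF E(1) assms]]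
    by (simp add: blinfun.scaleR_right)
  then show ?thesis using False by simp
qed (simp add: DE_0 P_0)

lemma DP_ray:
  assumes "t *\<^sub>R X \<in> U"
  shows "frechet_derivative P (at (t *\<^sub>R X)) X v = - G (E (t *\<^sub>R X)) (P (t *\<^sub>R X) X) (P (t *\<^sub>R X) v)"
proof (cases "t = 0")
  case False
  have "t *\<^sub>R blinfun_apply (frechet_derivative P (at (t *\<^sub>R X)) X) v =
      t *\<^sub>R (- G (E (t *\<^sub>R X)) (P (t *\<^sub>R X) X) (P (t *\<^sub>R X) v))"
    using DP[OF assms, of v] linear_scale[OF smooth_on_linear_derivative[OF P assms]]
      linear_scale[OF linear_left[OF EU[OF assms]]]
    by (simp add: blinfun.scaleR_right blinfun.scaleR_left)
  then show ?thesis using False by (simp only: scaleR_cancel_left) simp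
qed (simp add: DP_0 P_0)

text \<open>Freezing v = Q w at the point and differentiating Q P v = v along the ray transfers the
  known derivative of \<open>P\<close> to \<open>Q\<close>.\<close>

lemma DQ_ray:
  assumes tX: "t *\<^sub>R X \<in> U"
  shows "frechet_derivative Q (at (t *\<^sub>R X)) X w = Q (t *\<^sub>R X) (G (E (t *\<^sub>R X)) (P (t *\<^sub>R X) X) w)"
proof -
  define v where "v = Q (t *\<^sub>R X) w"
  have w: "P (t *\<^sub>R X) v = w" by (simp add: v_def PQ tX)
  have dP: "P differentiable (at (t *\<^sub>R X))" and dQ: "Q differentiable (at (t *\<^sub>R X))"
    by (rule smooth_on_differentiable[OF P tX], rule smooth_on_differentiable[OF Q tX])
  have dPv: "(\<lambda>y. P y v) differentiable (at (t *\<^sub>R X))"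
    by (rule smooth_on_differentiable[OF smooth_on_bounded_linear[OF U(1) blinfun.bounded_linear_left P] tX])
  have "frechet_derivative (\<lambda>y. Q y (P y v)) (at (t *\<^sub>R X)) = frechet_derivative (\<lambda>y. v) (at (t *\<^sub>R X))"
    by (rule frechet_derivative_cong_open[OF U(1) tX QP])
  then have "0 = frechet_derivative (\<lambda>y. Q y (P y v)) (at (t *\<^sub>R X)) X"
    by (simp add: frechet_derivative_const)
  also have "\<dots> = frechet_derivative Q (at (t *\<^sub>R X)) X w +
      Q (t *\<^sub>R X) (frechet_derivative (\<lambda>y. P y v) (at (t *\<^sub>R X)) X)"
    by (subst frechet_derivative_bilinear[OF bounded_bilinear_blinfun_apply dQ dPv]) (simp add: w)
  also have "frechet_derivative (\<lambda>y. P y v) (at (t *\<^sub>R X)) X = frechet_derivative P (at (t *\<^sub>R X)) X v"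
    by (rule frechet_derivative_bounded_linear[OF blinfun.bounded_linear_left dP])
  finally show ?thesis by (simp add: DP_ray[OF tX] w blinfun.minus_right)
qed

lemma DQ:
  assumes X: "X \<in> U" shows "frechet_derivative Q (at X) X w = Q X (G (E X) (P X X) w)"
  using DQ_ray[of 1 X w] X by simp

text \<open>Transport back to the start of the ray turns covariant into ordinary differentiation:
  the derivative of \<open>Q\<close> supplies the term with \<open>G\<close> outside
  \<open>S\<close>, that of each \<open>P\<close> the correction in its slot, and that of
  \<open>E\<close> the derivative of \<open>S\<close> in the direction of the velocity.\<close>

lemma transported_tensor_derivative:
  assumes S: "local_tensor \<Omega> n S" and vs: "length vs = n" and tX: "t *\<^sub>R X \<in> U"
  shows "((\<lambda>t. Q (t *\<^sub>R X) (S (E (t *\<^sub>R X)) (map (P (t *\<^sub>R X)) vs))) has_vector_derivative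
    Q (t *\<^sub>R X) (local_cov S (E (t *\<^sub>R X)) (map (P (t *\<^sub>R X)) (X # vs)))) (at t)"
proof -
  let ?y = "t *\<^sub>R X"
  define Xs where "Xs = map (\<lambda>v y. blinfun_apply (P y) v) vs"
  have mapXs: "map (\<lambda>X. X y) Xs = map (P y) vs" for y by (simp add: Xs_def)
  have lenXs: "length Xs = n" by (simp add: Xs_def vs)
  have smXs: "smooth_on U Z" if "Z \<in> set Xs" for Z
    using that by (auto simp: Xs_def intro!: smooth_on_bounded_linear[OF U(1) blinfun.bounded_linear_left P])
  let ?ws = "map (P ?y) vs"
  have Sy: "multilinear n (S (E ?y))" by (rule local_tensorD(1)[OF S EU[OF tX]])
  have sm: "smooth_on U (\<lambda>y. S (E y) (map (P y) vs))"
    using smooth_on_local_tensor[OF U(1) open_domain E(2,1) S lenXs smXs] by (simp only: mapXs)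
  have smS: "smooth_on U (\<lambda>y. S (E y) us)" if "length us = n" for us
    by (rule smooth_on_compose[OF U(1) open_domain E(2) local_tensorD(2)[OF S that] E(1)])
  have "((\<lambda>y. S (E y) (map (\<lambda>X. X y) Xs)) has_derivative
    (\<lambda>h. frechet_derivative (\<lambda>y. S (E y) (map (\<lambda>X. X ?y) Xs)) (at ?y) h +
      (\<Sum>i<length Xs. S (E ?y) ((map (\<lambda>X. X ?y) Xs)[i := frechet_derivative (Xs ! i) (at ?y) h])))) (at ?y)"
  proof (rule has_derivative_multilinear[OF U(1) tX, where B = "\<lambda>y. S (E y)"])
    show "multilinear (length Xs) (S (E y))" if "y \<in> U" for y
      unfolding lenXs by (rule local_tensorD(1)[OF S EU[OF that]])
    show "(\<lambda>y. S (E y) us) differentiable (at ?y)" if "length us = length Xs" for us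
      using that smooth_on_differentiable[OF smS tX] by (simp add: lenXs)
    show "Z differentiable (at ?y)" if "Z \<in> set Xs" for Z by (rule smooth_on_differentiable[OF smXs[OF that] tX])
  qed
  then have d: "frechet_derivative (\<lambda>y. S (E y) (map (P y) vs)) (at ?y) X =
    frechet_derivative (\<lambda>y. S (E y) ?ws) (at ?y) X +
      (\<Sum>i<n. S (E ?y) (?ws[i := frechet_derivative (Xs ! i) (at ?y) X]))"
    unfolding mapXs lenXs by (simp add: frechet_derivative_eq)
  have d1: "frechet_derivative (\<lambda>y. S (E y) ?ws) (at ?y) X = frechet_derivative (\<lambda>x. S x ?ws) (at (E ?y)) (P ?y X)"
    by (subst frechet_derivative_compose_apply[where f = "\<lambda>x. S x ?ws"])
      (auto simp: DE_ray[OF tX] vs intro!: smooth_on_differentiable[OF local_tensorD(2)[OF S]]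
        smooth_on_differentiable[OF E(1) tX] EU[OF tX])
  have d2: "S (E ?y) (?ws[i := frechet_derivative (Xs ! i) (at ?y) X]) =
    - S (E ?y) (?ws[i := G (E ?y) (P ?y X) (?ws ! i)])" if i: "i < n" for i
  proof -
    have "frechet_derivative (Xs ! i) (at ?y) X = frechet_derivative P (at ?y) X (vs ! i)"
      using i frechet_derivative_bounded_linear[OF blinfun.bounded_linear_left smooth_on_differentiable[OF P tX]]
      by (simp add: Xs_def vs)
    also have "\<dots> = - G (E ?y) (P ?y X) (?ws ! i)" using i by (simp add: DP_ray[OF tX] vs)
    finally show ?thesis using linear_neg[OF multilinearD[OF Sy _ i, of ?ws]] by (simp add: vs)
  qed
  have "frechet_derivative (\<lambda>y. Q y (S (E y) (map (P y) vs))) (at ?y) X =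
    frechet_derivative Q (at ?y) X (S (E ?y) ?ws) + Q ?y (frechet_derivative (\<lambda>y. S (E y) (map (P y) vs)) (at ?y) X)"
    by (rule frechet_derivative_bilinear[OF bounded_bilinear_blinfun_apply smooth_on_differentiable[OF Q tX]
      smooth_on_differentiable[OF sm tX]])
  also have "\<dots> = Q ?y (local_cov S (E ?y) (map (P ?y) (X # vs)))"
    unfolding DQ_ray[OF tX] d d1 by (simp add: d2 vs sum_negf blinfun.bilinear_simps)
  finally have "frechet_derivative (\<lambda>y. Q y (S (E y) (map (P y) vs))) (at (0 + ?y)) X =
    Q ?y (local_cov S (E ?y) (map (P ?y) (X # vs)))" by simp
  moreover have "smooth_on U (\<lambda>y. Q y (S (E y) (map (P y) vs)))"
    by (rule smooth_on_bilinear[OF U(1) bounded_bilinear_blinfun_apply Q sm])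
  ultimately show ?thesis
    using smooth_on_vector_derivative[of U "\<lambda>y. Q y (S (E y) (map (P y) vs))" 0 t X UNIV] tX by simp
qed

section \<open>Curvature, torsion and the differential of \<open>E\<close> in the parallel
  frame\<close>

definition velocity :: "'e \<Rightarrow> 'e" where "velocity X = P X X"

text \<open>A smooth operator function whose Taylor series at 0 is the curvature series; the two
  slots filled with \<open>velocity\<close> account for its shift of degree by 2.\<close>

definition frame_curvature :: "'e \<Rightarrow> 'e \<Rightarrow>\<^sub>L 'e" where
  "frame_curvature X = Blinfun (\<lambda>Y. Q X (local_curvature (E X) [velocity X, P X Y, velocity X]))"

definition frame_torsion :: "'e \<Rightarrow> 'e \<Rightarrow>\<^sub>L 'e" where
  "frame_torsion X = Blinfun (\<lambda>Y. Q X (local_torsion (E X) [velocity X, P X Y]))"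

text \<open>The chart version of \<open>backward_transport\<close>, with which it is identified at
  the end.\<close>

definition frame_transport :: "'e \<Rightarrow> 'e \<Rightarrow>\<^sub>L 'e" where
  "frame_transport X = Q X o\<^sub>L Blinfun (frechet_derivative E (at X))"

lemma smooth_on_velocity: "smooth_on U velocity"
  unfolding velocity_def[abs_def]
  by (rule smooth_on_bilinear[OF U(1) bounded_bilinear_blinfun_apply P smooth_on_ident[OF U(1)]])

lemma linear_frame_curvature:
  assumes X: "X \<in> U" shows "linear (\<lambda>Y. Q X (local_curvature (E X) [velocity X, P X Y, velocity X]))"
proof -
  have "linear (\<lambda>v. local_curvature (E X) ([velocity X, 0, velocity X][1 := v]))"
    by (rule multilinearD[OF local_tensorD(1)[OF local_tensor_curvature EU[OF X]]]) auto
  then have "linear (\<lambda>v. local_curvature (E X) [velocity X, v, velocity X])" by simp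
  from linear_compose'[OF linear_compose'[OF bounded_linear.linear[OF blinfun.bounded_linear_right] this]
    bounded_linear.linear[OF blinfun.bounded_linear_right]]
  show ?thesis .
qed

lemma linear_frame_torsion:
  assumes X: "X \<in> U" shows "linear (\<lambda>Y. Q X (local_torsion (E X) [velocity X, P X Y]))"
proof -
  have "linear (\<lambda>v. local_torsion (E X) ([velocity X, 0][1 := v]))"
    by (rule multilinearD[OF local_tensorD(1)[OF local_tensor_torsion EU[OF X]]]) auto
  then have "linear (\<lambda>v. local_torsion (E X) [velocity X, v])" by simp
  from linear_compose'[OF linear_compose'[OF bounded_linear.linear[OF blinfun.bounded_linear_right] this]
    bounded_linear.linear[OF blinfun.bounded_linear_right]]
  show ?thesis .
qed

lemma frame_curvature_apply:
  "X \<in> U \<Longrightarrow> frame_curvature X Y = Q X (local_curvature (E X) [velocity X, P X Y, velocity X])"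
  unfolding frame_curvature_def by (simp add: Blinfun_apply_linear[OF linear_frame_curvature])

lemma frame_torsion_apply:
  "X \<in> U \<Longrightarrow> frame_torsion X Y = Q X (local_torsion (E X) [velocity X, P X Y])"
  unfolding frame_torsion_def by (simp add: Blinfun_apply_linear[OF linear_frame_torsion])

lemma frame_transport_apply:
  "X \<in> U \<Longrightarrow> frame_transport X Y = Q X (frechet_derivative E (at X) Y)"
  unfolding frame_transport_def by (simp add: Blinfun_apply_linear[OF smooth_on_linear_derivative[OF E(1)]])

lemma smooth_on_P_apply: "smooth_on U (\<lambda>X. P X v)"
  by (rule smooth_on_bounded_linear[OF U(1) blinfun.bounded_linear_left P])

lemma smooth_on_frame_curvature: "smooth_on U frame_curvature"
  unfolding frame_curvature_def[abs_def]
proof (rule smooth_on_Blinfun[OF U(1) linear_frame_curvature])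
  fix b :: 'e
  have "smooth_on U (\<lambda>X. local_curvature (E X) (map (\<lambda>Z. Z X) [velocity, \<lambda>X. P X b, velocity]))"
    by (rule smooth_on_local_tensor[OF U(1) open_domain E(2,1) local_tensor_curvature])
      (auto intro: smooth_on_velocity smooth_on_P_apply)
  then show "smooth_on U (\<lambda>X. Q X (local_curvature (E X) [velocity X, P X b, velocity X]))"
    by (intro smooth_on_bilinear[OF U(1) bounded_bilinear_blinfun_apply Q]) simp
qed

lemma smooth_on_frame_torsion: "smooth_on U frame_torsion"
  unfolding frame_torsion_def[abs_def]
proof (rule smooth_on_Blinfun[OF U(1) linear_frame_torsion])
  fix b :: 'e
  have "smooth_on U (\<lambda>X. local_torsion (E X) (map (\<lambda>Z. Z X) [velocity, \<lambda>X. P X b]))"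
    by (rule smooth_on_local_tensor[OF U(1) open_domain E(2,1) local_tensor_torsion])
      (auto intro: smooth_on_velocity smooth_on_P_apply)
  then show "smooth_on U (\<lambda>X. Q X (local_torsion (E X) [velocity X, P X b]))"
    by (intro smooth_on_bilinear[OF U(1) bounded_bilinear_blinfun_apply Q]) simp
qed

lemma smooth_on_frame_transport: "smooth_on U frame_transport"
  unfolding frame_transport_def[abs_def]
  by (intro smooth_on_bilinear[OF U(1) bounded_bilinear_blinfun_compose Q]
    smooth_on_Blinfun[OF U(1)] smooth_on_linear_derivative[OF E(1)] smooth_on_derivative[OF E(1)])

text \<open>In the parallel frame the covariant derivative along radial geodesics becomes the plain
  radial derivative.\<close>

lemma radial_derivative_Q:
  assumes X: "X \<in> U" and w: "smooth_on U w"
  shows "frechet_derivative (\<lambda>X. Q X (w X)) (at X) X =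
    Q X (frechet_derivative w (at X) X + G (E X) (velocity X) (w X))"
  by (subst frechet_derivative_bilinear[OF bounded_bilinear_blinfun_apply smooth_on_differentiable[OF Q X]
      smooth_on_differentiable[OF w X]])
    (simp add: DQ[OF X] velocity_def blinfun.add_right)

text \<open>The Jacobi equation for \<open>J = \<partial>\<^bsub>Y\<^esub> E\<close>, integrated once: the second statement computes the
  radial derivative of the first summand on the right of the first one. Both rest on
  \<open>N \<partial>\<^bsub>Y\<^esub> = \<partial>\<^bsub>Y\<^esub> N - \<partial>\<^bsub>Y\<^esub>\<close> for the radial derivative \<open>N\<close>.\<close>

lemma jacobi_equation:
  fixes Y :: 'e
  defines "J \<equiv> \<lambda>X. frechet_derivative E (at X) Y"
  defines "m \<equiv> \<lambda>X. Q X (frechet_derivative velocity (at X) Y + G (E X) (J X) (velocity X))"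
  shows "X \<in> U \<Longrightarrow> frechet_derivative (\<lambda>X. Q X (J X)) (at X) X + Q X (J X) =
      m X + Q X (local_torsion (E X) [velocity X, J X])"
    and "X \<in> U \<Longrightarrow> frechet_derivative m (at X) X = Q X (local_curvature (E X) [velocity X, J X, velocity X])"
    and "smooth_on U m"
proof -
  let ?V = velocity
  have smJ: "smooth_on U J" unfolding J_def by (rule smooth_on_derivative[OF E(1)])
  note smV = smooth_on_velocity
  have NE: "frechet_derivative E (at X) X = ?V X" if "X \<in> U" for X
    using DE[OF that] by (simp add: velocity_def)
  have NJ: "frechet_derivative J (at X) X = frechet_derivative ?V (at X) Y - J X" if X: "X \<in> U" for X
  proof -
    have "frechet_derivative ?V (at X) Y = frechet_derivative (\<lambda>y. frechet_derivative E (at y) y) (at X) Y"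
      using frechet_derivative_cong_open[OF U(1) X NE] by simp
    then show ?thesis using frechet_derivative_radial[OF U(1) E(1) X, of Y] by (simp add: J_def)
  qed
  show "frechet_derivative (\<lambda>X. Q X (J X)) (at X) X + Q X (J X) =
      m X + Q X (local_torsion (E X) [?V X, J X])" if X: "X \<in> U"
    unfolding radial_derivative_Q[OF X smJ] NJ[OF X] m_def local_torsion_def
    by (simp add: flip: blinfun.add_right)
  have NV: "frechet_derivative ?V (at X) X = ?V X - G (E X) (?V X) (?V X)" if X: "X \<in> U" for X
    unfolding velocity_def[abs_def]
    by (subst frechet_derivative_bilinear[OF bounded_bilinear_blinfun_apply smooth_on_differentiable[OF P X]])
      (simp_all add: DP[OF X] frechet_derivative_eq[OF has_derivative_ident])
  have smG: "smooth_on U (\<lambda>X. G (E X) (a X) (b X))" if "smooth_on U a" "smooth_on U b" for a b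
    by (rule smooth_on_coefficients[OF U(1) E(2,1) that])
  have dG: "frechet_derivative (\<lambda>y. G (E y) (a y) (b y)) (at X) h =
      frechet_derivative (\<lambda>y. G y (a X) (b X)) (at (E X)) (frechet_derivative E (at X) h) +
      G (E X) (frechet_derivative a (at X) h) (b X) + G (E X) (a X) (frechet_derivative b (at X) h)"
    if "smooth_on U a" "smooth_on U b" and X: "X \<in> U" for a b X h
    by (rule fun_cong[OF frechet_derivative_eq[OF coefficients_has_derivative[OF U(1) X E(2)
      smooth_on_differentiable[OF E(1) X] smooth_on_differentiable[OF that(1) X] smooth_on_differentiable[OF that(2) X]]]])
  let ?w = "\<lambda>X. frechet_derivative ?V (at X) Y + G (E X) (J X) (?V X)"
  have smw: "smooth_on U ?w"
    by (intro smooth_on_add U smooth_on_derivative smV smG smJ)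
  show "smooth_on U m"
    unfolding m_def by (rule smooth_on_bilinear[OF U(1) bounded_bilinear_blinfun_apply Q smw])
  show "frechet_derivative m (at X) X = Q X (local_curvature (E X) [?V X, J X, ?V X])" if X: "X \<in> U"
  proof -
    let ?W = "frechet_derivative ?V (at X) Y" and ?x = "E X" and ?v = "?V X" and ?j = "J X"
    note EX = EU[OF X]
    note lin = linear_add[OF linear_left[OF EX]] linear_diff[OF linear_left[OF EX]]
      linear_add[OF linear_right[OF EX]] linear_diff[OF linear_right[OF EX]]
    \<comment> \<open>The geodesic equation is differentiated in direction \<open>Y\<close>;
      commuting the derivatives yields the radial derivative of the \<open>Y\<close>-derivative of
      the velocity.\<close>
    have "frechet_derivative (\<lambda>y. frechet_derivative ?V (at y) y) (at X) Y =
        frechet_derivative (\<lambda>y. ?V y - G (E y) (?V y) (?V y)) (at X) Y"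
      using frechet_derivative_cong_open[OF U(1) X NV] by simp
    also have "\<dots> = ?W - frechet_derivative (\<lambda>y. G (E y) (?V y) (?V y)) (at X) Y"
      by (subst frechet_derivative_eq[OF has_derivative_diff[OF smooth_on_has_derivative[OF smV X]
        smooth_on_has_derivative[OF smG[OF smV smV] X]]]) simp
    finally have "frechet_derivative (\<lambda>y. frechet_derivative ?V (at y) Y) (at X) X + ?W =
        ?W - (frechet_derivative (\<lambda>y. G y ?v ?v) (at ?x) ?j + G ?x ?W ?v + G ?x ?v ?W)"
      unfolding frechet_derivative_radial[OF U(1) smV X, of Y] dG[OF smV smV X] by (simp add: J_def)
    then have a: "frechet_derivative (\<lambda>y. frechet_derivative ?V (at y) Y) (at X) X =
        - (frechet_derivative (\<lambda>y. G y ?v ?v) (at ?x) ?j + G ?x ?W ?v + G ?x ?v ?W)"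
      by (simp add: eq_neg_iff_add_eq_0 algebra_simps)
    have b: "frechet_derivative (\<lambda>y. G (E y) (J y) (?V y)) (at X) X =
        frechet_derivative (\<lambda>y. G y ?j ?v) (at ?x) ?v + G ?x (?W - ?j) ?v + G ?x ?j (?v - G ?x ?v ?v)"
      by (simp add: dG[OF smJ smV X] NE[OF X] NJ[OF X] NV[OF X])
    \<comment> \<open>All terms containing \<open>?W\<close> cancel, and so do the two copies of
      \<open>G ?x ?j ?v\<close>, one from -J in \<open>NJ\<close> and one from V in
      \<open>NV\<close>. What is left is the curvature.\<close>
    have "frechet_derivative ?w (at X) X + G ?x ?v (?w X) = local_curvature ?x [?v, ?j, ?v]"
      unfolding smooth_on_frechet_derivative_add[OF smooth_on_derivative[OF smV] smG[OF smJ smV] X] a b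
      by (simp add: local_curvature_def lin algebra_simps)
    then show ?thesis unfolding m_def radial_derivative_Q[OF X smw] by simp
  qed
qed

text \<open>An identity of operator functions near 0, checked on each vector \<open>Y\<close> and
  then expanded in Taylor series. The torsion term is carried through the first step
  undifferentiated, so that it ends up under the outer radial derivative.\<close>

lemma frame_transport_equation:
  "number_op (series_add (number_op (taylor_series frame_transport)) (taylor_series frame_transport)) =
    series_add (series_comp (taylor_series frame_curvature) (taylor_series frame_transport))
      (number_op (series_comp (taylor_series frame_torsion) (taylor_series frame_transport)))"
proof -
  let ?\<Psi> = frame_transport and ?N = "\<lambda>f X. frechet_derivative f (at X) X"
  note sm = smooth_on_frame_transport smooth_on_frame_curvature smooth_on_frame_torsion
  note comp = bounded_bilinear_blinfun_compose
  have sm\<R>: "smooth_on U (\<lambda>X. frame_curvature X o\<^sub>L ?\<Psi> X)" and sm\<T>: "smooth_on U (\<lambda>X. frame_torsion X o\<^sub>L ?\<Psi> X)"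
    by (intro smooth_on_bilinear[OF U(1) comp] sm)+
  have smN: "smooth_on U (\<lambda>X. ?N ?\<Psi> X + ?\<Psi> X)"
    by (intro smooth_on_add U smooth_on_radial_derivative sm)
  have eq: "?N (\<lambda>X. ?N ?\<Psi> X + ?\<Psi> X) X = (frame_curvature X o\<^sub>L ?\<Psi> X) + ?N (\<lambda>X. frame_torsion X o\<^sub>L ?\<Psi> X) X"
    if X: "X \<in> U" for X
  proof (rule blinfun_eqI)
    fix Y
    define J where "J X = frechet_derivative E (at X) Y" for X
    define m where "m X = Q X (frechet_derivative velocity (at X) Y + G (E X) (J X) (velocity X))" for X
    note bl = blinfun.bounded_linear_left[of Y]
    have smm: "smooth_on U m"
      using jacobi_equation(3)[of Y] unfolding m_def[abs_def] J_def .
    have \<Psi>Y: "?\<Psi> X Y = Q X (J X)" if "X \<in> U" for X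
      by (simp add: frame_transport_apply[OF that] J_def)
    \<comment> \<open>The factor \<open>P\<close> in the frame torsion undoes the \<open>Q\<close>
      in the frame transport, so the torsion acts on \<open>J\<close> itself.\<close>
    have \<T>Y: "(frame_torsion X o\<^sub>L ?\<Psi> X) Y = Q X (local_torsion (E X) [velocity X, J X])" if "X \<in> U" for X
      by (simp add: frame_torsion_apply[OF that] \<Psi>Y[OF that] PQ[OF that])
    have N1: "(?N ?\<Psi> X + ?\<Psi> X) Y = m X + (frame_torsion X o\<^sub>L ?\<Psi> X) Y" if X: "X \<in> U" for X
    proof -
      have "?N ?\<Psi> X Y = frechet_derivative (\<lambda>X. ?\<Psi> X Y) (at X) X"
        by (rule frechet_derivative_bounded_linear[OF bl smooth_on_differentiable[OF sm(1) X], symmetric])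
      also have "\<dots> = frechet_derivative (\<lambda>X. Q X (J X)) (at X) X"
        using frechet_derivative_cong_open[OF U(1) X \<Psi>Y] by simp
      finally show ?thesis
        using jacobi_equation(1)[OF X, of Y] unfolding blinfun.add_left \<T>Y[OF X] \<Psi>Y[OF X] m_def J_def by simp
    qed
    have "?N (\<lambda>X. ?N ?\<Psi> X + ?\<Psi> X) X Y = frechet_derivative (\<lambda>X. (?N ?\<Psi> X + ?\<Psi> X) Y) (at X) X"
      by (rule frechet_derivative_bounded_linear[OF bl smooth_on_differentiable[OF smN X], symmetric])
    also have "\<dots> = frechet_derivative (\<lambda>X. m X + (frame_torsion X o\<^sub>L ?\<Psi> X) Y) (at X) X"
      using frechet_derivative_cong_open[OF U(1) X N1] by simp
    also have "\<dots> = ?N m X + frechet_derivative (\<lambda>X. (frame_torsion X o\<^sub>L ?\<Psi> X) Y) (at X) X"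
      by (rule smooth_on_frechet_derivative_add[OF smm smooth_on_bounded_linear[OF U(1) bl sm\<T>] X])
    also have "frechet_derivative (\<lambda>X. (frame_torsion X o\<^sub>L ?\<Psi> X) Y) (at X) X = ?N (\<lambda>X. frame_torsion X o\<^sub>L ?\<Psi> X) X Y"
      by (rule frechet_derivative_bounded_linear[OF bl smooth_on_differentiable[OF sm\<T> X]])
    also have "?N m X = (frame_curvature X o\<^sub>L ?\<Psi> X) Y"
      using jacobi_equation(2)[OF X, of Y]
      by (simp add: frame_curvature_apply[OF X] \<Psi>Y[OF X] PQ[OF X] m_def[abs_def] J_def)
    finally show "?N (\<lambda>X. ?N ?\<Psi> X + ?\<Psi> X) X Y =
        ((frame_curvature X o\<^sub>L ?\<Psi> X) + ?N (\<lambda>X. frame_torsion X o\<^sub>L ?\<Psi> X) X) Y"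
      by (simp only: blinfun.add_left)
  qed
  have "number_op (series_add (number_op (taylor_series ?\<Psi>)) (taylor_series ?\<Psi>)) =
      taylor_series (?N (\<lambda>X. ?N ?\<Psi> X + ?\<Psi> X))"
    unfolding taylor_series_radial_derivative[OF U smN]
      taylor_series_add[OF U(1) smooth_on_radial_derivative[OF U(1) sm(1)] sm(1) U(2)]
      taylor_series_radial_derivative[OF U sm(1)] ..
  also have "\<dots> = taylor_series (\<lambda>X. (frame_curvature X o\<^sub>L ?\<Psi> X) + ?N (\<lambda>X. frame_torsion X o\<^sub>L ?\<Psi> X) X)"
    by (rule taylor_series_cong[OF U eq])
  also have "\<dots> = series_add (taylor_series (\<lambda>X. frame_curvature X o\<^sub>L ?\<Psi> X))
      (number_op (taylor_series (\<lambda>X. frame_torsion X o\<^sub>L ?\<Psi> X)))"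
    unfolding taylor_series_add[OF U(1) sm\<R> smooth_on_radial_derivative[OF U(1) sm\<T>] U(2)]
      taylor_series_radial_derivative[OF U sm\<T>] ..
  also have "taylor_series (\<lambda>X. frame_curvature X o\<^sub>L ?\<Psi> X) = series_comp (taylor_series frame_curvature) (taylor_series ?\<Psi>)"
    by (intro ext) (simp add: series_comp_def taylor_series_bilinear[OF U comp sm(2,1)])
  also have "taylor_series (\<lambda>X. frame_torsion X o\<^sub>L ?\<Psi> X) = series_comp (taylor_series frame_torsion) (taylor_series ?\<Psi>)"
    by (intro ext) (simp add: series_comp_def taylor_series_bilinear[OF U comp sm(3,1)])
  finally show ?thesis .
qed

section \<open>Taylor coefficients of the transported tensors\<close>

definition transported :: "('e \<Rightarrow> 'e list \<Rightarrow> 'e) \<Rightarrow> 'e \<Rightarrow> 'e list \<Rightarrow> nat \<Rightarrow> real \<Rightarrow> 'e" where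
  "transported S X us k t = Q (t *\<^sub>R X) ((local_cov ^^ k) S (E (t *\<^sub>R X)) (map (P (t *\<^sub>R X)) (replicate k X @ us)))"

text \<open>The covariant derivative puts its direction in front of the arguments. In direction
  \<open>X\<close> it merely lengthens the block of copies of \<open>X\<close>, so the family
  indexed by \<open>k\<close> is closed under differentiation in \<open>t\<close>.\<close>

lemma transported_has_vector_derivative:
  assumes "local_tensor \<Omega> (length us) S" "t *\<^sub>R X \<in> U"
  shows "(transported S X us k has_vector_derivative transported S X us (Suc k) t) (at t)"
  using transported_tensor_derivative[OF local_tensor_iterated_cov[OF assms(1)] _ assms(2), of "replicate k X @ us" k]
  unfolding transported_def[abs_def] by simp

lemma transported_0: "transported S X us k 0 = (local_cov ^^ k) S (E 0) (replicate k X @ us)"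
  by (simp add: transported_def Q_0 P_0 cong: map_cong)

lemma ray_domain: "open {t. t *\<^sub>R X \<in> U}" "0 \<in> {t. t *\<^sub>R X \<in> U}"
proof -
  have "open ((\<lambda>t. t *\<^sub>R X) -` U)" by (intro open_vimage U continuous_intros)
  then show "open {t. t *\<^sub>R X \<in> U}" by (simp add: vimage_def)
qed (simp add: U)

lemma linear_scale_outer:
  assumes X: "x \<in> \<Omega>" and S: "local_tensor \<Omega> n S" and vs: "length vs = n" "i < n"
  shows "S x (vs[i := c *\<^sub>R v]) = c *\<^sub>R S x (vs[i := v])"
  by (rule linear_scale[OF multilinearD[OF local_tensorD(1)[OF S X] vs]])

text \<open>At t X the velocity is t P X and fills two slots, so on the ray the function is t^2
  r(t). For n at least 2 its n-th derivative at 0 is n (n - 1) times the derivative of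
  \<open>r\<close> of order n - 2, and division by n! leaves 1 / (n - 2)!. Degrees 0 and 1
  vanish.\<close>

lemma taylor_series_frame_curvature_apply:
  "taylor_series frame_curvature n X Y =
    (\<Sum>k | k + 2 = n. (1 / fact k) *\<^sub>R (local_cov ^^ k) local_curvature (E 0) (replicate k X @ [X, Y, X]))"
proof -
  define r where "r = transported local_curvature X [X, Y, X]"
  let ?h = "times_parameter (times_parameter r)"
  have r: "(r k has_vector_derivative r (Suc k) t) (at t)" if "t \<in> {t. t *\<^sub>R X \<in> U}" for k t
    unfolding r_def by (rule transported_has_vector_derivative)
      (use that local_tensor_curvature in \<open>auto simp: numeral_3_eq_3\<close>)
  have h: "(?h k has_vector_derivative ?h (Suc k) t) (at t)" if "t \<in> {t. t *\<^sub>R X \<in> U}" for k t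
    by (intro times_parameter_has_vector_derivative r that)
  have start: "frame_curvature (t *\<^sub>R X) Y = ?h 0 t" if "t \<in> {t. t *\<^sub>R X \<in> U}" for t
  proof -
    have tX: "t *\<^sub>R X \<in> U" using that by simp
    let ?P = "P (t *\<^sub>R X)"
    have "local_curvature (E (t *\<^sub>R X)) [t *\<^sub>R ?P X, ?P Y, t *\<^sub>R ?P X] = t *\<^sub>R t *\<^sub>R local_curvature (E (t *\<^sub>R X)) [?P X, ?P Y, ?P X]"
      using linear_scale_outer[OF EU[OF tX] local_tensor_curvature, of "[0, ?P Y, t *\<^sub>R ?P X]" 0 t "?P X"]
        linear_scale_outer[OF EU[OF tX] local_tensor_curvature, of "[?P X, ?P Y, 0]" 2 t "?P X"] by simp
    then show ?thesis
      by (simp add: frame_curvature_apply[OF tX] velocity_def times_parameter_def r_def transported_def blinfun.scaleR_right)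
  qed
  have "diag_derivative n (\<lambda>X. frame_curvature X Y) 0 X = ?h n 0"
    by (rule diag_derivative_along_ray[OF U(1) smooth_on_bounded_linear[OF U(1) blinfun.bounded_linear_left smooth_on_frame_curvature]
          ray_domain _ start h]) auto
  then have eq: "taylor_series frame_curvature n X Y = (1 / fact n) *\<^sub>R ?h n 0"
    using diag_derivative_bounded_linear[OF U(1) blinfun.bounded_linear_left smooth_on_frame_curvature U(2), of n Y X]
    by (simp add: taylor_series_def blinfun.scaleR_left)
  consider "n = 0" | "n = 1" | m where "n = Suc (Suc m)" by (metis One_nat_def not0_implies_Suc)
  then show ?thesis
  proof cases
    case (3 m)
    have "{k. k + 2 = n} = {m}" using 3 by auto
    moreover have "(1 / fact n) *\<^sub>R ?h n 0 = (1 / fact m) *\<^sub>R r m 0"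
      by (simp add: 3 times_parameter_def)
    ultimately show ?thesis using eq by (simp add: r_def transported_0)
  qed (unfold eq, simp_all add: times_parameter_def)
qed

text \<open>Only one slot holds the velocity, hence a single factor \<open>t\<close> and a shift of
  degree by 1.\<close>

lemma taylor_series_frame_torsion_apply:
  "taylor_series frame_torsion n X Y =
    (\<Sum>k | k + 1 = n. (1 / fact k) *\<^sub>R (local_cov ^^ k) local_torsion (E 0) (replicate k X @ [X, Y]))"
proof -
  define r where "r = transported local_torsion X [X, Y]"
  let ?h = "times_parameter r"
  have r: "(r k has_vector_derivative r (Suc k) t) (at t)" if "t \<in> {t. t *\<^sub>R X \<in> U}" for k t
    unfolding r_def by (rule transported_has_vector_derivative)
      (use that local_tensor_torsion in \<open>auto simp: numeral_2_eq_2\<close>)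
  have h: "(?h k has_vector_derivative ?h (Suc k) t) (at t)" if "t \<in> {t. t *\<^sub>R X \<in> U}" for k t
    by (intro times_parameter_has_vector_derivative r that)
  have start: "frame_torsion (t *\<^sub>R X) Y = ?h 0 t" if "t \<in> {t. t *\<^sub>R X \<in> U}" for t
  proof -
    have tX: "t *\<^sub>R X \<in> U" using that by simp
    let ?P = "P (t *\<^sub>R X)"
    have "local_torsion (E (t *\<^sub>R X)) [t *\<^sub>R ?P X, ?P Y] = t *\<^sub>R local_torsion (E (t *\<^sub>R X)) [?P X, ?P Y]"
      using linear_scale_outer[OF EU[OF tX] local_tensor_torsion, of "[0, ?P Y]" 0 t "?P X"] by simp
    then show ?thesis
      by (simp add: frame_torsion_apply[OF tX] velocity_def times_parameter_def r_def transported_def blinfun.scaleR_right)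
  qed
  have "diag_derivative n (\<lambda>X. frame_torsion X Y) 0 X = ?h n 0"
    by (rule diag_derivative_along_ray[OF U(1) smooth_on_bounded_linear[OF U(1) blinfun.bounded_linear_left smooth_on_frame_torsion]
          ray_domain _ start h]) auto
  then have eq: "taylor_series frame_torsion n X Y = (1 / fact n) *\<^sub>R ?h n 0"
    using diag_derivative_bounded_linear[OF U(1) blinfun.bounded_linear_left smooth_on_frame_torsion U(2), of n Y X]
    by (simp add: taylor_series_def blinfun.scaleR_left)
  show ?thesis
  proof (cases n)
    case (Suc m)
    have "{k. k + 1 = n} = {m}" using Suc by auto
    moreover have "(1 / fact n) *\<^sub>R ?h n 0 = (1 / fact m) *\<^sub>R r m 0"
      by (simp add: Suc times_parameter_def)
    ultimately show ?thesis using eq by (simp add: r_def transported_0)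
  qed (unfold eq, simp add: times_parameter_def)
qed

lemma taylor_series_frame_curvature:
  "taylor_series frame_curvature = (\<lambda>n X. \<Sum>k | k + 2 = n. (1 / fact k) *\<^sub>R
     Blinfun (\<lambda>Y. (local_cov ^^ k) local_curvature (E 0) (replicate k X @ [X, Y, X])))"
proof (intro ext blinfun_eqI)
  fix n X Y
  \<comment> \<open>\<open>Y\<close> sits in slot k + 1, behind \<open>k\<close> directions of
    differentiation and the first argument \<open>X\<close>; linearity there gives
    \<open>Blinfun\<close> its meaning.\<close>
  have "linear (\<lambda>Y. (local_cov ^^ k) local_curvature (E 0) ((replicate k X @ [X, 0, X])[k + 1 := Y]))" for k
    by (rule multilinearD[OF local_tensorD(1)[OF local_tensor_iterated_cov[OF local_tensor_curvature] EU[OF U(2)]]]) auto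
  then have "linear (\<lambda>Y. (local_cov ^^ k) local_curvature (E 0) (replicate k X @ [X, Y, X]))" for k
    by (simp add: list_update_append)
  then show "taylor_series frame_curvature n X Y = (\<Sum>k | k + 2 = n. (1 / fact k) *\<^sub>R
     Blinfun (\<lambda>Y. (local_cov ^^ k) local_curvature (E 0) (replicate k X @ [X, Y, X]))) Y"
    by (simp add: taylor_series_frame_curvature_apply blinfun.sum_left blinfun.scaleR_left Blinfun_apply_linear)
qed

lemma taylor_series_frame_torsion:
  "taylor_series frame_torsion = (\<lambda>n X. \<Sum>k | k + 1 = n. (1 / fact k) *\<^sub>R
     Blinfun (\<lambda>Y. (local_cov ^^ k) local_torsion (E 0) (replicate k X @ [X, Y])))"
proof (intro ext blinfun_eqI)
  fix n X Y
  have "linear (\<lambda>Y. (local_cov ^^ k) local_torsion (E 0) ((replicate k X @ [X, 0])[k + 1 := Y]))" for k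
    by (rule multilinearD[OF local_tensorD(1)[OF local_tensor_iterated_cov[OF local_tensor_torsion] EU[OF U(2)]]]) auto
  then have "linear (\<lambda>Y. (local_cov ^^ k) local_torsion (E 0) (replicate k X @ [X, Y]))" for k
    by (simp add: list_update_append)
  then show "taylor_series frame_torsion n X Y = (\<Sum>k | k + 1 = n. (1 / fact k) *\<^sub>R
     Blinfun (\<lambda>Y. (local_cov ^^ k) local_torsion (E 0) (replicate k X @ [X, Y]))) Y"
    by (simp add: taylor_series_frame_torsion_apply blinfun.sum_left blinfun.scaleR_left Blinfun_apply_linear)
qed

lemma taylor_series_frame_transport_0: "taylor_series frame_transport 0 = (\<lambda>_. id_blinfun)"
  by (intro ext blinfun_eqI) (simp add: taylor_series_def frame_transport_apply[OF U(2)] Q_0 DE_0)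

theorem frame_transport_characterization:
  "formal_power_series F \<and> F 0 = (\<lambda>_. id_blinfun) \<and>
    number_op (series_add (number_op F) F) =
      series_add (series_comp (taylor_series frame_curvature) F) (number_op (series_comp (taylor_series frame_torsion) F))
   \<longleftrightarrow> F = taylor_series frame_transport"
proof
  assume "formal_power_series F \<and> F 0 = (\<lambda>_. id_blinfun) \<and>
    number_op (series_add (number_op F) F) =
      series_add (series_comp (taylor_series frame_curvature) F) (number_op (series_comp (taylor_series frame_torsion) F))"
  then show "F = taylor_series frame_transport"
    by (intro formal_equation_unique[OF _ _ _ _ frame_transport_equation])
      (auto simp: taylor_series_frame_transport_0 taylor_series_frame_curvature taylor_series_frame_torsion)
next
  assume "F = taylor_series frame_transport"
  then show "formal_power_series F \<and> F 0 = (\<lambda>_. id_blinfun) \<and>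
    number_op (series_add (number_op F) F) =
      series_add (series_comp (taylor_series frame_curvature) F) (number_op (series_comp (taylor_series frame_torsion) F))"
    using frame_transport_equation taylor_series_frame_transport_0
      formal_power_series_taylor_series[OF U smooth_on_frame_transport] by simp
qed

end

section \<open>Geodesics and parallel transport in a chart\<close>

lemma gronwall_zero:
  fixes d :: "real \<Rightarrow> 'a::euclidean_space"
  assumes ab: "a \<le> b"
    and d: "\<And>t. t \<in> {a..b} \<Longrightarrow> (d has_vector_derivative d' t) (at t within {a..b})"
    and bound: "\<And>t. t \<in> {a..b} \<Longrightarrow> norm (d' t) \<le> L * norm (d t)"
  shows "d a = 0 \<longleftrightarrow> d b = 0"
proof -
  \<comment> \<open>With c = - 2 L the weighted square norm does not increase from \<open>a\<close>
    to \<open>b\<close>, with c = 2 L it does not decrease, so a zero propagates both forward and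
    backward in time.\<close>
  define \<phi> where "\<phi> c t = exp (c * t) * (d t \<bullet> d t)" for c t :: real
  define \<phi>' where "\<phi>' c t = exp (c * t) * (2 * (d t \<bullet> d' t) + c * (d t \<bullet> d t))" for c t :: real
  have deriv: "(\<phi> c has_derivative (\<lambda>h. h * \<phi>' c t)) (at t within {a..b})" if t: "t \<in> {a..b}" for c t
  proof -
    have dt: "(d has_derivative (\<lambda>h. h *\<^sub>R d' t)) (at t within {a..b})"
      using d[OF t] by (simp add: has_vector_derivative_def)
    have e: "((\<lambda>t. exp (c * t)) has_derivative (\<lambda>h. h * (c * exp (c * t)))) (at t within {a..b})"
      by (auto intro!: derivative_eq_intros simp: algebra_simps)
    show ?thesis
      unfolding \<phi>_def[abs_def]
      by (rule has_derivative_eq_rhs[OF has_derivative_mult[OF e has_derivative_inner[OF dt dt]]])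
        (simp add: \<phi>'_def fun_eq_iff algebra_simps inner_commute)
  qed
  have mvt: "\<exists>t\<in>{a..b}. \<phi> c b - \<phi> c a = (b - a) * \<phi>' c t" for c
    by (rule mvt_very_simple[OF ab]) (use deriv in auto)
  have inner_bound: "\<bar>d t \<bullet> d' t\<bar> \<le> L * (d t \<bullet> d t)" if "t \<in> {a..b}" for t
  proof -
    have "\<bar>d t \<bullet> d' t\<bar> \<le> norm (d t) * norm (d' t)" by (rule Cauchy_Schwarz_ineq2)
    also have "\<dots> \<le> norm (d t) * (L * norm (d t))" by (intro mult_left_mono bound that) simp
    finally show ?thesis by (simp add: dot_square_norm power2_eq_square ac_simps)
  qed
  have down: "\<phi> (- 2 * L) b \<le> \<phi> (- 2 * L) a"
  proof -
    obtain t where t: "t \<in> {a..b}" "\<phi> (- 2 * L) b - \<phi> (- 2 * L) a = (b - a) * \<phi>' (- 2 * L) t" using mvt by blast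
    have "\<phi>' (- 2 * L) t \<le> 0" using inner_bound[OF t(1)] by (simp add: \<phi>'_def mult_nonneg_nonpos)
    then show ?thesis using t(2) ab by (smt (verit) mult_nonneg_nonpos)
  qed
  have up: "\<phi> (2 * L) a \<le> \<phi> (2 * L) b"
  proof -
    obtain t where t: "t \<in> {a..b}" "\<phi> (2 * L) b - \<phi> (2 * L) a = (b - a) * \<phi>' (2 * L) t" using mvt by blast
    have "0 \<le> \<phi>' (2 * L) t" using inner_bound[OF t(1)] by (simp add: \<phi>'_def)
    then show ?thesis using t(2) ab by (smt (verit) mult_nonneg_nonneg)
  qed
  have zero: "\<phi> c t \<le> 0 \<longleftrightarrow> d t = 0" for c t
    unfolding \<phi>_def dot_square_norm by (simp add: mult_le_0_iff not_le[symmetric])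
  show ?thesis
  proof
    assume "d a = 0"
    then have "\<phi> (- 2 * L) a \<le> 0" by (simp only: zero)
    then show "d b = 0" using down zero[of "- 2 * L" b] by linarith
  next
    assume "d b = 0"
    then have "\<phi> (2 * L) b \<le> 0" by (simp only: zero)
    then show "d a = 0" using up zero[of "2 * L" a] by linarith
  qed
qed

lemma smooth_on_lipschitz:
  fixes g :: "'a::euclidean_space \<Rightarrow> 'b::real_normed_vector"
  assumes X: "open X" "smooth_on X g" and K: "compact K" "K \<subseteq> X"
  obtains L where "0 < L" "\<And>x v. x \<in> K \<Longrightarrow> norm (frechet_derivative g (at x) v) \<le> L * norm v"
proof -
  have "\<exists>M. \<forall>x\<in>K. norm (frechet_derivative g (at x) b) \<le> M" for b
  proof -
    have "continuous_on K (\<lambda>x. frechet_derivative g (at x) b)"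
      by (rule continuous_on_subset[OF smooth_on_continuous[OF smooth_on_derivative[OF X(2)]] K(2)])
    then have "bounded ((\<lambda>x. frechet_derivative g (at x) b) ` K)"
      by (intro compact_imp_bounded compact_continuous_image K)
    then show ?thesis by (auto simp: bounded_iff)
  qed
  then obtain M where M: "\<And>b x. x \<in> K \<Longrightarrow> norm (frechet_derivative g (at x) b) \<le> M b" by metis
  define L where "L = 1 + (\<Sum>b\<in>(Basis :: 'a set). \<bar>M b\<bar>)"
  show thesis
  proof
    show "0 < L" unfolding L_def by (simp add: add_pos_nonneg sum_nonneg)
    fix x v assume x: "x \<in> K"
    have "linear (frechet_derivative g (at x))" using smooth_on_linear_derivative[OF X(2)] x K(2) by auto
    from linear_basis_expansion[OF this, of v]
    have "norm (frechet_derivative g (at x) v) = norm (\<Sum>b\<in>Basis. (v \<bullet> b) *\<^sub>R frechet_derivative g (at x) b)" by simp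
    also have "\<dots> \<le> (\<Sum>b\<in>(Basis :: 'a set). norm v * \<bar>M b\<bar>)"
      by (intro order_trans[OF norm_sum] sum_mono)
        (auto intro!: mult_mono Basis_le_norm order_trans[OF M[OF x]])
    also have "\<dots> \<le> L * norm v" by (simp add: L_def sum_distrib_left[symmetric] algebra_simps)
    finally show "norm (frechet_derivative g (at x) v) \<le> L * norm v" .
  qed
qed

lemma has_vector_derivative_nearby:
  fixes z :: "real \<Rightarrow> 'a::real_normed_vector"
  assumes "(z has_vector_derivative z') (at t within T)" "open X" "z t \<in> X"
  obtains \<delta> where "\<delta> > 0" "\<And>s. s \<in> T \<Longrightarrow> dist s t < \<delta> \<Longrightarrow> z s \<in> X"
proof -
  have "continuous (at t within T) z" using assms(1) by (rule has_vector_derivative_continuous)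
  moreover obtain e where "e > 0" "\<And>y. dist y (z t) < e \<Longrightarrow> y \<in> X"
    using assms(2,3) unfolding open_dist by metis
  ultimately show thesis using that unfolding continuous_within_eps_delta by metis
qed

text \<open>Agreement and disagreement are both open in the interval \<open>T\<close>: the former by
  Gronwall's inequality, with a Lipschitz constant on a ball around the common value, the latter by
  continuity. Connectedness of \<open>T\<close> does the rest.\<close>

lemma ode_solutions_agree:
  fixes z1 z2 :: "real \<Rightarrow> 'a::euclidean_space"
  assumes X: "open X" "smooth_on X g" and T: "convex T"
    and z1: "\<And>t. t \<in> T \<Longrightarrow> z1 t \<in> X" "\<And>t. t \<in> T \<Longrightarrow> (z1 has_vector_derivative g (z1 t)) (at t within T)"
    and z2: "\<And>t. t \<in> T \<Longrightarrow> z2 t \<in> X" "\<And>t. t \<in> T \<Longrightarrow> (z2 has_vector_derivative g (z2 t)) (at t within T)"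
    and s: "s \<in> T" "z1 s = z2 s" and t: "t \<in> T"
  shows "z1 t = z2 t"
proof (rule connected_induction_simple[OF convex_connected[OF T], where P = "\<lambda>t. z1 t = z2 t", OF s(1) t s(2)])
  fix a assume a: "a \<in> T"
  have nbhd: "openin (top_of_set T) (T \<inter> ball a \<delta>)" "a \<in> T \<inter> ball a \<delta>" if "\<delta> > 0" for \<delta>
    using that a by auto
  show "\<exists>W. openin (top_of_set T) W \<and> a \<in> W \<and> (\<forall>x\<in>W. \<forall>y\<in>W. z1 x = z2 x \<longrightarrow> z1 y = z2 y)"
  proof (cases "z1 a = z2 a")
    case False
    obtain \<delta> where "\<delta> > 0" "\<And>s. s \<in> T \<Longrightarrow> dist s a < \<delta> \<Longrightarrow> z1 s - z2 s \<in> - {0}"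
      using has_vector_derivative_nearby[OF has_vector_derivative_diff[OF z1(2)[OF a] z2(2)[OF a]], of "- {0}"] False by auto
    then show ?thesis using nbhd[of \<delta>] by (intro exI[of _ "T \<inter> ball a \<delta>"]) (auto simp: dist_commute)
  next
    case True
    obtain r where r: "r > 0" "cball (z1 a) r \<subseteq> X" using X(1) z1(1)[OF a] open_contains_cball by blast
    obtain \<delta>1 where \<delta>1: "\<delta>1 > 0" "\<And>s. s \<in> T \<Longrightarrow> dist s a < \<delta>1 \<Longrightarrow> z1 s \<in> ball (z1 a) r"
      using has_vector_derivative_nearby[OF z1(2)[OF a], of "ball (z1 a) r"] r by auto
    obtain \<delta>2 where \<delta>2: "\<delta>2 > 0" "\<And>s. s \<in> T \<Longrightarrow> dist s a < \<delta>2 \<Longrightarrow> z2 s \<in> ball (z1 a) r"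
      using has_vector_derivative_nearby[OF z2(2)[OF a], of "ball (z1 a) r"] r True by auto
    obtain L where L: "\<And>x v. x \<in> cball (z1 a) r \<Longrightarrow> norm (frechet_derivative g (at x) v) \<le> L * norm v"
      using smooth_on_lipschitz[OF X compact_cball r(2)] by metis
    have lip: "norm (g y - g x) \<le> L * norm (y - x)" if "x \<in> cball (z1 a) r" "y \<in> cball (z1 a) r" for x y
    proof (rule differentiable_bound[OF convex_cball _ _ that(2,1)])
      fix x assume x: "x \<in> cball (z1 a) r"
      show "(g has_derivative frechet_derivative g (at x)) (at x within cball (z1 a) r)"
        by (rule has_derivative_at_withinI[OF smooth_on_has_derivative[OF X(2)]]) (use x r in auto)
      show "onorm (frechet_derivative g (at x)) \<le> L" by (rule onorm_le[OF L[OF x]])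
    qed
    define \<delta> where "\<delta> = min \<delta>1 \<delta>2"
    have \<delta>: "\<delta> > 0" using \<delta>1 \<delta>2 by (simp add: \<delta>_def)
    define J where "J = T \<inter> ball a \<delta>"
    have cJ: "convex J" unfolding J_def by (intro convex_Int T convex_ball)
    have inJ: "z1 t \<in> cball (z1 a) r" "z2 t \<in> cball (z1 a) r" "t \<in> T" if "t \<in> J" for t
      using that \<delta>1(2)[of t] \<delta>2(2)[of t] by (auto simp: J_def \<delta>_def dist_commute)
    have main: "z1 x = z2 x \<longleftrightarrow> z1 y = z2 y" if xy: "x \<in> J" "y \<in> J" "x \<le> y" for x y
    proof -
      have sub: "{x..y} \<subseteq> J"
        using cJ xy closed_segment_subset[of x J y] by (simp add: closed_segment_eq_real_ivl)
      have subT: "{x..y} \<subseteq> T" using sub by (auto simp: J_def)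
      have "z1 x - z2 x = 0 \<longleftrightarrow> z1 y - z2 y = 0"
      proof (rule gronwall_zero[OF xy(3), where L = L])
        fix t assume t: "t \<in> {x..y}"
        then have tJ: "t \<in> J" using sub by auto
        show "((\<lambda>t. z1 t - z2 t) has_vector_derivative (g (z1 t) - g (z2 t))) (at t within {x..y})"
          by (intro has_vector_derivative_diff
            has_vector_derivative_within_subset[OF z1(2)[OF inJ(3)[OF tJ]] subT]
            has_vector_derivative_within_subset[OF z2(2)[OF inJ(3)[OF tJ]] subT])
        show "norm (g (z1 t) - g (z2 t)) \<le> L * norm (z1 t - z2 t)"
          by (rule lip[OF inJ(2,1)[OF tJ]])
      qed
      then show ?thesis by simp
    qed
    have "z1 y = z2 y" if "x \<in> J" "y \<in> J" "z1 x = z2 x" for x y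
      using main[of x y] main[of y x] that by linarith
    moreover have "openin (top_of_set T) J" "a \<in> J" using nbhd[OF \<delta>] by (simp_all only: J_def)
    ultimately show ?thesis by metis
  qed
qed

section \<open>Geodesics and parallel fields as one first order system\<close>

context local_connection
begin

text \<open>The vector field of the first order system for \<open>(\<gamma>, \<gamma>', V)\<close>, where \<open>\<gamma>\<close> is a geodesic and
  \<open>V\<close> is parallel along it.\<close>

definition spray :: "'e \<times> 'e \<times> 'e \<Rightarrow> 'e \<times> 'e \<times> 'e" where
  "spray z = (case z of (x, y, a) \<Rightarrow> (y, - G x y y, - G x y a))"

lemma spray_simps [simp]: "spray (x, y, a) = (y, - G x y y, - G x y a)"
  by (simp add: spray_def)

definition phase_space :: "('e \<times> 'e \<times> 'e) set" where "phase_space = \<Omega> \<times> UNIV"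

lemma open_phase_space: "open phase_space"
  unfolding phase_space_def by (intro open_Times open_domain open_UNIV)

lemma smooth_on_spray: "smooth_on phase_space spray"
proof -
  have bl: "bounded_linear (\<lambda>z::'e\<times>'e\<times>'e. fst (snd z))" "bounded_linear (\<lambda>z::'e\<times>'e\<times>'e. snd (snd z))"
    by (intro bounded_linear_compose[OF bounded_linear_fst bounded_linear_snd] bounded_linear_compose[OF bounded_linear_snd bounded_linear_snd])+
  note sm = smooth_on_linear_image[OF open_phase_space bounded_linear_fst]
    smooth_on_linear_image[OF open_phase_space bl(1)] smooth_on_linear_image[OF open_phase_space bl(2)]
  have "smooth_on phase_space (\<lambda>z. (fst (snd z), - G (fst z) (fst (snd z)) (fst (snd z)), - G (fst z) (fst (snd z)) (snd (snd z))))"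
    by (intro smooth_on_Pair smooth_on_minus open_phase_space sm smooth_on_coefficients[OF open_phase_space])
      (auto simp: phase_space_def)
  then show ?thesis by (simp add: spray_def[abs_def] case_prod_beta)
qed

text \<open>The time domain is a parameter because a geodesic of the manifold can be compared with a
  solution in the chart only on those pieces of {0..1} where it lies in the chart.\<close>

definition transport_solution :: "real set \<Rightarrow> (real \<Rightarrow> 'e) \<Rightarrow> (real \<Rightarrow> 'e) \<Rightarrow> (real \<Rightarrow> 'e) \<Rightarrow> bool" where
  "transport_solution T x y a \<longleftrightarrow> (\<forall>t\<in>T. x t \<in> \<Omega> \<and> (x has_vector_derivative y t) (at t within T) \<and>
     (y has_vector_derivative - G (x t) (y t) (y t)) (at t within T) \<and>
     (a has_vector_derivative - G (x t) (y t) (a t)) (at t within T))"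

lemma transport_solutionD:
  assumes "transport_solution T x y a" "t \<in> T"
  shows "x t \<in> \<Omega>" "(x has_vector_derivative y t) (at t within T)"
    "(y has_vector_derivative - G (x t) (y t) (y t)) (at t within T)"
    "(a has_vector_derivative - G (x t) (y t) (a t)) (at t within T)"
  using assms by (auto simp: transport_solution_def)

lemma transport_solution_unique:
  assumes 1: "transport_solution T x1 y1 a1" and 2: "transport_solution T x2 y2 a2" and T: "convex T"
    and s: "s \<in> T" "x1 s = x2 s" "y1 s = y2 s" "a1 s = a2 s" and t: "t \<in> T"
  shows "x1 t = x2 t" "y1 t = y2 t" "a1 t = a2 t"
proof -
  have "(x1 t, y1 t, a1 t) = (x2 t, y2 t, a2 t)"
    by (rule ode_solutions_agree[OF open_phase_space smooth_on_spray T,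
          where ?z1.0 = "\<lambda>t. (x1 t, y1 t, a1 t)" and ?z2.0 = "\<lambda>t. (x2 t, y2 t, a2 t)", OF _ _ _ _ s(1) _ t])
      (use s transport_solutionD[OF 1] transport_solutionD[OF 2] in
        \<open>auto simp: phase_space_def intro!: has_vector_derivative_Pair\<close>)
  then show "x1 t = x2 t" "y1 t = y2 t" "a1 t = a2 t" by auto
qed

lemma transport_solution_cong:
  assumes "transport_solution T x y a" "\<And>t. t \<in> T \<Longrightarrow> x' t = x t" "\<And>t. t \<in> T \<Longrightarrow> y' t = y t"
  shows "transport_solution T x' y' a"
  unfolding transport_solution_def
proof (intro ballI conjI)
  fix t assume t: "t \<in> T"
  note D = transport_solutionD[OF assms(1) t]
  show "x' t \<in> \<Omega>" "(a has_vector_derivative - G (x' t) (y' t) (a t)) (at t within T)"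
    using D assms(2,3)[OF t] by simp_all
  show "(x' has_vector_derivative y' t) (at t within T)"
    using has_vector_derivative_transform[OF t assms(2) D(2)] assms(3)[OF t] by simp
  show "(y' has_vector_derivative - G (x' t) (y' t) (y' t)) (at t within T)"
    using has_vector_derivative_transform[OF t assms(3) D(3)] assms(2,3)[OF t] by simp
qed

text \<open>The velocity of a geodesic is parallel along it. This also serves to discard a parallel
  field in favour of one determined by the geodesic.\<close>

lemma transport_solution_velocity:
  "transport_solution T x y a \<Longrightarrow> transport_solution T x y y"
  by (simp add: transport_solution_def)

text \<open>Parallel fields along a fixed curve form a vector space. The extra solution
  \<open>a'\<close> supplies the equations for \<open>x\<close> and \<open>y\<close> even when
  \<open>B\<close> is empty.\<close>

lemma transport_solution_sum:
  assumes "\<And>b. b \<in> B \<Longrightarrow> transport_solution T x y (a b)" and "transport_solution T x y a'"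
  shows "transport_solution T x y (\<lambda>t. \<Sum>b\<in>B. c b *\<^sub>R a b t)"
  unfolding transport_solution_def
proof (intro ballI conjI)
  fix t assume t: "t \<in> T"
  note D = transport_solutionD[OF assms(2) t]
  show "x t \<in> \<Omega>" "(x has_vector_derivative y t) (at t within T)" "(y has_vector_derivative - G (x t) (y t) (y t)) (at t within T)"
    by (rule D)+
  have "((\<lambda>t. \<Sum>b\<in>B. c b *\<^sub>R a b t) has_vector_derivative (\<Sum>b\<in>B. c b *\<^sub>R (- G (x t) (y t) (a b t)))) (at t within T)"
    by (intro has_vector_derivative_sum bounded_linear.has_vector_derivative[OF bounded_linear_scaleR_right]
      transport_solutionD(4)[OF assms(1) t])
  moreover have "(\<Sum>b\<in>B. c b *\<^sub>R (- G (x t) (y t) (a b t))) = - G (x t) (y t) (\<Sum>b\<in>B. c b *\<^sub>R a b t)"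
    by (simp add: linear_sum[OF linear_right[OF D(1)]] linear_scale[OF linear_right[OF D(1)]] sum_negf)
  ultimately show "((\<lambda>t. \<Sum>b\<in>B. c b *\<^sub>R a b t) has_vector_derivative - G (x t) (y t) (\<Sum>b\<in>B. c b *\<^sub>R a b t)) (at t within T)"
    by simp
qed

text \<open>Homogeneity of geodesics: slowing down by \<open>s\<close> multiplies the velocity by
  \<open>s\<close>, while the parallel field is merely reparametrised.\<close>

lemma transport_solution_rescale:
  assumes sol: "transport_solution {0..1} x y a" and s: "s \<in> {0..1}"
  shows "transport_solution {0..1} (\<lambda>t. x (s * t)) (\<lambda>t. s *\<^sub>R y (s * t)) (\<lambda>t. a (s * t))"
  unfolding transport_solution_def
proof (intro ballI conjI)
  fix t :: real assume t: "t \<in> {0..1}"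
  then have st: "s * t \<in> {0..1}" using s by (auto intro: mult_le_one)
  note D = transport_solutionD[OF sol st]
  show "x (s * t) \<in> \<Omega>" by (rule D)
  have inner: "((\<lambda>t. s * t) has_vector_derivative s) (at t within {0..1})"
    unfolding has_vector_derivative_def by (auto intro!: derivative_eq_intros simp: mult.commute)
  have img: "(\<lambda>t. s * t) ` {0..1} \<subseteq> {0..1}" using s by (auto intro: mult_le_one)
  have chain: "((\<lambda>t. f (s * t)) has_vector_derivative s *\<^sub>R f') (at t within {0..1})"
    if "(f has_vector_derivative f') (at (s * t) within {0..1})" for f :: "real \<Rightarrow> 'e" and f'
    using vector_diff_chain_within[OF inner has_vector_derivative_within_subset[OF that img]] by (simp add: o_def)
  show "((\<lambda>t. x (s * t)) has_vector_derivative s *\<^sub>R y (s * t)) (at t within {0..1})"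
    by (rule chain[OF D(2)])
  note lin = linear_scale[OF linear_left[OF D(1)]] linear_scale[OF linear_right[OF D(1)]]
  show "((\<lambda>t. s *\<^sub>R y (s * t)) has_vector_derivative - G (x (s * t)) (s *\<^sub>R y (s * t)) (s *\<^sub>R y (s * t))) (at t within {0..1})"
    using bounded_linear.has_vector_derivative[OF bounded_linear_scaleR_right[of s] chain[OF D(3)]] by (simp add: lin)
  show "((\<lambda>t. a (s * t)) has_vector_derivative - G (x (s * t)) (s *\<^sub>R y (s * t)) (a (s * t))) (at t within {0..1})"
    using chain[OF D(4)] by (simp add: lin)
qed

text \<open>The spray is multiplied by an \<open>\<epsilon>\<close> that makes the field and its
  derivative small enough for existence in unit time. By bilinearity of \<open>G\<close> the result
  solves the original system with \<open>\<epsilon>\<close> times the second component as velocity,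
  while the parallel component keeps its scale.\<close>

lemma transport_flow:
  assumes x0: "x0 \<in> \<Omega>"
  obtains \<epsilon> r u where "0 < \<epsilon>" "0 < r"
    "\<And>W v. norm W < r \<Longrightarrow> norm v < r \<Longrightarrow> transport_solution {0..1}
       (\<lambda>t. fst (u (W, v) t)) (\<lambda>t. \<epsilon> *\<^sub>R fst (snd (u (W, v) t))) (\<lambda>t. snd (snd (u (W, v) t)))"
    "\<And>W v. norm W < r \<Longrightarrow> norm v < r \<Longrightarrow> u (W, v) 0 = (x0, W, v)"
    "\<And>t. smooth_on (ball 0 r \<times> ball 0 r) (\<lambda>\<xi>. u \<xi> t)"
proof -
  define z :: "'e \<times> 'e \<times> 'e" where "z = (x0, 0, 0)"
  have "z \<in> phase_space" using x0 by (simp add: z_def phase_space_def)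
  then obtain r where r: "r > 0" "cball z r \<subseteq> phase_space"
    using open_phase_space open_contains_cball by blast
  obtain L where L: "0 < L" "\<And>x v. x \<in> cball z r \<Longrightarrow> norm (frechet_derivative spray (at x) v) \<le> L * norm v"
    using smooth_on_lipschitz[OF open_phase_space smooth_on_spray compact_cball r(2)] by metis
  have "bounded (spray ` cball z r)"
    by (intro compact_imp_bounded compact_continuous_image compact_cball
      continuous_on_subset[OF smooth_on_continuous[OF smooth_on_spray] r(2)])
  then obtain M where M: "0 < M" "\<And>x. x \<in> cball z r \<Longrightarrow> norm (spray x) \<le> M"
    unfolding bounded_pos by blast
  define \<epsilon> where "\<epsilon> = min (1 / (2 * L)) (r / (2 * M))"
  have \<epsilon>: "\<epsilon> > 0" "\<epsilon> * L \<le> 1 / 2" "\<epsilon> * M \<le> r / 2"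
    using L(1) M(1) r(1) by (auto simp: \<epsilon>_def field_simps min_def)
  define l :: "'e \<times> 'e \<Rightarrow> 'e \<times> 'e \<times> 'e" where "l \<xi> = (0, \<xi>)" for \<xi>
  have l: "bounded_linear l"
    unfolding l_def[abs_def] by (intro bounded_linear_Pair bounded_linear_zero bounded_linear_ident)
  \<comment> \<open>Two components of norm below r / 4 keep the initial point within r / 2 of
    \<open>z\<close>.\<close>
  define S :: "('e \<times> 'e) set" where "S = ball 0 (r / 4) \<times> ball 0 (r / 4)"
  have openS: "open S" unfolding S_def by (intro open_Times open_ball)
  have start: "dist z (z + l \<xi>) \<le> r / 2" if "\<xi> \<in> S" for \<xi>
  proof -
    have "norm \<xi> \<le> norm (fst \<xi>) + norm (snd \<xi>)" using norm_Pair_le[of "fst \<xi>" "snd \<xi>"] by simp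
    also have "\<dots> \<le> r / 2" using that by (auto simp: S_def)
    finally show ?thesis by (simp add: dist_norm l_def norm_Pair)
  qed
  have smooth: "smooth_on phase_space (\<lambda>z. \<epsilon> *\<^sub>R spray z)"
    by (rule smooth_on_bounded_linear[OF open_phase_space bounded_linear_scaleR_right smooth_on_spray])
  have bound: "norm (\<epsilon> *\<^sub>R spray x) \<le> r / 2" if "x \<in> cball z r" for x
    using order_trans[OF mult_left_mono[OF M(2)[OF that]] \<epsilon>(3)] \<epsilon>(1) by simp
  have contraction: "norm (frechet_derivative (\<lambda>z. \<epsilon> *\<^sub>R spray z) (at x) v) \<le> norm v / 2" if x: "x \<in> cball z r" for x v
  proof -
    have "norm (frechet_derivative (\<lambda>z. \<epsilon> *\<^sub>R spray z) (at x) v) = \<epsilon> * norm (frechet_derivative spray (at x) v)"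
      using x r(2) \<epsilon>(1) by (subst frechet_derivative_bounded_linear[OF bounded_linear_scaleR_right
          smooth_on_differentiable[OF smooth_on_spray]]) auto
    also have "\<dots> \<le> \<epsilon> * (L * norm v)" using L(2)[OF x] \<epsilon>(1) by (intro mult_left_mono) auto
    also have "\<dots> \<le> norm v / 2" using mult_right_mono[OF \<epsilon>(2), of "norm v"] by simp
    finally show ?thesis .
  qed
  obtain u where u: "\<And>\<xi>. \<xi> \<in> S \<Longrightarrow> u \<xi> 0 = z + l \<xi>" "\<And>\<xi> t. \<xi> \<in> S \<Longrightarrow> u \<xi> t \<in> cball z r"
    "\<And>\<xi> t. \<xi> \<in> S \<Longrightarrow> t \<in> {0..1} \<Longrightarrow> (u \<xi> has_vector_derivative \<epsilon> *\<^sub>R spray (u \<xi> t)) (at t within {0..1})"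
    "\<And>t. smooth_on S (\<lambda>\<xi>. u \<xi> t)"
    by (rule ode_solution_smooth[OF open_phase_space smooth r(2) bound contraction r(1) openS l start]) metis+
  show thesis
  proof
    show "0 < \<epsilon>" "0 < r / 4" using \<epsilon> r by auto
    show "smooth_on (ball 0 (r / 4) \<times> ball 0 (r / 4)) (\<lambda>\<xi>. u \<xi> t)" for t using u(4)[of t] by (simp add: S_def)
    fix W v :: 'e assume "norm W < r / 4" "norm v < r / 4"
    then have S: "(W, v) \<in> S" by (simp add: S_def)
    show "u (W, v) 0 = (x0, W, v)" by (simp add: u(1)[OF S] z_def l_def)
    show "transport_solution {0..1} (\<lambda>t. fst (u (W, v) t)) (\<lambda>t. \<epsilon> *\<^sub>R fst (snd (u (W, v) t))) (\<lambda>t. snd (snd (u (W, v) t)))"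
      unfolding transport_solution_def
    proof (intro ballI)
      fix t :: real assume t: "t \<in> {0..1}"
      obtain x y a where xya: "u (W, v) t = (x, y, a)" by (cases "u (W, v) t") auto
      have x: "x \<in> \<Omega>" using u(2)[OF S, of t] r(2) by (auto simp: xya phase_space_def)
      have d: "(u (W, v) has_vector_derivative (\<epsilon> *\<^sub>R y, \<epsilon> *\<^sub>R (- G x y y), \<epsilon> *\<^sub>R (- G x y a))) (at t within {0..1})"
        using u(3)[OF S t] by (simp add: xya scaleR_Pair)
      note d2 = bounded_linear.has_vector_derivative[OF bounded_linear_snd d]
      have "((\<lambda>t. fst (u (W, v) t)) has_vector_derivative \<epsilon> *\<^sub>R y) (at t within {0..1})"
        "((\<lambda>t. \<epsilon> *\<^sub>R fst (snd (u (W, v) t))) has_vector_derivative \<epsilon> *\<^sub>R \<epsilon> *\<^sub>R (- G x y y)) (at t within {0..1})"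
        "((\<lambda>t. snd (snd (u (W, v) t))) has_vector_derivative \<epsilon> *\<^sub>R (- G x y a)) (at t within {0..1})"
        using bounded_linear.has_vector_derivative[OF bounded_linear_fst d]
          bounded_linear.has_vector_derivative[OF bounded_linear_scaleR_right[of \<epsilon>] bounded_linear.has_vector_derivative[OF bounded_linear_fst d2]]
          bounded_linear.has_vector_derivative[OF bounded_linear_snd d2] by simp_all
      then show "fst (u (W, v) t) \<in> \<Omega> \<and> ((\<lambda>t. fst (u (W, v) t)) has_vector_derivative \<epsilon> *\<^sub>R fst (snd (u (W, v) t))) (at t within {0..1}) \<and>
        ((\<lambda>t. \<epsilon> *\<^sub>R fst (snd (u (W, v) t))) has_vector_derivative
          - G (fst (u (W, v) t)) (\<epsilon> *\<^sub>R fst (snd (u (W, v) t))) (\<epsilon> *\<^sub>R fst (snd (u (W, v) t)))) (at t within {0..1}) \<and>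
        ((\<lambda>t. snd (snd (u (W, v) t))) has_vector_derivative
          - G (fst (u (W, v) t)) (\<epsilon> *\<^sub>R fst (snd (u (W, v) t))) (snd (snd (u (W, v) t)))) (at t within {0..1})"
        by (simp add: xya x linear_scale[OF linear_left[OF x]] linear_scale[OF linear_right[OF x]])
    qed
  qed
qed

text \<open>The equations of \<^locale>\<open>radial_frame\<close> hold because \<open>\<gamma> (s X) t = \<gamma> X (s t)\<close>, and because the
  velocity \<open>V X\<close> is itself the parallel field with initial value \<open>X\<close>.\<close>

lemma radial_frame_exists:
  assumes x0: "x0 \<in> \<Omega>"
  obtains \<rho> \<gamma> V \<tau> Q where "0 < \<rho>"
    "radial_frame \<Omega> G (ball 0 \<rho>) (\<lambda>X. \<gamma> X 1) (\<lambda>X. Blinfun (\<tau> X 1)) Q"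
    "\<And>X t. linear (\<tau> X t)"
    "\<And>X v. X \<in> ball 0 \<rho> \<Longrightarrow> transport_solution {0..1} (\<gamma> X) (V X) (\<lambda>t. \<tau> X t v)"
    "\<And>X v. X \<in> ball 0 \<rho> \<Longrightarrow> \<gamma> X 0 = x0 \<and> V X 0 = X \<and> \<tau> X 0 v = v"
    "\<And>X s. X \<in> ball 0 \<rho> \<Longrightarrow> s \<in> {0..1} \<Longrightarrow> \<gamma> (s *\<^sub>R X) 1 = \<gamma> X s"
proof -
  obtain \<epsilon> r u where \<epsilon>: "0 < \<epsilon>" and r: "0 < r"
    and sol: "\<And>W v. norm W < r \<Longrightarrow> norm v < r \<Longrightarrow> transport_solution {0..1}
       (\<lambda>t. fst (u (W, v) t)) (\<lambda>t. \<epsilon> *\<^sub>R fst (snd (u (W, v) t))) (\<lambda>t. snd (snd (u (W, v) t)))"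
    and init: "\<And>W v. norm W < r \<Longrightarrow> norm v < r \<Longrightarrow> u (W, v) 0 = (x0, W, v)"
    and smooth: "\<And>t. smooth_on (ball 0 r \<times> ball 0 r) (\<lambda>\<xi>. u \<xi> t)"
    by (rule transport_flow[OF x0]) (rule that)
  \<comment> \<open>The flow accepts only initial vectors of norm below \<open>r\<close>, so the
    basis is shrunk by \<open>\<kappa>\<close> before it is transported; \<open>\<tau>\<close>
    undoes the scaling.\<close>
  define \<kappa> where "\<kappa> = r / 2"
  have \<kappa>: "\<kappa> > 0" "\<And>b::'e. b \<in> Basis \<Longrightarrow> norm (\<kappa> *\<^sub>R b) < r" using r by (auto simp: \<kappa>_def)
  \<comment> \<open>Initial velocity \<open>X\<close> corresponds to the flow parameter X /
    \<open>\<epsilon>\<close>, which has to stay below \<open>r\<close>.\<close>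
  define R where "R = \<epsilon> * r"
  have R: "R > 0" using \<epsilon> r by (simp add: R_def)
  have small: "norm ((1 / \<epsilon>) *\<^sub>R X) < r" if "X \<in> ball 0 R" for X :: 'e
    using that \<epsilon> by (simp add: R_def divide_less_eq mult.commute)
  define \<gamma> where "\<gamma> X t = fst (u ((1 / \<epsilon>) *\<^sub>R X, 0) t)" for X t
  define V where "V X t = \<epsilon> *\<^sub>R fst (snd (u ((1 / \<epsilon>) *\<^sub>R X, 0) t))" for X t
  define A where "A X b t = snd (snd (u ((1 / \<epsilon>) *\<^sub>R X, \<kappa> *\<^sub>R b) t))" for X b t
  \<comment> \<open>Combining the transported basis vectors makes transport linear in
    \<open>v\<close> by construction and defines it for every \<open>v\<close>, however
    large.\<close>
  define \<tau> where "\<tau> X t v = (\<Sum>b\<in>Basis. ((v \<bullet> b) / \<kappa>) *\<^sub>R A X b t)" for X t v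
  have lin: "linear (\<tau> X t)" for X t
  proof
    show "\<tau> X t (v + w) = \<tau> X t v + \<tau> X t w" for v w
      by (simp add: \<tau>_def inner_add_left add_divide_distrib scaleR_add_left sum.distrib)
    show "\<tau> X t (c *\<^sub>R v) = c *\<^sub>R \<tau> X t v" for c v
      by (simp add: \<tau>_def scaleR_sum_right)
  qed
  have sol0: "transport_solution {0..1} (\<gamma> X) (V X) (\<lambda>t. snd (snd (u ((1 / \<epsilon>) *\<^sub>R X, 0) t)))" if "X \<in> ball 0 R" for X
    using sol[OF small[OF that], of 0] r by (simp add: \<gamma>_def[abs_def] V_def[abs_def])
  have init\<gamma>: "\<gamma> X 0 = x0" "V X 0 = X" if "X \<in> ball 0 R" for X
    using init[OF small[OF that], of 0] r \<epsilon> by (simp_all add: \<gamma>_def V_def)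
  \<comment> \<open>Changing the initial parallel vector does not change the geodesic: by uniqueness
    the first two components agree with those of the solution started with parallel vector
    0.\<close>
  have solA: "transport_solution {0..1} (\<gamma> X) (V X) (A X b)" if X: "X \<in> ball 0 R" and b: "b \<in> Basis" for X b
  proof -
    let ?x = "\<lambda>t. fst (u ((1 / \<epsilon>) *\<^sub>R X, \<kappa> *\<^sub>R b) t)" and ?y = "\<lambda>t. \<epsilon> *\<^sub>R fst (snd (u ((1 / \<epsilon>) *\<^sub>R X, \<kappa> *\<^sub>R b) t))"
    have s: "transport_solution {0..1} ?x ?y (A X b)" using sol[OF small[OF X] \<kappa>(2)[OF b]] by (simp add: A_def[abs_def])
    have i: "?x 0 = \<gamma> X 0" "?y 0 = V X 0" using init[OF small[OF X] \<kappa>(2)[OF b]] init\<gamma>[OF X] \<epsilon> by simp_all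
    have "\<gamma> X t = ?x t" "V X t = ?y t" if "t \<in> {0..1}" for t
      using transport_solution_unique[OF transport_solution_velocity[OF s] transport_solution_velocity[OF sol0[OF X]] convex_real_interval(5)
          _ i i(2) that] by simp_all
    then show ?thesis using transport_solution_cong[OF s] by simp
  qed
  have sol\<tau>: "transport_solution {0..1} (\<gamma> X) (V X) (\<lambda>t. \<tau> X t v)" if "X \<in> ball 0 R" for X v
    unfolding \<tau>_def by (rule transport_solution_sum[OF solA[OF that] sol0[OF that]])
  have init\<tau>: "\<tau> X 0 v = v" if X: "X \<in> ball 0 R" for X v
  proof -
    have "\<tau> X 0 v = (\<Sum>b\<in>Basis. ((v \<bullet> b) / \<kappa>) *\<^sub>R \<kappa> *\<^sub>R b)"
      unfolding \<tau>_def A_def by (intro sum.cong refl) (simp add: init[OF small[OF X] \<kappa>(2)])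
    then show ?thesis using \<kappa>(1) by (simp add: euclidean_representation)
  qed
  have star: "s *\<^sub>R X \<in> ball 0 R" if "X \<in> ball 0 R" "s \<in> {0..1}" for s and X :: 'e
    using that mult_left_le_one_le[of "norm X" s] by auto
  have rescale: "\<gamma> (s *\<^sub>R X) 1 = \<gamma> X s" "V (s *\<^sub>R X) 1 = s *\<^sub>R V X s" "\<tau> (s *\<^sub>R X) 1 v = \<tau> X s v"
    if X: "X \<in> ball 0 R" and s: "s \<in> {0..1}" for X s v
    using transport_solution_unique[OF sol\<tau>[OF star[OF X s], of v] transport_solution_rescale[OF sol\<tau>[OF X, of v] s] convex_real_interval(5), of 0 1]
    by (simp_all add: init\<gamma>[OF X] init\<gamma>[OF star[OF X s]] init\<tau>[OF X] init\<tau>[OF star[OF X s]])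
  have velocity: "V X t = \<tau> X t X" if X: "X \<in> ball 0 R" and t: "t \<in> {0..1}" for X t
    using transport_solution_unique(3)[OF transport_solution_velocity[OF sol0[OF X]] sol\<tau>[OF X, of X] convex_real_interval(5) _ _ _ _ t, of 0]
    by (simp add: init\<gamma>[OF X] init\<tau>[OF X])
  define P where "P X = Blinfun (\<tau> X 1)" for X
  have P: "P X v = \<tau> X 1 v" for X v unfolding P_def by (simp add: Blinfun_apply_linear[OF lin])
  have slice: "smooth_on (ball 0 R) (\<lambda>X. u ((1 / \<epsilon>) *\<^sub>R X, w) t)" if "norm w < r" for w t
    by (rule smooth_on_compose[OF open_ball open_Times[OF open_ball open_ball] _ smooth])
      (use small that in \<open>auto intro!: smooth_on_Pair smooth_on_const smooth_on_bounded_linear[OF _ bounded_linear_scaleR_right] smooth_on_ident\<close>)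
  have smooth\<gamma>: "smooth_on (ball 0 R) (\<lambda>X. \<gamma> X 1)"
    unfolding \<gamma>_def by (rule smooth_on_bounded_linear[OF open_ball bounded_linear_fst slice]) (simp add: r)
  have smoothP: "smooth_on (ball 0 R) P"
    unfolding P_def[abs_def]
  proof (rule smooth_on_Blinfun[OF open_ball lin])
    fix b
    show "smooth_on (ball 0 R) (\<lambda>X. \<tau> X 1 b)"
      unfolding \<tau>_def A_def
      by (intro smooth_on_sum open_ball smooth_on_bounded_linear[OF open_ball bounded_linear_scaleR_right]
        smooth_on_bounded_linear[OF open_ball bounded_linear_compose[OF bounded_linear_snd bounded_linear_snd]] slice \<kappa>)
  qed
  have P0: "P 0 v = v" for v
    using rescale(3)[of 0 0 v] init\<tau>[of 0 v] R by (simp add: P)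
  have ray: "((\<lambda>s. f (s *\<^sub>R X)) has_vector_derivative frechet_derivative f (at (s *\<^sub>R X)) X) (at s within {0..1})"
    if f: "smooth_on (ball 0 R) f" and X: "X \<in> ball 0 R" and s: "s \<in> {0..1}" for f :: "'e \<Rightarrow> 'b::real_normed_vector" and X s
    using smooth_on_vector_derivative[OF f, of 0 s X "{0..1}"] star[OF X s] by simp
  have unique: "a = b" if "(f has_vector_derivative a) (at s within {0..1})" "(g has_vector_derivative b) (at s within {0..1})"
    "s \<in> {0..1}" "\<And>s. s \<in> {0..1} \<Longrightarrow> f s = g s" for f g :: "real \<Rightarrow> 'e" and a b and s :: real
  proof -
    have "(f has_vector_derivative b) (at s within {0..1})"
      by (rule has_vector_derivative_transform[OF that(3,4,2)])
    then show ?thesis using vector_derivative_unique_within_closed_interval[of 0 1 s f a b] that(1,3) by simp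
  qed
  have DE: "frechet_derivative (\<lambda>X. \<gamma> X 1) (at (s *\<^sub>R X)) X = P (s *\<^sub>R X) X" if X: "X \<in> ball 0 R" and s: "s \<in> {0..1}" for X s
    using unique[OF ray[OF smooth\<gamma> X s] transport_solutionD(2)[OF sol0[OF X] s] s rescale(1)[OF X]]
    by (simp add: rescale(3)[OF X s] P velocity[OF X s])
  have DP: "frechet_derivative P (at (s *\<^sub>R X)) X v = - G (\<gamma> (s *\<^sub>R X) 1) (P (s *\<^sub>R X) X) (P (s *\<^sub>R X) v)"
    if X: "X \<in> ball 0 R" and s: "s \<in> {0..1}" for X s v
  proof -
    have "((\<lambda>s. P (s *\<^sub>R X) v) has_vector_derivative frechet_derivative P (at (s *\<^sub>R X)) X v) (at s within {0..1})"
      by (rule bounded_linear.has_vector_derivative[OF blinfun.bounded_linear_left ray[OF smoothP X s]])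
    moreover have "P (s *\<^sub>R X) v = \<tau> X s v" if "s \<in> {0..1}" for s by (simp only: P rescale(3)[OF X that])
    ultimately have "frechet_derivative P (at (s *\<^sub>R X)) X v = - G (\<gamma> X s) (V X s) (\<tau> X s v)"
      by (rule unique[OF _ transport_solutionD(4)[OF sol\<tau>[OF X, of v] s] s])
    then show ?thesis by (simp only: rescale[OF X s] P velocity[OF X s])
  qed
  \<comment> \<open>\<open>P 0\<close> is the identity, so on a smaller ball \<open>P X\<close>
    stays within 1/2 of it and is inverted with a uniform bound.\<close>
  have "continuous_on (ball 0 R) P" by (rule smooth_on_continuous[OF smoothP])
  then obtain d where d: "d > 0" "\<And>X. X \<in> ball 0 R \<Longrightarrow> dist X 0 < d \<Longrightarrow> dist (P X) (P 0) < 1/2"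
    unfolding continuous_on_iff using R by (metis centre_in_ball half_gt_zero zero_less_one)
  define \<rho> where "\<rho> = min R d"
  have \<rho>: "0 < \<rho>" "ball 0 \<rho> \<subseteq> ball (0::'e) R" using R d by (auto simp: \<rho>_def)
  have "\<exists>B. (\<forall>v. blinfun_apply B (P X v) = v) \<and> (\<forall>v. P X (B v) = v) \<and> norm B \<le> 2" if X: "X \<in> ball 0 \<rho>" for X
  proof -
    have "P 0 = id_blinfun" by (rule blinfun_eqI) (simp add: P0)
    then have "norm (id_blinfun - P X) \<le> 1/2"
      using d(2)[of X] X by (auto simp: \<rho>_def dist_norm norm_minus_commute)
    then obtain B where "\<And>v. blinfun_apply B (v - (id_blinfun - P X) v) = v"
      "\<And>v. blinfun_apply B v - (id_blinfun - P X) (B v) = v" "norm B \<le> 2"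
      by (rule blinfun_inverse_near_id) (rule that)
    then show ?thesis by (intro exI[of _ B]) (simp add: blinfun.diff_left)
  qed
  then obtain Q where Q: "\<And>X v. X \<in> ball 0 \<rho> \<Longrightarrow> blinfun_apply (Q X) (P X v) = v"
    "\<And>X v. X \<in> ball 0 \<rho> \<Longrightarrow> P X (Q X v) = v" "\<And>X. X \<in> ball 0 \<rho> \<Longrightarrow> norm (Q X) \<le> 2" by metis
  have smoothQ: "smooth_on (ball 0 \<rho>) Q"
    unfolding smooth_on_def
    by (intro allI higher_differentiable_on_blinfun_inverse[OF open_ball Q] smooth_onD[OF smooth_on_subset[OF smoothP \<rho>(2)]])
  \<comment> \<open>The derivatives at the origin are obtained on vectors inside the ball and
    extended to all vectors by homogeneity.\<close>
  have scale_small: "\<exists>c>0. c *\<^sub>R v \<in> ball 0 R" for v :: 'e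
    using R by (intro exI[of _ "R / (2 * (norm v + 1))"]) (auto simp: field_simps add_pos_nonneg intro: add_strict_increasing2)
  have D0: "0 \<in> ball (0::'e) R" using R by simp
  show thesis
  proof
    show "0 < \<rho>" by (rule \<rho>)
    show "linear (\<tau> X t)" for X t by (rule lin)
    fix X v :: 'e assume X: "X \<in> ball 0 \<rho>"
    then have XR: "X \<in> ball 0 R" using \<rho>(2) by blast
    show "transport_solution {0..1} (\<gamma> X) (V X) (\<lambda>t. \<tau> X t v)" by (rule sol\<tau>[OF XR])
    show "\<gamma> X 0 = x0 \<and> V X 0 = X \<and> \<tau> X 0 v = v" by (simp add: init\<gamma>[OF XR] init\<tau>[OF XR])
    show "\<gamma> (s *\<^sub>R X) 1 = \<gamma> X s" if "s \<in> {0..1}" for s by (rule rescale(1)[OF XR that])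
  next
    show "radial_frame \<Omega> G (ball 0 \<rho>) (\<lambda>X. \<gamma> X 1) (\<lambda>X. Blinfun (\<tau> X 1)) Q"
      unfolding P_def[symmetric]
    proof
      show "open (ball (0::'e) \<rho>)" "0 \<in> ball (0::'e) \<rho>" using \<rho> by auto
      show "smooth_on (ball 0 \<rho>) (\<lambda>X. \<gamma> X 1)" "smooth_on (ball 0 \<rho>) P"
        by (rule smooth_on_subset[OF smooth\<gamma> \<rho>(2)], rule smooth_on_subset[OF smoothP \<rho>(2)])
      show "(\<lambda>X. \<gamma> X 1) ` ball 0 \<rho> \<subseteq> \<Omega>"
        using transport_solutionD(1)[OF sol0, of _ 1] \<rho>(2) by auto
      show "smooth_on (ball 0 \<rho>) Q" by (rule smoothQ)
      show "Q X (P X v) = v" "P X (Q X v) = v" if "X \<in> ball 0 \<rho>" for X v using Q(1,2) that by auto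
      show "P 0 v = v" for v by (rule P0)
      show "frechet_derivative (\<lambda>X. \<gamma> X 1) (at 0) v = v" for v
      proof -
        obtain c where c: "c > 0" "c *\<^sub>R v \<in> ball 0 R" using scale_small by blast
        have "frechet_derivative (\<lambda>X. \<gamma> X 1) (at 0) (c *\<^sub>R v) = c *\<^sub>R v"
          using DE[OF c(2), of 0] by (simp add: P0)
        then show ?thesis using c(1) linear_scale[OF smooth_on_linear_derivative[OF smooth\<gamma> D0]] by simp
      qed
      show "frechet_derivative P (at 0) X v = - G (\<gamma> 0 1) X v" for X v
      proof -
        obtain c where c: "c > 0" "c *\<^sub>R X \<in> ball 0 R" using scale_small by blast
        have "\<gamma> 0 1 \<in> \<Omega>" using transport_solutionD(1)[OF sol0[OF D0], of 1] by simp
        then have "c *\<^sub>R blinfun_apply (frechet_derivative P (at 0) X) v = c *\<^sub>R (- G (\<gamma> 0 1) X v)"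
          using DP[OF c(2), of 0 v] linear_scale[OF smooth_on_linear_derivative[OF smoothP D0]]
            linear_scale[OF linear_left] by (simp add: P0 blinfun.scaleR_left)
        then show ?thesis using c(1) by (simp only: scaleR_cancel_left) simp
      qed
      fix X :: 'e assume "X \<in> ball 0 \<rho>"
      then have XR: "X \<in> ball 0 R" using \<rho>(2) by blast
      show "frechet_derivative (\<lambda>X. \<gamma> X 1) (at X) X = P X X" using DE[OF XR, of 1] by simp
      show "frechet_derivative P (at X) X v = - G (\<gamma> X 1) (P X X) (P X v)" for v using DP[OF XR, of 1 v] by simp
    qed
  qed
qed

end

section \<open>Connections in a chart\<close>

text \<open>Treating the direction as a one element argument list makes this a case of the product
  rule for multilinear families.\<close>

lemma has_derivative_derivative_pair:
  fixes f :: "'a::euclidean_space \<Rightarrow> 'b::real_normed_vector"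
  assumes O: "open O'" "smooth_on O' f" and x: "x \<in> O'"
  shows "((\<lambda>z. frechet_derivative f (at (fst z)) (snd z)) has_derivative
    (\<lambda>h. frechet_derivative (\<lambda>x. frechet_derivative f (at x) y) (at x) (fst h) + frechet_derivative f (at x) (snd h))) (at (x, y))"
proof -
  let ?S = "O' \<times> (UNIV :: 'a set)"
  have openS: "open ?S" and xy: "(x, y) \<in> ?S" using O(1) x by (auto intro: open_Times)
  have d: "((\<lambda>z. frechet_derivative f (at (fst z)) v) has_derivative
     (\<lambda>h. frechet_derivative (\<lambda>x. frechet_derivative f (at x) v) (at x) (fst h))) (at (x, y))" for v
    by (rule has_derivative_compose[of fst fst "(x, y)" UNIV "\<lambda>x. frechet_derivative f (at x) v"])
      (auto intro!: has_derivative_fst smooth_on_has_derivative[OF smooth_on_derivative[OF O(2)] x] has_derivative_ident)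
  have "((\<lambda>z. (\<lambda>z vs. frechet_derivative f (at (fst z)) (hd vs)) z (map (\<lambda>X. X z) [snd])) has_derivative
    (\<lambda>h. frechet_derivative (\<lambda>z. (\<lambda>z vs. frechet_derivative f (at (fst z)) (hd vs)) z (map (\<lambda>X. X (x, y)) [snd])) (at (x, y)) h +
      (\<Sum>i<length [snd :: 'a \<times> 'a \<Rightarrow> 'a]. (\<lambda>z vs. frechet_derivative f (at (fst z)) (hd vs)) (x, y)
        ((map (\<lambda>X. X (x, y)) [snd])[i := frechet_derivative ([snd] ! i) (at (x, y)) h])))) (at (x, y))"
  proof (rule has_derivative_multilinear[OF openS xy])
    show "multilinear (length [snd :: 'a \<times> 'a \<Rightarrow> 'a]) (\<lambda>vs. frechet_derivative f (at (fst z)) (hd vs))" if "z \<in> ?S" for z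
    proof -
      have "linear (frechet_derivative f (at (fst z)))"
        by (rule smooth_on_linear_derivative[OF O(2)]) (use that in auto)
      then show ?thesis unfolding multilinear_def by (auto simp: length_Suc_conv)
    qed
    show "(\<lambda>z. frechet_derivative f (at (fst z)) (hd vs)) differentiable (at (x, y))" for vs
      using d differentiable_def by blast
    show "X differentiable (at (x, y))" if "X \<in> set [snd]" for X :: "'a \<times> 'a \<Rightarrow> 'a"
      using that has_derivative_snd[OF has_derivative_ident] differentiable_def by fastforce
  qed
  then show ?thesis
    by (simp add: frechet_derivative_eq[OF d] frechet_derivative_eq[OF has_derivative_snd[OF has_derivative_ident]])
qed

definition chart_change :: "('m, 'e::euclidean_space) chart \<Rightarrow> ('m, 'e) chart \<Rightarrow> 'm \<Rightarrow> 'e \<Rightarrow> 'e" where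
  "chart_change c d q v = frechet_derivative (chart_map d \<circ> chart_inv c) (at (chart_map c q)) v"

lemma components_eq: "components M c q v = chart_change (chart_at M q) c q v"
  by (simp add: components_def chart_change_def)

section \<open>Chart changes on tangent vectors\<close>

context smooth_manifold
begin

lemma chart_inv_map: "c \<in> atlas M \<Longrightarrow> q \<in> chart_dom c \<Longrightarrow> chart_inv c (chart_map c q) = q"
  by (rule homeomorphism_apply1[OF chart_homeomorphism])

lemma chart_map_inv: "c \<in> atlas M \<Longrightarrow> x \<in> chart_map c ` chart_dom c \<Longrightarrow> chart_map c (chart_inv c x) = x"
  by (rule homeomorphism_apply2[OF chart_homeomorphism])

lemma open_chart_map_image:
  assumes c: "c \<in> atlas M" and V: "open V"
  shows "open (chart_map c ` (V \<inter> chart_dom c))"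
proof -
  have "openin (top_of_set (chart_map c ` chart_dom c)) (chart_map c ` (V \<inter> chart_dom c))"
    by (rule homeomorphism_imp_open_map[OF chart_homeomorphism[OF c]])
      (simp add: Int_commute[of V] openin_open_Int V)
  then show ?thesis using open_chart_image[OF c] by (simp add: openin_open_eq)
qed

lemma open_overlap:
  assumes "c \<in> atlas M" "d \<in> atlas M" shows "open (chart_map c ` (chart_dom c \<inter> chart_dom d))"
  using open_chart_map_image[OF assms(1) open_chart_dom[OF assms(2)]] by (simp add: Int_commute)

lemma chart_change_linear:
  assumes "c \<in> atlas M" "d \<in> atlas M" "q \<in> chart_dom c" "q \<in> chart_dom d"
  shows "linear (chart_change c d q)"
  unfolding chart_change_def[abs_def]
  by (rule smooth_on_linear_derivative[OF smooth_transition[OF assms(1,2)]]) (use assms in auto)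

lemma transition_differentiable:
  assumes "c \<in> atlas M" "d \<in> atlas M" "q \<in> chart_dom c" "q \<in> chart_dom d"
  shows "(chart_map d \<circ> chart_inv c) differentiable (at (chart_map c q))"
  by (rule smooth_on_differentiable[OF smooth_transition[OF assms(1,2)]]) (use assms in auto)

lemma chart_change_cocycle:
  assumes c: "c \<in> atlas M" "q \<in> chart_dom c" and d: "d \<in> atlas M" "q \<in> chart_dom d" and e: "e \<in> atlas M" "q \<in> chart_dom e"
  shows "chart_change d e q (chart_change c d q v) = chart_change c e q v"
proof -
  let ?cd = "chart_map d \<circ> chart_inv c" and ?de = "chart_map e \<circ> chart_inv d" and ?W = "chart_map c ` (chart_dom d \<inter> chart_dom c)"
  have x: "chart_map c q \<in> ?W" using c d by auto
  have "frechet_derivative (chart_map e \<circ> chart_inv c) (at (chart_map c q)) =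
      frechet_derivative (\<lambda>x. ?de (?cd x)) (at (chart_map c q))"
    by (rule frechet_derivative_cong_open[OF open_chart_map_image[OF c(1) open_chart_dom[OF d(1)]] x])
      (auto simp: chart_inv_map c d)
  moreover have "frechet_derivative (\<lambda>x. ?de (?cd x)) (at (chart_map c q)) v =
      frechet_derivative ?de (at (?cd (chart_map c q))) (frechet_derivative ?cd (at (chart_map c q)) v)"
    using transition_differentiable[OF c(1) d(1) c(2) d(2)] transition_differentiable[OF d(1) e(1) d(2) e(2)]
    by (intro frechet_derivative_compose_apply) (simp_all add: chart_inv_map c o_def)
  ultimately show ?thesis by (simp add: chart_change_def chart_inv_map c)
qed

lemma chart_change_self:
  assumes c: "c \<in> atlas M" "q \<in> chart_dom c" shows "chart_change c c q v = v"
proof -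
  have "frechet_derivative (chart_map c \<circ> chart_inv c) (at (chart_map c q)) = frechet_derivative (\<lambda>x. x) (at (chart_map c q))"
    by (rule frechet_derivative_cong_open[OF open_chart_image[OF c(1)]]) (use c in \<open>auto simp: chart_map_inv\<close>)
  then show ?thesis by (simp add: chart_change_def frechet_derivative_eq[OF has_derivative_ident])
qed

lemma chart_change_inverse:
  assumes "c \<in> atlas M" "q \<in> chart_dom c" "d \<in> atlas M" "q \<in> chart_dom d"
  shows "chart_change d c q (chart_change c d q v) = v"
  using chart_change_cocycle[OF assms(1,2,3,4,1,2)] chart_change_self[OF assms(1,2)] by simp

lemma components_linear: "c \<in> atlas M \<Longrightarrow> q \<in> chart_dom c \<Longrightarrow> linear (components M c q)"
  using chart_change_linear[OF chart_at_atlas _ chart_at_dom] by (simp add: components_eq[abs_def])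

lemma components_self: "components M (chart_at M q) q v = v"
  by (simp add: components_eq chart_change_self chart_at_atlas chart_at_dom)

lemma components_change:
  assumes "c \<in> atlas M" "q \<in> chart_dom c" "d \<in> atlas M" "q \<in> chart_dom d"
  shows "components M d q v = chart_change c d q (components M c q v)"
  by (simp add: components_eq chart_change_cocycle assms chart_at_atlas chart_at_dom)

lemma components_chart_change:
  assumes "c \<in> atlas M" "q \<in> chart_dom c"
  shows "components M c q (chart_change c (chart_at M q) q v) = v"
    "chart_change c (chart_at M q) q (components M c q v) = v"
  by (simp_all add: components_eq chart_change_inverse assms chart_at_atlas chart_at_dom)

lemma local_rep_map: "c \<in> atlas M \<Longrightarrow> q \<in> chart_dom c \<Longrightarrow> local_rep M c X (chart_map c q) = components M c q (X q)"
  by (simp add: local_rep_def chart_inv_map)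

lemma smooth_on_local_rep:
  assumes "smooth_field_on M U X" "c \<in> atlas M" "U \<subseteq> chart_dom c"
  shows "smooth_on (chart_map c ` U) (local_rep M c X)"
proof -
  have "U \<inter> chart_dom c = U" using assms(3) by auto
  then show ?thesis using assms(1,2) unfolding smooth_field_on_def by force
qed

lemma smooth_on_transition:
  assumes c: "c \<in> atlas M" and d: "d \<in> atlas M" and U: "U \<subseteq> chart_dom c"
  shows "smooth_on (chart_map d ` (U \<inter> chart_dom d)) (\<lambda>x. chart_map c (chart_inv d x))"
  by (rule smooth_on_subset[OF smooth_transition[OF d c, unfolded o_def]]) (use U in auto)

text \<open>Smoothness in one chart covering \<open>U\<close> passes to every chart
  \<open>d\<close>: the representative in \<open>d\<close> is the derivative of the transition map
  applied to the one in \<open>c\<close>.\<close>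

lemma smooth_field_onI:
  assumes U: "open U" "U \<subseteq> chart_dom c" and c: "c \<in> atlas M" and X: "smooth_on (chart_map c ` U) (local_rep M c X)"
  shows "smooth_field_on M U X"
  unfolding smooth_field_on_def
proof
  fix d assume d: "d \<in> atlas M"
  let ?W = "chart_map d ` (U \<inter> chart_dom d)" and ?g = "\<lambda>x. chart_map c (chart_inv d x)"
  note W = open_chart_map_image[OF d U(1)]
  have openU: "open (chart_map c ` U)" using open_chart_map_image[OF c U(1)] U(2) by (simp add: Int_absorb2)
  note g = smooth_on_transition[OF c d U(2)]
  have gW: "?g ` ?W \<subseteq> chart_map c ` U" "?g ` ?W \<subseteq> chart_map c ` (chart_dom c \<inter> chart_dom d)"
    using U(2) by (auto simp: chart_inv_map[OF d])
  have "smooth_on ?W (\<lambda>x. frechet_derivative (chart_map d \<circ> chart_inv c) (at (?g x)) (local_rep M c X (?g x)))"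
    by (rule smooth_on_derivative_apply[OF W open_overlap[OF c d] smooth_transition[OF c d] g gW(2)
      smooth_on_compose[OF W openU gW(1) X g]])
  then show "smooth_on ?W (local_rep M d X)"
  proof (rule smooth_on_cong[OF W, rotated])
    fix x assume "x \<in> ?W"
    then obtain q where q: "q \<in> U" "q \<in> chart_dom d" "x = chart_map d q" by auto
    show "frechet_derivative (chart_map d \<circ> chart_inv c) (at (?g x)) (local_rep M c X (?g x)) = local_rep M d X x"
      using q U(2) components_change[OF c _ d, of q] by (auto simp: chart_inv_map[OF d] local_rep_map[OF c] local_rep_map[OF d] chart_change_def)
  qed
qed

lemma smooth_fun_onI:
  assumes U: "open U" "U \<subseteq> chart_dom c" and c: "c \<in> atlas M" and f: "smooth_on (chart_map c ` U) (f \<circ> chart_inv c)"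
  shows "smooth_fun_on M U f"
  unfolding smooth_fun_on_def
proof
  fix d assume d: "d \<in> atlas M"
  let ?W = "chart_map d ` (U \<inter> chart_dom d)" and ?g = "\<lambda>x. chart_map c (chart_inv d x)"
  note W = open_chart_map_image[OF d U(1)]
  have openU: "open (chart_map c ` U)" using open_chart_map_image[OF c U(1)] U(2) by (simp add: Int_absorb2)
  have gW: "?g ` ?W \<subseteq> chart_map c ` U" using U(2) by (auto simp: chart_inv_map[OF d])
  have "smooth_on ?W (\<lambda>x. (f \<circ> chart_inv c) (?g x))"
    by (rule smooth_on_compose[OF W openU gW f smooth_on_transition[OF c d U(2)]])
  then show "smooth_on ?W (f \<circ> chart_inv d)"
    by (rule smooth_on_cong[OF W, rotated]) (use U(2) in \<open>auto simp: chart_inv_map[OF d] chart_inv_map[OF c]\<close>)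
qed

lemma coordinate_field_eq:
  "q \<in> chart_dom (chart_at M p) \<Longrightarrow> coordinate_field M p v q = chart_change (chart_at M p) (chart_at M q) q v"
  by (simp add: coordinate_field_def chart_change_def)

lemma components_coordinate_field:
  "q \<in> chart_dom (chart_at M p) \<Longrightarrow> components M (chart_at M p) q (coordinate_field M p v q) = v"
  by (simp add: coordinate_field_eq components_chart_change chart_at_atlas)

lemma coordinate_field_components:
  "q \<in> chart_dom (chart_at M p) \<Longrightarrow> coordinate_field M p (components M (chart_at M p) q v) q = v"
  by (simp add: coordinate_field_eq components_chart_change chart_at_atlas)

lemma linear_coordinate_field: "linear (\<lambda>v. coordinate_field M p v q)"
proof (cases "q \<in> chart_dom (chart_at M p)")
  case True
  then show ?thesis
    using chart_change_linear[OF chart_at_atlas chart_at_atlas True chart_at_dom] by (simp add: coordinate_field_eq)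
next
  case False
  then show ?thesis by (simp add: coordinate_field_def linear_zero)
qed

end

section \<open>The connection in the chart chosen at \<open>p\<close>\<close>

locale based_connection = affine_connection M D
  for M :: "('m::{t2_space, second_countable_topology}, 'e::euclidean_space) manifold" and D :: "('m, 'e) connection" +
  fixes p :: 'm
begin

abbreviation dom :: "'m set" where "dom \<equiv> chart_dom (chart_at M p)"
abbreviation \<phi> :: "'m \<Rightarrow> 'e" where "\<phi> \<equiv> chart_map (chart_at M p)"
abbreviation rep :: "('m \<Rightarrow> 'e) \<Rightarrow> 'e \<Rightarrow> 'e" where "rep \<equiv> local_rep M (chart_at M p)"
abbreviation comp_at :: "'m \<Rightarrow> 'e \<Rightarrow> 'e" where "comp_at \<equiv> components M (chart_at M p)"
abbreviation frame :: "'e \<Rightarrow> 'm \<Rightarrow> 'e" where "frame \<equiv> coordinate_field M p"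

lemmas inv_map = chart_inv_map[OF chart_at_atlas]
lemmas map_inv = chart_map_inv[OF chart_at_atlas]
lemmas rep_map = local_rep_map[OF chart_at_atlas]
lemmas comp_linear = components_linear[OF chart_at_atlas]
lemmas open_dom = open_chart_dom[OF chart_at_atlas]

text \<open>Christoffel symbols of the one chart at \<open>p\<close>, at all points of its domain;
  \<open>christoffel\<close>, in contrast, uses a chart that changes with the point.\<close>

definition coefficients :: "'e \<Rightarrow> 'e \<Rightarrow> 'e \<Rightarrow> 'e" where
  "coefficients x u v = rep (D (frame u) (frame v)) x"

lemma open_image:
  assumes "open U" "U \<subseteq> dom" shows "open (\<phi> ` U)"
  using open_chart_map_image[OF chart_at_atlas assms(1), of p] assms(2) by (simp add: Int_absorb2)

lemma smooth_field_rep: "smooth_field_on M U X \<Longrightarrow> U \<subseteq> dom \<Longrightarrow> smooth_on (\<phi> ` U) (rep X)"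
  by (rule smooth_on_local_rep[OF _ chart_at_atlas])

lemma smooth_fieldI: "open U \<Longrightarrow> U \<subseteq> dom \<Longrightarrow> smooth_on (\<phi> ` U) (rep X) \<Longrightarrow> smooth_field_on M U X"
  by (rule smooth_field_onI[OF _ _ chart_at_atlas])

lemma rep_frame: "x \<in> \<phi> ` dom \<Longrightarrow> rep (frame v) x = v"
  by (auto simp: rep_map components_coordinate_field)

lemma smooth_frame:
  assumes "open U" "U \<subseteq> dom" shows "smooth_field_on M U (frame v)"
proof (rule smooth_fieldI[OF assms])
  have "smooth_on (\<phi> ` U) (\<lambda>x. v)" by (rule smooth_on_const[OF open_image[OF assms]])
  then show "smooth_on (\<phi> ` U) (rep (frame v))"
  proof (rule smooth_on_cong[OF open_image[OF assms], rotated])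
    fix x assume "x \<in> \<phi> ` U"
    then show "v = rep (frame v) x" using rep_frame[of x v] assms(2) by auto
  qed
qed

lemma smooth_component:
  assumes U: "open U" "U \<subseteq> dom" and h: "smooth_on (\<phi> ` U) h"
  shows "smooth_fun_on M U (\<lambda>r. h (\<phi> r) \<bullet> b)"
proof (rule smooth_fun_onI[OF U chart_at_atlas])
  have "smooth_on (\<phi> ` U) (\<lambda>x. h x \<bullet> b)"
    by (rule smooth_on_bounded_linear[OF open_image[OF U] bounded_linear_inner_left h])
  then show "smooth_on (\<phi> ` U) ((\<lambda>r. h (\<phi> r) \<bullet> b) \<circ> chart_inv (chart_at M p))"
    by (rule smooth_on_cong[OF open_image[OF U], rotated]) (use U(2) in \<open>auto simp: inv_map\<close>)
qed

lemma smooth_scaled_frame: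
  assumes U: "open U" "U \<subseteq> dom" and h: "smooth_on (\<phi> ` U) h"
  shows "smooth_field_on M U (\<lambda>r. (h (\<phi> r) \<bullet> b) *\<^sub>R frame v r)"
proof (rule smooth_fieldI[OF U])
  have "smooth_on (\<phi> ` U) (\<lambda>x. (h x \<bullet> b) *\<^sub>R v)"
    by (intro smooth_on_scaleR smooth_on_const open_image[OF U] smooth_on_bounded_linear[OF open_image[OF U] bounded_linear_inner_left h])
  then show "smooth_on (\<phi> ` U) (rep (\<lambda>r. (h (\<phi> r) \<bullet> b) *\<^sub>R frame v r))"
    by (rule smooth_on_cong[OF open_image[OF U], rotated])
      (use U(2) in \<open>auto simp: rep_map linear_scale[OF comp_linear] components_coordinate_field\<close>)
qed

lemma smooth_field_sum:
  assumes U: "open U" "U \<subseteq> dom" and X: "\<And>b. b \<in> B \<Longrightarrow> smooth_field_on M U (X b)"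
  shows "smooth_field_on M U (\<lambda>r. \<Sum>b\<in>B. X b r)"
proof (rule smooth_fieldI[OF U])
  have "smooth_on (\<phi> ` U) (\<lambda>x. \<Sum>b\<in>B. rep (X b) x)"
    by (intro smooth_on_sum open_image[OF U] smooth_field_rep X U)
  then show "smooth_on (\<phi> ` U) (rep (\<lambda>r. \<Sum>b\<in>B. X b r))"
    by (rule smooth_on_cong[OF open_image[OF U], rotated])
      (use U(2) in \<open>auto simp: rep_map linear_sum[OF comp_linear]\<close>)
qed

lemma frame_expansion:
  assumes "q \<in> dom" shows "X q = (\<Sum>b\<in>Basis. (rep X (\<phi> q) \<bullet> b) *\<^sub>R frame b q)"
  using linear_basis_expansion[OF linear_coordinate_field[of p q], of "rep X (\<phi> q)"] assms
  by (simp add: rep_map coordinate_field_components)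

lemma smooth_fun_const: "open U \<Longrightarrow> smooth_fun_on M U (\<lambda>r. c)"
  by (auto simp: smooth_fun_on_def o_def intro!: smooth_on_const open_chart_map_image)

lemma connection_sum_left:
  assumes U: "open U" "U \<subseteq> dom" and X: "\<And>b. b \<in> B \<Longrightarrow> smooth_field_on M U (X b)" and Y: "smooth_field_on M U Y"
    and q: "q \<in> U"
  shows "D (\<lambda>r. \<Sum>b\<in>B. X b r) Y q = (\<Sum>b\<in>B. D (X b) Y q)"
  using X
proof (induction B rule: infinite_finite_induct)
  case (insert b B)
  have "smooth_field_on M U (X b)" "smooth_field_on M U (\<lambda>r. \<Sum>b\<in>B. X b r)"
    by (auto intro!: insert.prems smooth_field_sum[OF U])
  from connection_add_left[OF U(1) this Y q] show ?case using insert by simp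
qed (use connection_scale_left[OF U(1) smooth_fun_const[OF U(1), of 0] Y Y q] in simp_all)

lemma connection_sum_right:
  assumes U: "open U" "U \<subseteq> dom" and X: "smooth_field_on M U X" and Y: "\<And>b. b \<in> B \<Longrightarrow> smooth_field_on M U (Y b)"
    and q: "q \<in> U"
  shows "D X (\<lambda>r. \<Sum>b\<in>B. Y b r) q = (\<Sum>b\<in>B. D X (Y b) q)"
  using Y
proof (induction B rule: infinite_finite_induct)
  case (insert b B)
  have "smooth_field_on M U (Y b)" "smooth_field_on M U (\<lambda>r. \<Sum>b\<in>B. Y b r)"
    by (auto intro!: insert.prems smooth_field_sum[OF U])
  from connection_add_right[OF U(1) X this q] show ?case using insert by simp
next
  \<comment> \<open>The case of the empty sum: for the constant function 0 both Leibniz terms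
    vanish.\<close>
  have "D X (\<lambda>r. 0 *\<^sub>R X r) q = 0"
    using connection_leibniz[OF U(1) smooth_fun_const[OF U(1), of 0] X X q]
    by (simp add: directional_derivative_def o_def frechet_derivative_const)
  then show "D X (\<lambda>r. \<Sum>b\<in>B. Y b r) q = (\<Sum>b\<in>B. D X (Y b) q)" if "infinite B" for B
    using that by simp
  from \<open>D X (\<lambda>r. 0 *\<^sub>R X r) q = 0\<close> show "D X (\<lambda>r. \<Sum>b\<in>{}. Y b r) q = (\<Sum>b\<in>{}. D X (Y b) q)" by simp
qed

text \<open>By definition the derivative is taken in the chart at \<open>q\<close>. The transition
  to the chart at \<open>p\<close> carries \<open>frame v q\<close> to \<open>v\<close>, so a
  derivative in the fixed direction \<open>v\<close> results.\<close>

lemma directional_derivative_frame: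
  assumes U: "open U" "U \<subseteq> dom" and h: "smooth_on (\<phi> ` U) h" and q: "q \<in> U"
  shows "directional_derivative M (frame v) (\<lambda>r. h (\<phi> r) \<bullet> b) q = frechet_derivative h (at (\<phi> q)) v \<bullet> b"
proof -
  let ?d = "chart_at M q" and ?\<sigma> = "chart_map (chart_at M p) \<circ> chart_inv (chart_at M q)"
  have qd: "q \<in> dom" using q U by auto
  have x: "chart_map ?d q \<in> chart_map ?d ` (U \<inter> chart_dom ?d)" using q chart_at_dom by auto
  have \<sigma>: "?\<sigma> differentiable (at (chart_map ?d q))"
    by (rule smooth_on_differentiable[OF smooth_transition[OF chart_at_atlas chart_at_atlas]]) (use qd chart_at_dom in auto)
  have \<sigma>x: "?\<sigma> (chart_map ?d q) = \<phi> q" by (simp add: chart_inv_map chart_at_atlas chart_at_dom)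
  have h': "h differentiable (at (?\<sigma> (chart_map ?d q)))"
    unfolding \<sigma>x by (rule smooth_on_differentiable[OF h]) (use q in auto)
  have hb: "(\<lambda>x. h x \<bullet> b) differentiable (at (?\<sigma> (chart_map ?d q)))"
    using bounded_linear.has_derivative[OF bounded_linear_inner_left] h' unfolding differentiable_def by metis
  have "frechet_derivative ((\<lambda>r. h (\<phi> r) \<bullet> b) \<circ> chart_inv ?d) (at (chart_map ?d q)) (frame v q) =
     frechet_derivative (\<lambda>y. h (?\<sigma> y) \<bullet> b) (at (chart_map ?d q)) (frame v q)"
    by (simp add: o_def)
  also have "\<dots> = frechet_derivative (\<lambda>x. h x \<bullet> b) (at (?\<sigma> (chart_map ?d q))) (frechet_derivative ?\<sigma> (at (chart_map ?d q)) (frame v q))"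
    by (rule frechet_derivative_compose_apply[OF hb \<sigma>])
  also have "\<dots> = frechet_derivative h (at (\<phi> q)) (frechet_derivative ?\<sigma> (at (chart_map ?d q)) (frame v q)) \<bullet> b"
    unfolding \<sigma>x by (rule frechet_derivative_bounded_linear[OF bounded_linear_inner_left h'[unfolded \<sigma>x]])
  also have "frechet_derivative ?\<sigma> (at (chart_map ?d q)) (frame v q) = v"
    using components_coordinate_field[OF qd, of v] by (simp add: components_eq chart_change_def)
  finally show ?thesis by (simp add: directional_derivative_def o_def)
qed

text \<open>Both fields are expanded in the coordinate frame, and the axioms apply with their
  components as coefficient functions. The symbols occur on basis vectors only, because their
  bilinearity is a consequence, obtained by inserting constant fields.\<close>

lemma local_rep_connection:
  assumes U: "open U" "U \<subseteq> dom" and X: "smooth_field_on M U X" and Y: "smooth_field_on M U Y" and q: "q \<in> U"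
  shows "rep (D X Y) (\<phi> q) =
    frechet_derivative (rep Y) (at (\<phi> q)) (rep X (\<phi> q)) + (\<Sum>b\<in>Basis. \<Sum>b'\<in>Basis.
      (rep X (\<phi> q) \<bullet> b) *\<^sub>R (rep Y (\<phi> q) \<bullet> b') *\<^sub>R coefficients (\<phi> q) b b')"
proof -
  have qd: "q \<in> dom" using q U by auto
  note repX = smooth_field_rep[OF X U(2)] and repY = smooth_field_rep[OF Y U(2)]
  note fr = smooth_frame[OF U]
  let ?X = "\<lambda>b r. (rep X (\<phi> r) \<bullet> b) *\<^sub>R frame b r" and ?Y = "\<lambda>b r. (rep Y (\<phi> r) \<bullet> b) *\<^sub>R frame b r"
  have lin: "linear (frechet_derivative (rep Y) (at (\<phi> q)))"
    by (rule smooth_on_linear_derivative[OF repY]) (use q in auto)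
  have sX: "smooth_field_on M U (?X b)" and sY: "smooth_field_on M U (?Y b)" for b
    by (rule smooth_scaled_frame[OF U repX], rule smooth_scaled_frame[OF U repY])
  \<comment> \<open>The frame expansion holds only on \<open>U\<close>, so locality of the
    connection is needed to replace the field.\<close>
  have "D X Y q = D (\<lambda>r. \<Sum>b\<in>Basis. ?X b r) Y q"
    by (rule connection_local[OF U(1) smooth_field_sum[OF U sX] Y _ _ q]) (use U(2) frame_expansion in auto)
  also have "\<dots> = (\<Sum>b\<in>Basis. D (?X b) Y q)" by (rule connection_sum_left[OF U sX Y q])
  also have "\<dots> = (\<Sum>b\<in>Basis. (rep X (\<phi> q) \<bullet> b) *\<^sub>R D (frame b) Y q)"
    by (intro sum.cong refl connection_scale_left[OF U(1) smooth_component[OF U repX] fr Y q])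
  finally have 1: "D X Y q = (\<Sum>b\<in>Basis. (rep X (\<phi> q) \<bullet> b) *\<^sub>R D (frame b) Y q)" .
  have 2: "comp_at q (D (frame b) Y q) = frechet_derivative (rep Y) (at (\<phi> q)) b +
      (\<Sum>b'\<in>Basis. (rep Y (\<phi> q) \<bullet> b') *\<^sub>R coefficients (\<phi> q) b b')" for b
  proof -
    have "D (frame b) Y q = D (frame b) (\<lambda>r. \<Sum>b'\<in>Basis. ?Y b' r) q"
      by (rule connection_local[OF U(1) fr smooth_field_sum[OF U sY] _ _ q]) (use U(2) frame_expansion in auto)
    also have "\<dots> = (\<Sum>b'\<in>Basis. D (frame b) (?Y b') q)" by (rule connection_sum_right[OF U fr sY q])
    also have "\<dots> = (\<Sum>b'\<in>Basis. (frechet_derivative (rep Y) (at (\<phi> q)) b \<bullet> b') *\<^sub>R frame b' q +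
        (rep Y (\<phi> q) \<bullet> b') *\<^sub>R D (frame b) (frame b') q)"
      by (intro sum.cong refl)
        (simp add: connection_leibniz[OF U(1) smooth_component[OF U repY] fr fr q] directional_derivative_frame[OF U repY q])
    finally show ?thesis
      by (simp add: linear_sum[OF comp_linear[OF qd]] linear_add[OF comp_linear[OF qd]] linear_scale[OF comp_linear[OF qd]]
        components_coordinate_field[OF qd] coefficients_def rep_map[OF qd] sum.distrib euclidean_representation)
  qed
  have "rep (D X Y) (\<phi> q) = (\<Sum>b\<in>Basis. (rep X (\<phi> q) \<bullet> b) *\<^sub>R comp_at q (D (frame b) Y q))"
    by (simp add: rep_map[OF qd] 1 linear_sum[OF comp_linear[OF qd]] linear_scale[OF comp_linear[OF qd]])
  also have "\<dots> = (\<Sum>b\<in>Basis. (rep X (\<phi> q) \<bullet> b) *\<^sub>R frechet_derivative (rep Y) (at (\<phi> q)) b) +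
      (\<Sum>b\<in>Basis. \<Sum>b'\<in>Basis. (rep X (\<phi> q) \<bullet> b) *\<^sub>R (rep Y (\<phi> q) \<bullet> b') *\<^sub>R coefficients (\<phi> q) b b')"
    unfolding 2 by (simp only: scaleR_add_right sum.distrib scaleR_sum_right)
  finally show ?thesis unfolding linear_basis_expansion[OF lin, of "rep X (\<phi> q)", symmetric] .
qed

lemma coefficients_bilinear:
  assumes x: "x \<in> \<phi> ` dom"
  shows "coefficients x u v = (\<Sum>b\<in>Basis. \<Sum>b'\<in>Basis. (u \<bullet> b) *\<^sub>R (v \<bullet> b') *\<^sub>R coefficients x b b')"
proof -
  obtain q where q: "q \<in> dom" "x = \<phi> q" using x by auto
  note U = open_dom[of p] subset_refl
  have "frechet_derivative (rep (frame v)) (at x) = frechet_derivative (\<lambda>x. v) (at x)"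
    by (rule frechet_derivative_cong_open[OF open_image[OF U] x]) (rule rep_frame)
  then show ?thesis
    using local_rep_connection[OF U smooth_frame[OF U] smooth_frame[OF U] q(1), of u v] x
    by (simp add: q(2)[symmetric] rep_frame coefficients_def[of _ u v] frechet_derivative_const)
qed

sublocale chart: local_connection "\<phi> ` dom" coefficients
proof (rule local_connection.intro)
  show "open (\<phi> ` dom)" by (rule open_image[OF open_dom subset_refl])
  fix x u v :: 'e assume x: "x \<in> \<phi> ` dom"
  note e = coefficients_bilinear[OF x]
  show "linear (\<lambda>u. coefficients x u v)"
    by (subst e) (intro linear_compose_sum ballI linearI, simp_all add: inner_add_left algebra_simps)
  show "linear (\<lambda>v. coefficients x u v)"
    by (subst e) (intro linear_compose_sum ballI linearI, simp_all add: inner_add_left algebra_simps)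
next
  fix u v
  have U: "open dom" "dom \<subseteq> dom" using open_dom by auto
  show "smooth_on (\<phi> ` dom) (\<lambda>x. coefficients x u v)"
    unfolding coefficients_def
    by (rule smooth_field_rep[OF connection_smooth[OF U(1) smooth_frame[OF U] smooth_frame[OF U]] U(2)])
qed

lemma rep_connection:
  assumes U: "open U" "U \<subseteq> dom" and X: "smooth_field_on M U X" and Y: "smooth_field_on M U Y" and q: "q \<in> U"
  shows "rep (D X Y) (\<phi> q) =
    frechet_derivative (rep Y) (at (\<phi> q)) (rep X (\<phi> q)) + coefficients (\<phi> q) (rep X (\<phi> q)) (rep Y (\<phi> q))"
  using local_rep_connection[OF assms] coefficients_bilinear[of "\<phi> q" "rep X (\<phi> q)" "rep Y (\<phi> q)"] q U(2) by auto

end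

section \<open>Curvature and torsion in a chart\<close>

context based_connection
begin

text \<open>The derivative of a vector field does not transform as a tensor: differentiating the
  Jacobian of the transition \<open>\<sigma>\<close> leaves a second derivative term.\<close>

lemma frechet_derivative_rep_pushforward:
  assumes U: "open U" "U \<subseteq> dom" and X: "smooth_field_on M U X" and q: "q \<in> U"
  defines "d \<equiv> chart_at M q"
  defines "\<sigma> \<equiv> chart_map (chart_at M p) \<circ> chart_inv d"
  shows "frechet_derivative (rep X) (at (\<phi> q)) (comp_at q w) =
    frechet_derivative (\<lambda>y. frechet_derivative \<sigma> (at y) (X q)) (at (chart_map d q)) w +
    comp_at q (frechet_derivative (local_rep M d X) (at (chart_map d q)) w)"
proof -
  have qd: "q \<in> dom" "q \<in> chart_dom d" using q U by (auto simp: d_def chart_at_dom)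
  have d: "d \<in> atlas M" by (simp add: d_def chart_at_atlas)
  let ?y = "chart_map d q" and ?W = "chart_map d ` (U \<inter> chart_dom d)" and ?h = "local_rep M d X"
  have W: "open ?W" "?y \<in> ?W" using open_chart_map_image[OF d U(1)] q qd by auto
  have \<sigma>y: "\<sigma> ?y = \<phi> q" by (simp add: \<sigma>_def chart_inv_map d qd)
  have \<sigma>: "smooth_on ?W \<sigma>"
    unfolding \<sigma>_def by (rule smooth_on_subset[OF smooth_transition[OF d chart_at_atlas]]) (use U in auto)
  have h: "smooth_on ?W ?h" using X d by (auto simp: smooth_field_on_def)
  have hy: "?h ?y = X q" by (simp add: local_rep_map d qd) (simp add: d_def components_self)
  have "frechet_derivative (\<lambda>y. rep X (\<sigma> y)) (at ?y) = frechet_derivative (\<lambda>y. frechet_derivative \<sigma> (at y) (?h y)) (at ?y)"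
  proof (rule frechet_derivative_cong_open[OF W])
    fix y assume "y \<in> ?W"
    then obtain r where r: "r \<in> U" "r \<in> chart_dom d" "y = chart_map d r" by auto
    then have rd: "r \<in> dom" using U by auto
    show "rep X (\<sigma> y) = frechet_derivative \<sigma> (at y) (?h y)"
      using components_change[OF d r(2) chart_at_atlas rd]
      by (simp add: r(3) \<sigma>_def chart_inv_map d r rep_map rd local_rep_map chart_change_def)
  qed
  moreover have "frechet_derivative (\<lambda>y. rep X (\<sigma> y)) (at ?y) w = frechet_derivative (rep X) (at (\<phi> q)) (comp_at q w)"
  proof -
    have "comp_at q w = frechet_derivative \<sigma> (at ?y) w" by (simp add: components_eq chart_change_def \<sigma>_def d_def)
    moreover have "rep X differentiable (at (\<sigma> ?y))"
      unfolding \<sigma>y by (rule smooth_on_differentiable[OF smooth_field_rep[OF X U(2)]]) (use q in auto)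
    ultimately show ?thesis
      using frechet_derivative_compose_apply[of "rep X" \<sigma> ?y w] smooth_on_differentiable[OF \<sigma> W(2)] by (simp add: \<sigma>y)
  qed
  moreover have "frechet_derivative (\<lambda>y. frechet_derivative \<sigma> (at y) (?h y)) (at ?y) w =
    frechet_derivative (\<lambda>y. frechet_derivative \<sigma> (at y) (X q)) (at ?y) w + frechet_derivative \<sigma> (at ?y) (frechet_derivative ?h (at ?y) w)"
  proof -
    have pair: "((\<lambda>y. (y, ?h y)) has_derivative (\<lambda>v. (v, frechet_derivative ?h (at ?y) v))) (at ?y)"
      by (intro has_derivative_Pair has_derivative_ident smooth_on_has_derivative[OF h W(2)])
    have "((\<lambda>y. frechet_derivative \<sigma> (at (fst (y, ?h y))) (snd (y, ?h y))) has_derivative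
      (\<lambda>v. frechet_derivative (\<lambda>x. frechet_derivative \<sigma> (at x) (?h ?y)) (at ?y) (fst (v, frechet_derivative ?h (at ?y) v)) +
        frechet_derivative \<sigma> (at ?y) (snd (v, frechet_derivative ?h (at ?y) v)))) (at ?y)"
      by (rule has_derivative_compose[OF pair has_derivative_derivative_pair[OF W(1) \<sigma> W(2)]])
    from frechet_derivative_eq[OF this] show ?thesis by (simp add: hy)
  qed
  moreover have "comp_at q v = frechet_derivative \<sigma> (at ?y) v" for v
    by (simp add: components_eq chart_change_def \<sigma>_def d_def)
  ultimately show ?thesis by simp
qed

text \<open>In the difference the second derivatives of the transition map cancel by symmetry, so
  the bracket computed in the chart at \<open>q\<close> agrees with the one in the chart at
  \<open>p\<close>.\<close>

lemma rep_lie_bracket: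
  assumes U: "open U" "U \<subseteq> dom" and X: "smooth_field_on M U X" and Y: "smooth_field_on M U Y" and q: "q \<in> U"
  shows "rep (lie_bracket M X Y) (\<phi> q) =
    frechet_derivative (rep Y) (at (\<phi> q)) (rep X (\<phi> q)) - frechet_derivative (rep X) (at (\<phi> q)) (rep Y (\<phi> q))"
proof -
  let ?d = "chart_at M q" and ?\<sigma> = "chart_map (chart_at M p) \<circ> chart_inv (chart_at M q)"
  have qd: "q \<in> dom" using q U by auto
  have W: "open (chart_map ?d ` (chart_dom ?d \<inter> dom))" "chart_map ?d q \<in> chart_map ?d ` (chart_dom ?d \<inter> dom)"
    using open_overlap[OF chart_at_atlas chart_at_atlas] qd chart_at_dom by auto
  have sym: "frechet_derivative (\<lambda>y. frechet_derivative ?\<sigma> (at y) u) (at (chart_map ?d q)) v =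
      frechet_derivative (\<lambda>y. frechet_derivative ?\<sigma> (at y) v) (at (chart_map ?d q)) u" for u v
    by (rule smooth_on_mixed_derivatives[OF W(1) smooth_transition[OF chart_at_atlas chart_at_atlas] W(2)])
  have r: "rep Z (\<phi> q) = comp_at q (Z q)" for Z by (rule rep_map[OF qd])
  show ?thesis
    unfolding r frechet_derivative_rep_pushforward[OF U X q] frechet_derivative_rep_pushforward[OF U Y q]
    by (simp add: lie_bracket_def Let_def linear_diff[OF comp_linear[OF qd]] sym)
qed

lemma smooth_lie_bracket:
  assumes U: "open U" "U \<subseteq> dom" and X: "smooth_field_on M U X" and Y: "smooth_field_on M U Y"
  shows "smooth_field_on M U (lie_bracket M X Y)"
proof (rule smooth_fieldI[OF U])
  note o = open_image[OF U] and sX = smooth_field_rep[OF X U(2)] and sY = smooth_field_rep[OF Y U(2)]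
  have "smooth_on (\<phi> ` U) (\<lambda>x. frechet_derivative (rep Y) (at x) (rep X x) - frechet_derivative (rep X) (at x) (rep Y x))"
    by (intro smooth_on_diff o smooth_on_derivative_apply[OF o o sY smooth_on_ident[OF o] _ sX]
      smooth_on_derivative_apply[OF o o sX smooth_on_ident[OF o] _ sY]) auto
  then show "smooth_on (\<phi> ` U) (rep (lie_bracket M X Y))"
    by (rule smooth_on_cong[OF o, rotated]) (auto simp: rep_lie_bracket[OF U X Y])
qed

definition represents :: "nat \<Rightarrow> ('m, 'e) tensor_field \<Rightarrow> ('e \<Rightarrow> 'e list \<Rightarrow> 'e) \<Rightarrow> bool" where
  "represents n S S' \<longleftrightarrow> local_tensor (\<phi> ` dom) n S' \<and>
     (\<forall>U Xs q. open U \<and> U \<subseteq> dom \<and> length Xs = n \<and> (\<forall>X\<in>set Xs. smooth_field_on M U X) \<and> q \<in> U \<longrightarrow>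
        rep (S Xs) (\<phi> q) = S' (\<phi> q) (map (\<lambda>X. rep X (\<phi> q)) Xs))"

lemma representsD:
  assumes "represents n S S'"
  shows "local_tensor (\<phi> ` dom) n S'"
    "open U \<Longrightarrow> U \<subseteq> dom \<Longrightarrow> length Xs = n \<Longrightarrow> (\<And>X. X \<in> set Xs \<Longrightarrow> smooth_field_on M U X) \<Longrightarrow> q \<in> U \<Longrightarrow>
        rep (S Xs) (\<phi> q) = S' (\<phi> q) (map (\<lambda>X. rep X (\<phi> q)) Xs)"
  using assms unfolding represents_def by blast+

lemma represents_smooth:
  assumes S: "represents n S S'" and U: "open U" "U \<subseteq> dom" and Xs: "length Xs = n" "\<And>X. X \<in> set Xs \<Longrightarrow> smooth_field_on M U X"
  shows "smooth_field_on M U (S Xs)"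
proof (rule smooth_fieldI[OF U])
  note o = open_image[OF U]
  have "smooth_on (\<phi> ` U) (\<lambda>x. S' x (map (\<lambda>X. X x) (map rep Xs)))"
    by (rule smooth_on_local_tensor[OF o chart.open_domain _ smooth_on_ident[OF o] representsD(1)[OF S]])
      (use U(2) Xs smooth_field_rep[OF _ U(2)] in auto)
  then show "smooth_on (\<phi> ` U) (rep (S Xs))"
  proof (rule smooth_on_cong[OF o, rotated])
    fix x assume "x \<in> \<phi> ` U"
    then obtain q where q: "q \<in> U" "x = \<phi> q" by auto
    have "rep (S Xs) (\<phi> q) = S' (\<phi> q) (map (\<lambda>X. rep X (\<phi> q)) Xs)"
      by (rule representsD(2)[OF S U]) (use Xs q in auto)
    then show "S' x (map (\<lambda>X. X x) (map rep Xs)) = rep (S Xs) x" by (simp add: q(2) o_def)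
  qed
qed

lemma represents_torsion: "represents 2 (torsion_tensor M D) chart.local_torsion"
  unfolding represents_def
proof (intro conjI allI impI chart.local_tensor_torsion; elim conjE)
  fix U q and Xs :: "('m \<Rightarrow> 'e) list"
  assume U: "open U" "U \<subseteq> dom" and Xs: "length Xs = 2" "\<forall>X\<in>set Xs. smooth_field_on M U X" and q: "q \<in> U"
  obtain X Y where XY: "Xs = [X, Y]" using Xs(1) by (auto simp: numeral_2_eq_2 length_Suc_conv)
  have s: "smooth_field_on M U X" "smooth_field_on M U Y" using Xs(2) by (auto simp: XY)
  have qd: "q \<in> dom" using q U by auto
  have "rep (torsion_tensor M D Xs) (\<phi> q) = rep (D X Y) (\<phi> q) - rep (D Y X) (\<phi> q) - rep (lie_bracket M X Y) (\<phi> q)"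
    by (simp add: rep_map[OF qd] torsion_tensor_def torsion_def XY linear_diff[OF comp_linear[OF qd]])
  also have "\<dots> = chart.local_torsion (\<phi> q) (map (\<lambda>X. rep X (\<phi> q)) Xs)"
    unfolding rep_lie_bracket[OF U s q] rep_connection[OF U s q] rep_connection[OF U s(2,1) q]
    by (simp add: XY chart.local_torsion_def)
  finally show "rep (torsion_tensor M D Xs) (\<phi> q) = chart.local_torsion (\<phi> q) (map (\<lambda>X. rep X (\<phi> q)) Xs)" .
qed

lemma frechet_derivative_rep_connection:
  assumes U: "open U" "U \<subseteq> dom" and X: "smooth_field_on M U X" and Y: "smooth_field_on M U Y" and q: "q \<in> U"
  shows "frechet_derivative (rep (D X Y)) (at (\<phi> q)) h =
    frechet_derivative (\<lambda>x. frechet_derivative (rep Y) (at x) (rep X (\<phi> q))) (at (\<phi> q)) h +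
    frechet_derivative (rep Y) (at (\<phi> q)) (frechet_derivative (rep X) (at (\<phi> q)) h) +
    (frechet_derivative (\<lambda>x. coefficients x (rep X (\<phi> q)) (rep Y (\<phi> q))) (at (\<phi> q)) h +
     coefficients (\<phi> q) (frechet_derivative (rep X) (at (\<phi> q)) h) (rep Y (\<phi> q)) +
     coefficients (\<phi> q) (rep X (\<phi> q)) (frechet_derivative (rep Y) (at (\<phi> q)) h))"
proof -
  let ?x = "\<phi> q"
  note o = open_image[OF U] and sX = smooth_field_rep[OF X U(2)] and sY = smooth_field_rep[OF Y U(2)]
  have x: "?x \<in> \<phi> ` U" using q by simp
  have "frechet_derivative (rep (D X Y)) (at ?x) =
    frechet_derivative (\<lambda>x. frechet_derivative (rep Y) (at x) (rep X x) + coefficients x (rep X x) (rep Y x)) (at ?x)"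
    by (rule frechet_derivative_cong_open[OF o x]) (auto simp: rep_connection[OF U X Y])
  moreover have 1: "((\<lambda>x. frechet_derivative (rep Y) (at x) (rep X x)) has_derivative
    (\<lambda>v. frechet_derivative (\<lambda>x. frechet_derivative (rep Y) (at x) (rep X ?x)) (at ?x) v +
      frechet_derivative (rep Y) (at ?x) (frechet_derivative (rep X) (at ?x) v))) (at ?x)"
  proof -
    have pair: "((\<lambda>y. (y, rep X y)) has_derivative (\<lambda>v. (v, frechet_derivative (rep X) (at ?x) v))) (at ?x)"
      by (intro has_derivative_Pair has_derivative_ident smooth_on_has_derivative[OF sX x])
    from has_derivative_compose[OF pair has_derivative_derivative_pair[OF o sY x]] show ?thesis by simp
  qed
  moreover have 2: "((\<lambda>y. coefficients y (rep X y) (rep Y y)) has_derivative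
    (\<lambda>h. frechet_derivative (\<lambda>y. coefficients y (rep X ?x) (rep Y ?x)) (at ?x) h +
      coefficients ?x (frechet_derivative (rep X) (at ?x) h) (rep Y ?x) + coefficients ?x (rep X ?x) (frechet_derivative (rep Y) (at ?x) h))) (at ?x)"
  proof -
    have "(\<lambda>x. x) ` (\<phi> ` U) \<subseteq> \<phi> ` dom" using U(2) by auto
    moreover have "(\<lambda>x::'e. x) differentiable (at ?x)" by simp
    ultimately show ?thesis
      using chart.coefficients_has_derivative[OF o x _ _ smooth_on_differentiable[OF sX x] smooth_on_differentiable[OF sY x]]
      by (force simp: frechet_derivative_eq[OF has_derivative_ident])
  qed
  ultimately show ?thesis using frechet_derivative_eq[OF has_derivative_add[OF 1 2]] by simp
qed

text \<open>Second derivatives of \<open>Z\<close> cancel by symmetry, and first derivatives of the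
  fields cancel among themselves or against the bracket term; only the values of the three fields
  survive.\<close>

lemma represents_curvature: "represents 3 (curvature_tensor M D) chart.local_curvature"
  unfolding represents_def
proof (intro conjI allI impI chart.local_tensor_curvature; elim conjE)
  fix U q and Xs :: "('m \<Rightarrow> 'e) list"
  assume U: "open U" "U \<subseteq> dom" and Xs: "length Xs = 3" "\<forall>X\<in>set Xs. smooth_field_on M U X" and q: "q \<in> U"
  obtain X Y Z where XYZ: "Xs = [X, Y, Z]" using Xs(1) by (auto simp: numeral_3_eq_3 length_Suc_conv)
  have s: "smooth_field_on M U X" "smooth_field_on M U Y" "smooth_field_on M U Z" using Xs(2) by (auto simp: XYZ)
  have qd: "q \<in> dom" and x: "\<phi> q \<in> \<phi> ` U" and xd: "\<phi> q \<in> \<phi> ` dom" using q U by auto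
  note lin = linear_add[OF chart.linear_right[OF xd]] linear_diff[OF chart.linear_left[OF xd]]
  have linZ: "linear (frechet_derivative (rep Z) (at (\<phi> q)))"
    by (rule smooth_on_linear_derivative[OF smooth_field_rep[OF s(3) U(2)] x])
  have sym: "frechet_derivative (\<lambda>x. frechet_derivative (rep Z) (at x) u) (at (\<phi> q)) v =
    frechet_derivative (\<lambda>x. frechet_derivative (rep Z) (at x) v) (at (\<phi> q)) u" for u v
    by (rule smooth_on_mixed_derivatives[OF open_image[OF U] smooth_field_rep[OF s(3) U(2)] x])
  have "rep (curvature_tensor M D Xs) (\<phi> q) =
    rep (D X (D Y Z)) (\<phi> q) - rep (D Y (D X Z)) (\<phi> q) - rep (D (lie_bracket M X Y) Z) (\<phi> q)"
    by (simp add: rep_map[OF qd] curvature_tensor_def curvature_def XYZ linear_diff[OF comp_linear[OF qd]])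
  also have "\<dots> = chart.local_curvature (\<phi> q) (map (\<lambda>X. rep X (\<phi> q)) Xs)"
    unfolding rep_connection[OF U s(1) connection_smooth[OF U(1) s(2,3)] q] rep_connection[OF U s(2) connection_smooth[OF U(1) s(1,3)] q]
      rep_connection[OF U smooth_lie_bracket[OF U s(1,2)] s(3) q] rep_lie_bracket[OF U s(1,2) q]
      frechet_derivative_rep_connection[OF U s(2,3) q] frechet_derivative_rep_connection[OF U s(1,3) q]
      rep_connection[OF U s(2,3) q] rep_connection[OF U s(1,3) q] lin linear_diff[OF linZ]
      sym[of "rep X (\<phi> q)" "rep Y (\<phi> q)"]
    by (simp add: XYZ chart.local_curvature_def)
  finally show "rep (curvature_tensor M D Xs) (\<phi> q) = chart.local_curvature (\<phi> q) (map (\<lambda>X. rep X (\<phi> q)) Xs)" .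
qed

text \<open>The derivatives of the arguments occur twice, from the product rule for
  \<open>S Xs\<close> and from the correction terms, and cancel.\<close>

lemma represents_covariant_derivative:
  assumes S: "represents n S S'"
  shows "represents (Suc n) (covariant_derivative D S) (chart.local_cov S')"
  unfolding represents_def
proof (intro conjI allI impI chart.local_tensor_cov[OF representsD(1)[OF S]]; elim conjE)
  fix U q and Ws :: "('m \<Rightarrow> 'e) list"
  assume U: "open U" "U \<subseteq> dom" and Ws: "length Ws = Suc n" "\<forall>X\<in>set Ws. smooth_field_on M U X" and q: "q \<in> U"
  obtain Z Xs where ZXs: "Ws = Z # Xs" using Ws(1) by (cases Ws) auto
  have n: "length Xs = n" using Ws(1) by (simp add: ZXs)
  have Z: "smooth_field_on M U Z" and Xs: "\<And>X. X \<in> set Xs \<Longrightarrow> smooth_field_on M U X" using Ws(2) by (auto simp: ZXs)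
  let ?x = "\<phi> q" and ?v = "\<lambda>x. map (\<lambda>X. rep X x) Xs"
  have qd: "q \<in> dom" and x: "?x \<in> \<phi> ` U" and xd: "?x \<in> \<phi> ` dom" using q U by auto
  note o = open_image[OF U]
  have sub: "\<phi> ` U \<subseteq> \<phi> ` dom" using U by auto
  have sXs: "X differentiable (at ?x)" if "X \<in> set (map rep Xs)" for X
    using that smooth_on_differentiable[OF smooth_field_rep[OF Xs U(2)] x] by auto
  have rep_S: "rep (S Xs) (\<phi> r) = S' (\<phi> r) (?v (\<phi> r))" if "r \<in> U" for r
    by (rule representsD(2)[OF S U]) (use n Xs that in auto)
  have sSXs: "smooth_field_on M U (S Xs)" by (rule represents_smooth[OF S U]) (use n Xs in auto)
  have "frechet_derivative (rep (S Xs)) (at ?x) = frechet_derivative (\<lambda>x. S' x (map (\<lambda>X. X x) (map rep Xs))) (at ?x)"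
  proof (rule frechet_derivative_cong_open[OF o x])
    fix y assume "y \<in> \<phi> ` U"
    then obtain r where r: "r \<in> U" "y = \<phi> r" by auto
    then show "rep (S Xs) y = S' y (map (\<lambda>X. X y) (map rep Xs))"
      using rep_S[OF r(1)] by (simp add: o_def)
  qed
  also have "\<dots> = (\<lambda>h. frechet_derivative (\<lambda>y. S' y (map (\<lambda>X. X ?x) (map rep Xs))) (at ?x) h +
      (\<Sum>i<length (map rep Xs). S' ?x ((map (\<lambda>X. X ?x) (map rep Xs))[i := frechet_derivative (map rep Xs ! i) (at ?x) h])))"
  proof (rule frechet_derivative_eq[OF has_derivative_multilinear[OF o x]])
    show "multilinear (length (map rep Xs)) (S' y)" if "y \<in> \<phi> ` U" for y
      using local_tensorD(1)[OF representsD(1)[OF S]] that sub n by auto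
    show "(\<lambda>y. S' y vs) differentiable (at ?x)" if "length vs = length (map rep Xs)" for vs
      using smooth_on_differentiable[OF local_tensorD(2)[OF representsD(1)[OF S]] xd] that n by simp
    show "X differentiable (at ?x)" if "X \<in> set (map rep Xs)" for X by (rule sXs[OF that])
  qed
  finally have d: "frechet_derivative (rep (S Xs)) (at ?x) h = frechet_derivative (\<lambda>y. S' y (?v ?x)) (at ?x) h +
      (\<Sum>i<n. S' ?x ((?v ?x)[i := frechet_derivative (rep (Xs ! i)) (at ?x) h]))" for h
    by (simp add: n o_def)
  have upd: "rep (S (Xs[i := D Z (Xs ! i)])) ?x = S' ?x ((?v ?x)[i := frechet_derivative (rep (Xs ! i)) (at ?x) (rep Z ?x)]) +
      S' ?x ((?v ?x)[i := coefficients ?x (rep Z ?x) (rep (Xs ! i) ?x)])" if i: "i < n" for i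
  proof -
    have Xi: "smooth_field_on M U (Xs ! i)" using Xs i n by simp
    have "rep (S (Xs[i := D Z (Xs ! i)])) ?x = S' ?x (map (\<lambda>X. rep X ?x) (Xs[i := D Z (Xs ! i)]))"
    proof (rule representsD(2)[OF S U _ _ q])
      show "smooth_field_on M U X" if "X \<in> set (Xs[i := D Z (Xs ! i)])" for X
        using that set_update_subset_insert[of Xs i "D Z (Xs ! i)"] Xs connection_smooth[OF U(1) Z Xi] by blast
    qed (simp add: n)
    also have "\<dots> = S' ?x ((?v ?x)[i := frechet_derivative (rep (Xs ! i)) (at ?x) (rep Z ?x) + coefficients ?x (rep Z ?x) (rep (Xs ! i) ?x)])"
      by (simp add: map_update rep_connection[OF U Z Xi q])
    also have "\<dots> = S' ?x ((?v ?x)[i := frechet_derivative (rep (Xs ! i)) (at ?x) (rep Z ?x)]) +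
      S' ?x ((?v ?x)[i := coefficients ?x (rep Z ?x) (rep (Xs ! i) ?x)])"
      by (rule linear_add[OF multilinearD[OF local_tensorD(1)[OF representsD(1)[OF S] xd] _ i]]) (simp add: n)
    finally show ?thesis .
  qed
  have "rep (covariant_derivative D S Ws) ?x = rep (D Z (S Xs)) ?x - (\<Sum>i<n. rep (S (Xs[i := D Z (Xs ! i)])) ?x)"
    by (simp add: rep_map[OF qd] ZXs n linear_diff[OF comp_linear[OF qd]] linear_sum[OF comp_linear[OF qd]])
  also have "\<dots> = chart.local_cov S' ?x (map (\<lambda>X. rep X ?x) Ws)"
    unfolding rep_connection[OF U Z sSXs q] d rep_S[OF q]
    by (simp add: upd sum.distrib ZXs n)
  finally show "rep (covariant_derivative D S Ws) ?x = chart.local_cov S' ?x (map (\<lambda>X. rep X ?x) Ws)" .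
qed

lemma represents_iterated_covariant_derivative:
  "represents n S S' \<Longrightarrow> represents (k + n) ((covariant_derivative D ^^ k) S) ((chart.local_cov ^^ k) S')"
  by (induction k) (auto intro: represents_covariant_derivative)

text \<open>At \<open>p\<close> the reference chart is the chosen one, so tangent vectors and their
  components coincide.\<close>

lemma tensor_at_eq:
  assumes S: "represents n S S'" and vs: "length vs = n"
  shows "tensor_at M S p vs = S' (\<phi> p) vs"
proof -
  have U: "open dom" "dom \<subseteq> dom" and p: "p \<in> dom" using open_dom chart_at_dom by auto
  have "tensor_at M S p vs = rep (S (map frame vs)) (\<phi> p)"
    by (simp add: tensor_at_def rep_map[OF p] components_self)
  also have "\<dots> = S' (\<phi> p) (map (\<lambda>X. rep X (\<phi> p)) (map frame vs))"
    by (rule representsD(2)[OF S U _ _ p]) (use smooth_frame[OF U] vs in auto)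
  also have "map (\<lambda>X. rep X (\<phi> p)) (map frame vs) = vs"
    using p by (simp add: o_def rep_frame)
  finally show ?thesis .
qed

lemma curvature_series_eq:
  "curvature_series M D p = (\<lambda>n X. \<Sum>k | k + 2 = n. (1 / fact k) *\<^sub>R
     Blinfun (\<lambda>Y. (chart.local_cov ^^ k) chart.local_curvature (\<phi> p) (replicate k X @ [X, Y, X])))"
  unfolding curvature_series_def
  by (simp add: tensor_at_eq[OF represents_iterated_covariant_derivative[OF represents_curvature]])

lemma torsion_series_eq:
  "torsion_series M D p = (\<lambda>n X. \<Sum>k | k + 1 = n. (1 / fact k) *\<^sub>R
     Blinfun (\<lambda>Y. (chart.local_cov ^^ k) chart.local_torsion (\<phi> p) (replicate k X @ [X, Y])))"
  unfolding torsion_series_def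
  by (simp add: tensor_at_eq[OF represents_iterated_covariant_derivative[OF represents_torsion]])

end

section \<open>The exponential map and radial transport\<close>

lemma (in local_connection) transport_solution_subset:
  "transport_solution T x y a \<Longrightarrow> T' \<subseteq> T \<Longrightarrow> transport_solution T' x y a"
  unfolding transport_solution_def by (blast intro: has_vector_derivative_within_subset)

lemma (in local_connection) transport_solution_cong_field:
  assumes "transport_solution T x y a" "\<And>t. t \<in> T \<Longrightarrow> a' t = a t"
  shows "transport_solution T x y a'"
  unfolding transport_solution_def
proof (intro ballI conjI)
  fix t assume t: "t \<in> T"
  note D = transport_solutionD[OF assms(1) t]
  show "x t \<in> \<Omega>" "(x has_vector_derivative y t) (at t within T)" "(y has_vector_derivative - G (x t) (y t) (y t)) (at t within T)"
    by (rule D)+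
  show "(a' has_vector_derivative - G (x t) (y t) (a' t)) (at t within T)"
    using has_vector_derivative_transform[OF t assms(2) D(4)] assms(2)[OF t] by simp
qed

lemma curve_nearby:
  fixes \<gamma> :: "real \<Rightarrow> 'm::topological_space"
  assumes "continuous (at t within S) \<gamma>" "open W" "\<gamma> t \<in> W"
  obtains \<delta> where "\<delta> > 0" "\<And>s. s \<in> S \<Longrightarrow> dist s t < \<delta> \<Longrightarrow> \<gamma> s \<in> W"
proof -
  have "\<forall>\<^sub>F s in at t within S. \<gamma> s \<in> W"
    using assms unfolding continuous_within by (rule topological_tendstoD)
  then obtain \<delta> where "\<delta> > 0" "\<forall>s\<in>S. s \<noteq> t \<and> dist s t < \<delta> \<longrightarrow> \<gamma> s \<in> W"
    unfolding eventually_at by blast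
  then show thesis using that assms(3) by metis
qed

section \<open>Velocities and fields along a curve under a change of chart\<close>

context smooth_manifold
begin

context
  fixes c d :: "('m, 'e) chart" and \<gamma> :: "real \<Rightarrow> 'm" and t :: real and S :: "real set"
  assumes c: "c \<in> atlas M" "\<gamma> t \<in> chart_dom c" and d: "d \<in> atlas M" "\<gamma> t \<in> chart_dom d"
    and cont: "continuous (at t within S) \<gamma>" and t: "t \<in> S"
begin

lemma overlap_nearby:
  obtains \<delta> where "\<delta> > 0" "\<And>s. s \<in> S \<Longrightarrow> dist s t < \<delta> \<Longrightarrow> \<gamma> s \<in> chart_dom c \<inter> chart_dom d"
  by (rule curve_nearby[OF cont open_Int[OF open_chart_dom[OF c(1)] open_chart_dom[OF d(1)]]])
    (use c d in \<open>auto intro: that\<close>)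

lemma curve_chart_change:
  assumes "((\<lambda>s. chart_map d (\<gamma> s)) has_vector_derivative u) (at t within S)"
  shows "((\<lambda>s. chart_map c (\<gamma> s)) has_vector_derivative chart_change d c (\<gamma> t) u) (at t within S)"
proof -
  let ?\<sigma> = "chart_map c \<circ> chart_inv d"
  obtain \<delta> where \<delta>: "\<delta> > 0" "\<And>s. s \<in> S \<Longrightarrow> dist s t < \<delta> \<Longrightarrow> \<gamma> s \<in> chart_dom c \<inter> chart_dom d"
    by (rule overlap_nearby) (rule that)
  have "(?\<sigma> has_derivative chart_change d c (\<gamma> t)) (at (chart_map d (\<gamma> t)) within (\<lambda>s. chart_map d (\<gamma> s)) ` S)"
    unfolding chart_change_def[abs_def]
    by (rule has_derivative_at_withinI[OF frechet_derivative_has_derivative[OF transition_differentiable[OF d(1) c(1) d(2) c(2)]]])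
  from vector_derivative_diff_chain_within[OF assms this]
  have "((\<lambda>s. ?\<sigma> (chart_map d (\<gamma> s))) has_vector_derivative chart_change d c (\<gamma> t) u) (at t within S)"
    by (simp add: o_def)
  then show ?thesis
    by (rule has_vector_derivative_transform_within[OF _ \<delta>(1) t]) (use \<delta>(2) in \<open>auto simp: chart_inv_map d\<close>)
qed

text \<open>The Jacobian of the transition moves with the curve. Its derivative is the second
  derivative term, which is later matched by the inhomogeneous term of the Christoffel
  symbols.\<close>

lemma field_chart_change:
  assumes u: "((\<lambda>s. chart_map d (\<gamma> s)) has_vector_derivative u) (at t within S)"
    and w: "((\<lambda>s. components M d (\<gamma> s) (V s)) has_vector_derivative w) (at t within S)"
  shows "((\<lambda>s. components M c (\<gamma> s) (V s)) has_vector_derivative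
    frechet_derivative (\<lambda>x. frechet_derivative (chart_map c \<circ> chart_inv d) (at x) (components M d (\<gamma> t) (V t))) (at (chart_map d (\<gamma> t))) u
    + chart_change d c (\<gamma> t) w) (at t within S)"
proof -
  let ?\<sigma> = "chart_map c \<circ> chart_inv d" and ?x = "\<lambda>s. chart_map d (\<gamma> s)" and ?y = "\<lambda>s. components M d (\<gamma> s) (V s)"
  obtain \<delta> where \<delta>: "\<delta> > 0" "\<And>s. s \<in> S \<Longrightarrow> dist s t < \<delta> \<Longrightarrow> \<gamma> s \<in> chart_dom c \<inter> chart_dom d"
    by (rule overlap_nearby) (rule that)
  have xt: "?x t \<in> chart_map d ` (chart_dom d \<inter> chart_dom c)" using c d by auto
  have F: "((\<lambda>z. frechet_derivative ?\<sigma> (at (fst z)) (snd z)) has_derivative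
    (\<lambda>h. frechet_derivative (\<lambda>x. frechet_derivative ?\<sigma> (at x) (?y t)) (at (?x t)) (fst h) + frechet_derivative ?\<sigma> (at (?x t)) (snd h)))
    (at (?x t, ?y t) within (\<lambda>s. (?x s, ?y s)) ` S)"
    by (rule has_derivative_at_withinI[OF has_derivative_derivative_pair[OF open_overlap[OF d(1) c(1)] smooth_transition[OF d(1) c(1)] xt]])
  from vector_derivative_diff_chain_within[OF has_vector_derivative_Pair[OF u w] F]
  have "((\<lambda>s. frechet_derivative ?\<sigma> (at (?x s)) (?y s)) has_vector_derivative
    frechet_derivative (\<lambda>x. frechet_derivative ?\<sigma> (at x) (?y t)) (at (?x t)) u + chart_change d c (\<gamma> t) w) (at t within S)"
    by (simp add: o_def chart_change_def)
  then show ?thesis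
    by (rule has_vector_derivative_transform_within[OF _ \<delta>(1) t])
      (use \<delta>(2) components_change[OF d(1) _ c(1)] in \<open>auto simp: chart_change_def\<close>)
qed

end

end

context based_connection
begin

text \<open>The transformation law of Christoffel symbols. The inhomogeneous term is the derivative,
  in the chart at \<open>p\<close>, of a coordinate field of the chart at \<open>q\<close>.\<close>

lemma comp_at_christoffel:
  assumes q: "q \<in> dom"
  shows "comp_at q (christoffel M D q u v) =
    frechet_derivative (\<lambda>x. frechet_derivative (\<phi> \<circ> chart_inv (chart_at M q)) (at x) v) (at (chart_map (chart_at M q) q)) u
    + coefficients (\<phi> q) (comp_at q u) (comp_at q v)"
proof -
  let ?d = "chart_at M q"
  \<comment> \<open>The same theory based at \<open>q\<close> provides the coordinate fields of that
    chart.\<close>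
  interpret q: based_connection M D q by unfold_locales
  define U where "U = dom \<inter> chart_dom ?d"
  have U: "open U" "U \<subseteq> dom" "U \<subseteq> chart_dom ?d" and qU: "q \<in> U"
    using open_dom q.open_dom q chart_at_dom by (auto simp: U_def)
  note sm = q.smooth_frame[OF U(1,3)]
  have at_q: "coordinate_field M q w q = w" for w
    using coordinate_field_components[OF chart_at_dom, of q w] by (simp add: components_self)
  have "frechet_derivative (local_rep M ?d (coordinate_field M q v)) (at (chart_map ?d q)) = frechet_derivative (\<lambda>x. v) (at (chart_map ?d q))"
    by (rule frechet_derivative_cong_open[OF q.open_image[OF q.open_dom subset_refl]])
      (use chart_at_dom q.rep_frame in auto)
  then have "frechet_derivative (rep (coordinate_field M q v)) (at (\<phi> q)) (comp_at q u) =
    frechet_derivative (\<lambda>x. frechet_derivative (\<phi> \<circ> chart_inv ?d) (at x) v) (at (chart_map ?d q)) u"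
    using frechet_derivative_rep_pushforward[OF U(1,2) sm qU, of v u] linear_0[OF comp_linear[OF q]]
    by (simp add: at_q frechet_derivative_const)
  then show ?thesis
    using rep_connection[OF U(1,2) sm sm qU, of u v] by (simp add: christoffel_def rep_map[OF q] at_q)
qed

lemma frame_comp_at: "q \<in> dom \<Longrightarrow> frame (comp_at q v) q = v"
  by (rule coordinate_field_components)

lemma comp_at_frame: "q \<in> dom \<Longrightarrow> comp_at q (frame v q) = v"
  by (rule components_coordinate_field)

context
  fixes \<gamma> :: "real \<Rightarrow> 'm" and t :: real
  assumes t: "t \<in> {0..1}" and \<gamma>t: "\<gamma> t \<in> dom" and cont: "continuous (at t within {0..1}) \<gamma>"
begin

lemma has_velocity_chart:
  "has_velocity M \<gamma> u t \<longleftrightarrow> ((\<lambda>s. \<phi> (\<gamma> s)) has_vector_derivative comp_at (\<gamma> t) u) (at t within {0..1})"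
proof
  assume "has_velocity M \<gamma> u t"
  then show "((\<lambda>s. \<phi> (\<gamma> s)) has_vector_derivative comp_at (\<gamma> t) u) (at t within {0..1})"
    using curve_chart_change[OF chart_at_atlas \<gamma>t chart_at_atlas chart_at_dom cont t] by (simp add: has_velocity_def components_eq)
next
  assume "((\<lambda>s. \<phi> (\<gamma> s)) has_vector_derivative comp_at (\<gamma> t) u) (at t within {0..1})"
  from curve_chart_change[OF chart_at_atlas chart_at_dom chart_at_atlas \<gamma>t cont t this]
  show "has_velocity M \<gamma> u t"
    by (simp add: has_velocity_def components_chart_change chart_at_atlas \<gamma>t)
qed

text \<open>The definition works in a chart that depends on \<open>t\<close>. In the fixed chart the
  second derivative \<open>A\<close> arises both from the components of the field and from the
  Christoffel symbols, and the two contributions match.\<close>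

lemma has_covariant_derivative_chart:
  assumes u: "has_velocity M \<gamma> u t"
  shows "has_covariant_derivative M D \<gamma> V 0 t \<longleftrightarrow>
    ((\<lambda>s. comp_at (\<gamma> s) (V s)) has_vector_derivative
      - coefficients (\<phi> (\<gamma> t)) (comp_at (\<gamma> t) u) (comp_at (\<gamma> t) (V t))) (at t within {0..1})"
proof -
  let ?d = "chart_at M (\<gamma> t)" and ?\<kappa> = "comp_at (\<gamma> t)" and ?chr = "christoffel M D (\<gamma> t) u (V t)"
  note ud = u[unfolded has_velocity_def]
  note lin = comp_linear[OF \<gamma>t]
  define A where "A = frechet_derivative (\<lambda>x. frechet_derivative (\<phi> \<circ> chart_inv ?d) (at x) (V t)) (at (chart_map ?d (\<gamma> t))) u"
  have unique: "a = b" if "(f has_vector_derivative a) (at t within {0..1})" "(f has_vector_derivative b) (at t within {0..1})"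
    for f :: "real \<Rightarrow> 'e" and a b
    using vector_derivative_unique_within_closed_interval[of 0 1 t f a b] that t by simp
  have \<kappa>chr: "?\<kappa> ?chr = A + coefficients (\<phi> (\<gamma> t)) (?\<kappa> u) (?\<kappa> (V t))"
    unfolding A_def by (rule comp_at_christoffel[OF \<gamma>t])
  have change: "((\<lambda>s. comp_at (\<gamma> s) (V s)) has_vector_derivative A + ?\<kappa> w) (at t within {0..1})"
    if "((\<lambda>s. components M ?d (\<gamma> s) (V s)) has_vector_derivative w) (at t within {0..1})" for w
    using field_chart_change[OF chart_at_atlas \<gamma>t chart_at_atlas chart_at_dom cont t ud that]
    by (simp add: A_def components_self) (simp add: components_eq)
  show ?thesis
  proof
    assume "has_covariant_derivative M D \<gamma> V 0 t"
    then obtain u' w where uw: "has_velocity M \<gamma> u' t"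
      "((\<lambda>s. components M ?d (\<gamma> s) (V s)) has_vector_derivative w) (at t within {0..1})"
      "0 = w + christoffel M D (\<gamma> t) u' (V t)"
      unfolding has_covariant_derivative_def by blast
    have "u' = u" using unique[OF _ ud] uw(1) by (simp add: has_velocity_def)
    then have "?\<kappa> w + ?\<kappa> ?chr = 0" using uw(3) linear_add[OF lin, of w ?chr] linear_0[OF lin] by simp
    then have "A + ?\<kappa> w = - coefficients (\<phi> (\<gamma> t)) (?\<kappa> u) (?\<kappa> (V t))"
      unfolding \<kappa>chr by (simp add: eq_neg_iff_add_eq_0 algebra_simps)
    then show "((\<lambda>s. comp_at (\<gamma> s) (V s)) has_vector_derivative
      - coefficients (\<phi> (\<gamma> t)) (?\<kappa> u) (?\<kappa> (V t))) (at t within {0..1})"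
      using change[OF uw(2)] by simp
  next
    assume *: "((\<lambda>s. comp_at (\<gamma> s) (V s)) has_vector_derivative
      - coefficients (\<phi> (\<gamma> t)) (?\<kappa> u) (?\<kappa> (V t))) (at t within {0..1})"
    \<comment> \<open>The derivative in the moving chart exists by the opposite change of chart; its
      value is then forced by uniqueness of derivatives.\<close>
    obtain w where w: "((\<lambda>s. components M ?d (\<gamma> s) (V s)) has_vector_derivative w) (at t within {0..1})"
      using field_chart_change[OF chart_at_atlas chart_at_dom chart_at_atlas \<gamma>t cont t has_velocity_chart[THEN iffD1, OF u] *] by blast
    have "A + ?\<kappa> w = - coefficients (\<phi> (\<gamma> t)) (?\<kappa> u) (?\<kappa> (V t))"
      by (rule unique[OF change[OF w] *])
    then have "?\<kappa> (w + ?chr) = 0"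
      unfolding linear_add[OF lin] \<kappa>chr by (simp add: eq_neg_iff_add_eq_0 algebra_simps)
    then have "w + ?chr = 0"
      using frame_comp_at[OF \<gamma>t, of "w + ?chr"] linear_0[OF linear_coordinate_field[of p "\<gamma> t"]] by simp
    then show "has_covariant_derivative M D \<gamma> V 0 t"
      unfolding has_covariant_derivative_def using u w by metis
  qed
qed

end

end

text \<open>The flow of \<open>radial_frame_exists\<close> for the chart at \<open>p\<close>: \<open>\<gamma> X\<close> is the geodesic with
  initial velocity \<open>X\<close>, \<open>V X\<close> its velocity and \<open>\<tau> X\<close> the parallel transport along it.\<close>

locale normal_flow = based_connection M D p
  for M :: "('m::{t2_space, second_countable_topology}, 'e::euclidean_space) manifold" and D :: "('m, 'e) connection"
    and p :: 'm +
  fixes \<rho> :: real and \<gamma> V :: "'e \<Rightarrow> real \<Rightarrow> 'e" and \<tau> :: "'e \<Rightarrow> real \<Rightarrow> 'e \<Rightarrow> 'e" and Q :: "'e \<Rightarrow> 'e \<Rightarrow>\<^sub>L 'e"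
  assumes \<rho>: "0 < \<rho>"
    and radial: "radial_frame (\<phi> ` dom) coefficients (ball 0 \<rho>) (\<lambda>X. \<gamma> X 1) (\<lambda>X. Blinfun (\<tau> X 1)) Q"
    and lin\<tau>: "linear (\<tau> X t)"
    and sol: "X \<in> ball 0 \<rho> \<Longrightarrow> chart.transport_solution {0..1} (\<gamma> X) (V X) (\<lambda>t. \<tau> X t v)"
    and init: "X \<in> ball 0 \<rho> \<Longrightarrow> \<gamma> X 0 = \<phi> p \<and> V X 0 = X \<and> \<tau> X 0 v = v"
    and rescale: "X \<in> ball 0 \<rho> \<Longrightarrow> s \<in> {0..1} \<Longrightarrow> \<gamma> (s *\<^sub>R X) 1 = \<gamma> X s"
begin

sublocale flow: radial_frame "\<phi> ` dom" coefficients "ball 0 \<rho>" "\<lambda>X. \<gamma> X 1" "\<lambda>X. Blinfun (\<tau> X 1)" Q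
  by (rule radial)

definition curve :: "'e \<Rightarrow> real \<Rightarrow> 'm" where "curve X t = chart_inv (chart_at M p) (\<gamma> X t)"

context
  fixes X :: 'e
  assumes X: "X \<in> ball 0 \<rho>"
begin

lemma \<gamma>_image: "t \<in> {0..1} \<Longrightarrow> \<gamma> X t \<in> \<phi> ` dom"
  by (rule chart.transport_solutionD(1)[OF sol[OF X]])

lemma curve_dom: "t \<in> {0..1} \<Longrightarrow> curve X t \<in> dom"
  using \<gamma>_image[of t] by (auto simp: curve_def inv_map)

lemma map_curve: "t \<in> {0..1} \<Longrightarrow> \<phi> (curve X t) = \<gamma> X t"
  by (simp only: curve_def map_inv[OF \<gamma>_image])

lemma curve_0: "curve X 0 = p"
  using init[OF X] by (simp add: curve_def inv_map chart_at_dom)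

lemma continuous_on_curve: "continuous_on {0..1} (curve X)"
proof -
  have c: "continuous_on {0..1} (\<gamma> X)"
    unfolding continuous_on_eq_continuous_within
    by (intro ballI has_vector_derivative_continuous[OF chart.transport_solutionD(2)[OF sol[OF X]]])
  have "continuous_on (\<phi> ` dom) (chart_inv (chart_at M p))"
    using chart_homeomorphism[OF chart_at_atlas] by (simp add: homeomorphism_def)
  then show ?thesis
    unfolding curve_def[abs_def] by (rule continuous_on_compose2[OF _ c]) (use \<gamma>_image in auto)
qed

context
  fixes \<beta> :: "real \<Rightarrow> 'm"
  assumes \<beta>: "\<And>t. t \<in> {0..1} \<Longrightarrow> \<beta> t = curve X t"
begin

lemma continuous_on_\<beta>: "continuous_on {0..1} \<beta>"
  using continuous_on_curve by (rule continuous_on_eq) (simp add: \<beta>)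

lemma \<beta>_dom: "t \<in> {0..1} \<Longrightarrow> \<beta> t \<in> dom"
  by (simp only: \<beta> curve_dom)

lemma map_\<beta>: "t \<in> {0..1} \<Longrightarrow> \<phi> (\<beta> t) = \<gamma> X t"
  by (simp only: \<beta> map_curve)

lemma \<beta>_continuous_within: "t \<in> {0..1} \<Longrightarrow> continuous (at t within {0..1}) \<beta>"
  using continuous_on_\<beta> continuous_on_eq_continuous_within by blast

lemma \<beta>_velocity:
  assumes t: "t \<in> {0..1}" shows "has_velocity M \<beta> (frame (V X t) (\<beta> t)) t"
  unfolding has_velocity_chart[OF t \<beta>_dom[OF t] \<beta>_continuous_within[OF t]] comp_at_frame[OF \<beta>_dom[OF t]]
  by (rule has_vector_derivative_transform[OF t _ chart.transport_solutionD(2)[OF sol[OF X] t]]) (rule map_\<beta>)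

text \<open>\<open>\<beta>\<close> is any curve that agrees with \<open>curve X\<close> on {0..1}.
  This covers the ray t |-> exp (t X) in the definition of radial transport, which is identified
  with \<open>curve X\<close> only at these times.\<close>

lemma parallel_along_\<beta>_iff:
  "parallel_along M D \<beta> Z \<longleftrightarrow> chart.transport_solution {0..1} (\<gamma> X) (V X) (\<lambda>t. comp_at (\<beta> t) (Z t))"
proof -
  have "has_covariant_derivative M D \<beta> Z 0 t \<longleftrightarrow> ((\<lambda>s. comp_at (\<beta> s) (Z s)) has_vector_derivative
      - coefficients (\<gamma> X t) (V X t) (comp_at (\<beta> t) (Z t))) (at t within {0..1})" if t: "t \<in> {0..1}" for t
    using has_covariant_derivative_chart[OF t \<beta>_dom[OF t] \<beta>_continuous_within[OF t] \<beta>_velocity[OF t], of Z]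
    by (simp only: map_\<beta>[OF t] comp_at_frame[OF \<beta>_dom[OF t]])
  then show ?thesis
    using sol[OF X] continuous_on_\<beta> unfolding parallel_along_def chart.transport_solution_def by auto
qed

lemma \<beta>_0: "\<beta> 0 = p"
  using \<beta>[of 0] curve_0 by simp

lemma parallel_along_\<beta>_end:
  assumes "parallel_along M D \<beta> Z" shows "Z 1 = frame (\<tau> X 1 (Z 0)) (\<beta> 1)"
proof -
  have "comp_at (\<beta> 0) (Z 0) = \<tau> X 0 (Z 0)"
    using init[OF X, of "Z 0"] by (simp add: \<beta>_0 components_self)
  then have "comp_at (\<beta> 1) (Z 1) = \<tau> X 1 (Z 0)"
    using chart.transport_solution_unique(3)[OF assms[unfolded parallel_along_\<beta>_iff] sol[OF X] convex_real_interval(5),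
      where s = 0 and t = 1] by simp
  then show ?thesis using frame_comp_at[OF \<beta>_dom, of 1 "Z 1"] by simp
qed

lemma parallel_along_\<beta>_exists:
  "parallel_along M D \<beta> (\<lambda>t. frame (\<tau> X t v) (\<beta> t))"
  unfolding parallel_along_\<beta>_iff
  by (rule chart.transport_solution_cong_field[OF sol[OF X, of v]]) (simp only: comp_at_frame[OF \<beta>_dom])

lemma frame_p: "frame v p = v"
  using frame_comp_at[OF chart_at_dom, of v] by (simp add: components_self)

lemma parallel_transport_\<beta>: "parallel_transport M D \<beta> v = frame (\<tau> X 1 v) (\<beta> 1)"
  unfolding parallel_transport_def
proof (rule the_equality)
  show "\<exists>Z. parallel_along M D \<beta> Z \<and> Z 0 = v \<and> Z 1 = frame (\<tau> X 1 v) (\<beta> 1)"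
    using parallel_along_\<beta>_exists[of v] init[OF X, of v]
    by (intro exI[of _ "\<lambda>t. frame (\<tau> X t v) (\<beta> t)"]) (simp add: \<beta>_0 frame_p)
  show "w = frame (\<tau> X 1 v) (\<beta> 1)" if "\<exists>Z. parallel_along M D \<beta> Z \<and> Z 0 = v \<and> Z 1 = w" for w
    using that parallel_along_\<beta>_end by auto
qed

end

lemma geodesic_curve: "geodesic_from M D p X (curve X)"
  unfolding geodesic_from_def
proof (intro conjI exI[of _ "\<lambda>t. frame (V X t) (curve X t)"] ballI curve_0)
  show "frame (V X 0) (curve X 0) = X" using init[OF X] frame_p[of "curve X"] by (simp add: curve_0)
  show "has_velocity M (curve X) (frame (V X t) (curve X t)) t" if "t \<in> {0..1}" for t
    by (rule \<beta>_velocity[OF refl that])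
  show "parallel_along M D (curve X) (\<lambda>t. frame (V X t) (curve X t))"
    unfolding parallel_along_\<beta>_iff[OF refl]
    by (rule chart.transport_solution_cong_field[OF chart.transport_solution_velocity[OF sol[OF X]]])
      (simp only: comp_at_frame[OF curve_dom])
qed

text \<open>A competing geodesic might leave the chart. Agreement of position and velocity is shown
  to be locally constant on {0..1}: inside the chart by uniqueness for the system, and outside
  because \<open>curve X\<close> stays in the chart, so that the two disagree there.\<close>

lemma geodesic_unique:
  assumes g: "geodesic_from M D p X g" and t: "t \<in> {0..1}"
  shows "g t = curve X t"
proof -
  obtain W where g0: "g 0 = p" and W: "W 0 = X" "\<And>t. t \<in> {0..1} \<Longrightarrow> has_velocity M g (W t) t"
    and par: "parallel_along M D g W"
    using g unfolding geodesic_from_def by blast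
  have contg: "continuous (at s within {0..1}) g" if "s \<in> {0..1}" for s
    using par that unfolding parallel_along_def continuous_on_eq_continuous_within by blast
  have cov: "has_covariant_derivative M D g W 0 s" if "s \<in> {0..1}" for s
    using par that unfolding parallel_along_def by blast
  define agree where "agree s \<longleftrightarrow> g s = curve X s \<and> W s = frame (V X s) (curve X s)" for s
  have "agree t"
  proof (rule connected_induction_simple[where S = "{0..1::real}" and P = agree, OF _ _ t])
    show "agree 0" using init[OF X] by (simp add: agree_def g0 W(1) curve_0 frame_p[of "curve X"])
    fix a :: real assume a: "a \<in> {0..1}"
    show "\<exists>T. openin (top_of_set {0..1}) T \<and> a \<in> T \<and> (\<forall>x\<in>T. \<forall>y\<in>T. agree x \<longrightarrow> agree y)"
    proof (cases "g a \<in> dom")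
      case True
      obtain \<delta> where \<delta>: "\<delta> > 0" "\<And>s. s \<in> {0..1} \<Longrightarrow> dist s a < \<delta> \<Longrightarrow> g s \<in> dom"
        by (rule curve_nearby[OF contg[OF a] open_dom True]) (rule that)
      define T where "T = {0..1} \<inter> ball a \<delta>"
      have T: "T \<subseteq> {0..1}" "convex T" by (auto simp: T_def intro!: convex_Int convex_real_interval convex_ball)
      have gT: "g s \<in> dom" "s \<in> {0..1}" if "s \<in> T" for s using that \<delta>(2)[of s] by (auto simp: T_def dist_commute)
      have solg: "chart.transport_solution T (\<lambda>s. \<phi> (g s)) (\<lambda>s. comp_at (g s) (W s)) (\<lambda>s. comp_at (g s) (W s))"
        unfolding chart.transport_solution_def
      proof (intro ballI)
        fix s assume s: "s \<in> T"
        note h = gT(2)[OF s] gT(1)[OF s] contg[OF gT(2)[OF s]]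
        note v = W(2)[OF gT(2)[OF s]]
        have v1: "((\<lambda>s. \<phi> (g s)) has_vector_derivative comp_at (g s) (W s)) (at s within {0..1})"
          using v unfolding has_velocity_chart[OF h] .
        have v2: "((\<lambda>s. comp_at (g s) (W s)) has_vector_derivative
            - coefficients (\<phi> (g s)) (comp_at (g s) (W s)) (comp_at (g s) (W s))) (at s within {0..1})"
          using cov[OF gT(2)[OF s]] unfolding has_covariant_derivative_chart[OF h v] .
        show "\<phi> (g s) \<in> \<phi> ` dom \<and> ((\<lambda>s. \<phi> (g s)) has_vector_derivative comp_at (g s) (W s)) (at s within T) \<and>
          ((\<lambda>s. comp_at (g s) (W s)) has_vector_derivative - coefficients (\<phi> (g s)) (comp_at (g s) (W s)) (comp_at (g s) (W s))) (at s within T) \<and>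
          ((\<lambda>s. comp_at (g s) (W s)) has_vector_derivative - coefficients (\<phi> (g s)) (comp_at (g s) (W s)) (comp_at (g s) (W s))) (at s within T)"
          using gT(1)[OF s] has_vector_derivative_within_subset[OF v1 T(1)] has_vector_derivative_within_subset[OF v2 T(1)] by blast
      qed
      note solX = chart.transport_solution_subset[OF chart.transport_solution_velocity[OF sol[OF X]] T(1)]
      have "agree y" if x: "x \<in> T" and y: "y \<in> T" and ax: "agree x" for x y
      proof -
        have "\<phi> (g x) = \<gamma> X x" "comp_at (g x) (W x) = V X x"
          using ax gT[OF x] by (simp_all add: agree_def map_curve comp_at_frame[OF curve_dom])
        then have "\<phi> (g y) = \<gamma> X y" "comp_at (g y) (W y) = V X y"
          using chart.transport_solution_unique(1,2)[OF solg solX T(2) x _ _ _ y] by simp_all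
        moreover have "g y = chart_inv (chart_at M p) (\<phi> (g y))" by (simp add: inv_map gT[OF y])
        ultimately show "agree y"
          using frame_comp_at[OF gT(1)[OF y], of "W y"] by (simp add: agree_def curve_def)
      qed
      moreover have "openin (top_of_set {0..1}) T" "a \<in> T"
        using \<delta>(1) a by (auto simp: T_def)
      ultimately show ?thesis by metis
    next
      case False
      \<comment> \<open>Compact sets are closed in a Hausdorff space, so disagreement persists near
        a time at which \<open>g\<close> is outside the chart domain.\<close>
      have "closed (curve X ` {0..1})"
        by (intro compact_imp_closed compact_continuous_image continuous_on_curve) simp
      then have op: "open (- curve X ` {0..1})" by (rule open_Compl)
      have na: "g a \<in> - curve X ` {0..1}" using False curve_dom by auto
      obtain \<delta> where \<delta>: "\<delta> > 0" "\<And>s. s \<in> {0..1} \<Longrightarrow> dist s a < \<delta> \<Longrightarrow> g s \<in> - curve X ` {0..1}"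
        by (rule curve_nearby[OF contg[OF a] op na]) (rule that)
      have "\<not> agree s" if "s \<in> {0..1} \<inter> ball a \<delta>" for s
        using \<delta>(2)[of s] that by (auto simp: agree_def dist_commute)
      moreover have "openin (top_of_set {0..1}) ({0..1} \<inter> ball a \<delta>)" "a \<in> {0..1} \<inter> ball a \<delta>"
        using \<delta>(1) a by auto
      ultimately show ?thesis by blast
    qed
  qed simp_all
  then show ?thesis by (simp add: agree_def)
qed

lemma in_exp_domain: "X \<in> exp_domain M D p"
  using geodesic_curve by (auto simp: exp_domain_def)

lemma exp_map_eq: "exp_map M D p X = curve X 1"
  unfolding exp_map_def
proof (rule the_equality)
  show "\<exists>g. geodesic_from M D p X g \<and> g 1 = curve X 1"
    by (intro exI[of _ "curve X"] conjI geodesic_curve refl)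
  fix q assume "\<exists>g. geodesic_from M D p X g \<and> g 1 = q"
  then obtain g where g: "geodesic_from M D p X g" "g 1 = q" by blast
  show "q = curve X 1" using geodesic_unique[OF g(1), of 1] g(2) by simp
qed

end

section \<open>The exponential map and both transports in terms of the flow\<close>

lemma star:
  fixes X :: 'e
  shows "X \<in> ball 0 \<rho> \<Longrightarrow> t \<in> {0..1} \<Longrightarrow> t *\<^sub>R X \<in> ball 0 \<rho>"
  using mult_left_le_one_le[of "norm X" t] by auto

lemma exp_map_ray:
  assumes X: "X \<in> ball 0 \<rho>" and t: "t \<in> {0..1}"
  shows "exp_map M D p (t *\<^sub>R X) = curve X t"
  unfolding exp_map_eq[OF star[OF X t]] curve_def rescale[OF X t] ..

lemma radial_transport_eq:
  assumes X: "X \<in> ball 0 \<rho>"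
  shows "radial_transport M D p X v = frame (Blinfun (\<tau> X 1) v) (curve X 1)"
  using parallel_transport_\<beta>[OF X, where \<beta> = "\<lambda>t. exp_map M D p (t *\<^sub>R X)", OF exp_map_ray[OF X]]
  by (simp add: radial_transport_def Blinfun_apply_linear[OF lin\<tau>] exp_map_eq[OF X])

lemma exp_differential_eq:
  assumes X: "X \<in> ball 0 \<rho>"
  shows "exp_differential M D p X v = frame (frechet_derivative (\<lambda>X. \<gamma> X 1) (at X) v) (curve X 1)"
proof -
  let ?q = "curve X 1" and ?d = "chart_at M (curve X 1)" and ?E = "\<lambda>X. \<gamma> X 1"
  have q: "?q \<in> dom" by (rule curve_dom[OF X]) simp
  have \<phi>q: "\<phi> ?q = ?E X" by (rule map_curve[OF X]) simp
  have "frechet_derivative (chart_map ?d \<circ> exp_map M D p) (at X) =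
    frechet_derivative (\<lambda>Y. (chart_map ?d \<circ> chart_inv (chart_at M p)) (?E Y)) (at X)"
    by (rule frechet_derivative_cong_open[OF open_ball X]) (simp add: exp_map_eq curve_def)
  moreover have "frechet_derivative (\<lambda>Y. (chart_map ?d \<circ> chart_inv (chart_at M p)) (?E Y)) (at X) v =
    frechet_derivative (chart_map ?d \<circ> chart_inv (chart_at M p)) (at (?E X)) (frechet_derivative ?E (at X) v)"
    using transition_differentiable[OF chart_at_atlas chart_at_atlas q chart_at_dom]
    by (intro frechet_derivative_compose_apply smooth_on_differentiable[OF flow.E(1) X]) (simp only: \<phi>q)
  ultimately show ?thesis
    unfolding exp_differential_def exp_map_eq[OF X] coordinate_field_eq[OF q] chart_change_def \<phi>q by simp
qed

text \<open>The chart chosen at exp X enters the differential and the transport through the same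
  factor \<open>frame\<close>, which cancels when the transport is inverted.\<close>

lemma backward_transport_eq:
  assumes X: "X \<in> ball 0 \<rho>"
  shows "backward_transport M D p X = flow.frame_transport X"
proof -
  let ?P = "Blinfun (\<tau> X 1)" and ?q = "curve X 1"
  have q: "?q \<in> dom" by (rule curve_dom[OF X]) simp
  have inv: "inv (radial_transport M D p X) (frame w ?q) = Q X w" for w
  proof (rule inv_f_eq)
    show "inj (radial_transport M D p X)"
    proof (rule injI)
      fix v w assume "radial_transport M D p X v = radial_transport M D p X w"
      then have "frame (?P v) ?q = frame (?P w) ?q" by (simp only: radial_transport_eq[OF X])
      then have "?P v = ?P w" by (metis comp_at_frame[OF q])
      then show "v = w" by (metis flow.QP[OF X])
    qed
    show "radial_transport M D p X (Q X w) = frame w ?q"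
      by (simp only: radial_transport_eq[OF X] flow.PQ[OF X])
  qed
  have "inv (radial_transport M D p X) \<circ> exp_differential M D p X = blinfun_apply (flow.frame_transport X)"
    by (rule ext) (simp add: exp_differential_eq[OF X] inv flow.frame_transport_apply[OF X])
  then show ?thesis unfolding backward_transport_def by (simp add: blinfun_apply_inverse)
qed

lemma backward_transport_characterization:
  shows "open (ball 0 \<rho>)" "0 \<in> ball 0 \<rho>" "ball 0 \<rho> \<subseteq> exp_domain M D p" "smooth_on (ball 0 \<rho>) (backward_transport M D p)"
    and "formal_power_series F \<and> F 0 = (\<lambda>_. id_blinfun) \<and> transport_equation M D p F \<longleftrightarrow>
      F = taylor_series (backward_transport M D p)"
proof -
  show "open (ball 0 \<rho>)" "0 \<in> ball 0 \<rho>" "ball 0 \<rho> \<subseteq> exp_domain M D p"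
    using \<rho> in_exp_domain by auto
  show "smooth_on (ball 0 \<rho>) (backward_transport M D p)"
    by (rule smooth_on_cong[OF open_ball backward_transport_eq[symmetric] flow.smooth_on_frame_transport])
  have "taylor_series (backward_transport M D p) = taylor_series flow.frame_transport"
    by (rule taylor_series_cong[OF flow.U backward_transport_eq])
  moreover have "\<gamma> 0 1 = \<phi> p"
    using rescale[OF flow.U(2), of 0] init[OF flow.U(2)] by simp
  ultimately show "formal_power_series F \<and> F 0 = (\<lambda>_. id_blinfun) \<and> transport_equation M D p F \<longleftrightarrow>
      F = taylor_series (backward_transport M D p)"
    using flow.frame_transport_characterization[of F]
    unfolding transport_equation_def curvature_series_eq torsion_series_eq
      flow.taylor_series_frame_curvature flow.taylor_series_frame_torsion by simp
qed

end

theorem lemma3p1: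
  fixes M :: "('m::{t2_space, second_countable_topology}, 'e::euclidean_space) manifold"
    and D :: "('m, 'e) connection"
    and p :: 'm
  assumes "affine_connection M D"
  shows "(\<exists>U. open U \<and> 0 \<in> U \<and> U \<subseteq> exp_domain M D p \<and> smooth_on U (backward_transport M D p)) \<and>
    (\<forall>F. formal_power_series F \<and> F 0 = (\<lambda>_. id_blinfun) \<and> transport_equation M D p F
         \<longleftrightarrow> F = taylor_series (backward_transport M D p))"
proof -
  interpret based_connection M D p using assms by (rule based_connection.intro)
  have "\<phi> p \<in> \<phi> ` dom" using chart_at_dom by simp
  then obtain \<rho> \<gamma> V \<tau> Q where "0 < \<rho>"
    "radial_frame (\<phi> ` dom) coefficients (ball 0 \<rho>) (\<lambda>X. \<gamma> X 1) (\<lambda>X. Blinfun (\<tau> X 1)) Q"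
    "\<And>X t. linear (\<tau> X t)"
    "\<And>X v. X \<in> ball 0 \<rho> \<Longrightarrow> chart.transport_solution {0..1} (\<gamma> X) (V X) (\<lambda>t. \<tau> X t v)"
    "\<And>X v. X \<in> ball 0 \<rho> \<Longrightarrow> \<gamma> X 0 = \<phi> p \<and> V X 0 = X \<and> \<tau> X 0 v = v"
    "\<And>X s. X \<in> ball 0 \<rho> \<Longrightarrow> s \<in> {0..1} \<Longrightarrow> \<gamma> (s *\<^sub>R X) 1 = \<gamma> X s"
    by (rule chart.radial_frame_exists) (rule that)
  then interpret normal_flow M D p \<rho> \<gamma> V \<tau> Q
    by (intro normal_flow.intro normal_flow_axioms.intro based_connection_axioms)
  show ?thesis using backward_transport_characterization by blast
qed

end
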